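(* Let $X$ be a compact metric space, $T\colon X\to X$ a homeomorphism, $\mu\in\mathcal{M}_T(X)$ a $T$-invariant Borel probability measure, and $\Xi\subseteq\mathbb{S}^1$ a subset. The following conditions are equivalent: (1) The measure $\mu$ is ergodic and $\operatorname{Spec}(X,T,\mu)\subseteq\Xi$. (2) There exists a Borel set $X'\subseteq X$ with $\mu(X')=1$ such that every $x\in X'$ is a Wiener--Wintner $\mu$-generic point and for every $f\in C(X)$ $$\|P_{\mathcal{K}}(f)\|_2^2=\sum_{\xi\in\Xi}|A[f,\bar\xi](x)|^2 .\qquad( * )$$ (3) There exist a $\mu$-generic point $x\in X$ and a countable dense set $\mathcal{D}\subseteq C(X)$ such that for every $f\in\mathcal{D}$ and every $\xi\in\Xi$ the sequence $(A_n[f,\bar\xi](x))_{n=1}^\infty$ converges, and equality $( * )$ holds for every $f\in\mathcal{D}$. (4) There is a Wiener--Wintner $\mu$-generic point $x\in X$ with $\operatorname{Freq}(x)\subseteq\Xi$.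
   Context: $\mathcal{M}_T(X)$ denotes the set of $T$-invariant Borel probability measures on $X$; $C(X)$ denotes the continuous functions $X\to\mathbb{C}$ with the sup norm; $\mathbb{S}^1=\{z\in\mathbb{C}:|z|=1\}$. A point $x\in X$ is generic for $\mu$ ($\mu$-generic) if $\frac1n\sum_{j=0}^{n-1}f(T^j(x))\to\int f\,d\mu$ for every $f\in C(X)$. For $f\in C(X)$, $\xi\in\mathbb{S}^1$, $n\ge1$ let $A_n[f,\bar\xi](x)=\frac1n\sum_{j=0}^{n-1}\xi^{-j}f(T^j(x))$, and let $A[f,\bar\xi](x)=\lim_{n\to\infty}A_n[f,\bar\xi](x)$ whenever the limit exists. A point $x$ is Fourier--Bohr $\mu$-generic if it is generic for $\mu$ and $A[f,\bar\xi](x)$ exists for every $f\in C(X)$ and every $\xi\in\mathbb{S}^1$. The set of frequencies of $x$ is $\operatorname{Freq}(x)=\{\xi\in\mathbb{S}^1:\ \limsup_{n\to\infty}|A_n[f,\bar\xi](x)|>0\text{ for some }f\in C(X)\}$. Let $U_T f=f\circ T$ be the Koopman operator on $L^2(X,\mu)$; $\operatorname{Spec}(X,T,\mu)\subseteq\mathbb{S}^1$ is the set of eigenvalues of $U_T$; $\mathcal{K}\subseteq L^2(X,\mu)$ is the closed linear span of all eigenfunctions of $U_T$, and $P_{\mathcal{K}}$ is the orthogonal projection of $L^2(X,\mu)$ onto $\mathcal{K}$. A Fourier--Bohr $\mu$-generic point $x$ is Wiener--Wintner $\mu$-generic if $\|P_{\mathcal{K}}(f)\|_2^2=\sum_{\xi\in\operatorname{Freq}(x)}|A[f,\bar\xi](x)|^2$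 for every $f\in C(X)$. Sums of nonnegative terms over possibly uncountable index sets are suprema of finite partial sums. *)

theory Defs
  imports "HOL-Probability.Probability"
begin

text \<open>
  The compact metric space \<open>X\<close> is a type \<open>'a :: metric_space\<close> with \<open>compact (UNIV :: 'a set)\<close>.
  Under this hypothesis every continuous function on \<open>'a\<close> is bounded, so \<open>'a \<Rightarrow>\<^sub>C complex\<close> is all
  of \<open>C(X)\<close>, and its metric is the one of the sup norm.
\<close>

definition invariant_measures :: "('a::metric_space \<Rightarrow> 'a) \<Rightarrow> 'a measure set" where
  "invariant_measures T = {M. prob_space M \<and> sets M = sets borel \<and> distr M borel T = M}"

definition ergodic :: "('a::metric_space \<Rightarrow> 'a) \<Rightarrow> 'a measure \<Rightarrow> bool" where
  "ergodic T M \<longleftrightarrow>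
     (\<forall>A\<in>sets M. T -` A \<inter> space M = A \<longrightarrow> emeasure M A = 0 \<or> emeasure M A = 1)"

definition generic_point :: "('a::metric_space \<Rightarrow> 'a) \<Rightarrow> 'a measure \<Rightarrow> 'a \<Rightarrow> bool" where
  "generic_point T M x \<longleftrightarrow>
     (\<forall>f :: 'a \<Rightarrow>\<^sub>C complex.
        (\<lambda>n. (\<Sum>j<n. f ((T ^^ j) x)) / of_nat n) \<longlonglongrightarrow> (\<integral>y. f y \<partial>M))"

text \<open>
  \<open>fb_avg T f \<xi> n x\<close> is \<open>A\<^sub>n[f, \<xi>\<^sup>-](x)\<close>: the weights are the negative powers of \<open>\<xi>\<close>.
  The value at \<open>n = 0\<close> is 0 and plays no role in limits.
\<close>

definition fb_avg ::
    "('a::metric_space \<Rightarrow> 'a) \<Rightarrow> ('a \<Rightarrow>\<^sub>C complex) \<Rightarrow> complex \<Rightarrow> nat \<Rightarrow> 'a \<Rightarrow> complex" where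
  "fb_avg T f \<xi> n x = (\<Sum>j<n. \<xi> powi (- int j) * f ((T ^^ j) x)) / of_nat n"

text \<open>Only meaningful where the averages converge.\<close>

definition fb_lim ::
    "('a::metric_space \<Rightarrow> 'a) \<Rightarrow> ('a \<Rightarrow>\<^sub>C complex) \<Rightarrow> complex \<Rightarrow> 'a \<Rightarrow> complex" where
  "fb_lim T f \<xi> x = lim (\<lambda>n. fb_avg T f \<xi> n x)"

definition fb_generic :: "('a::metric_space \<Rightarrow> 'a) \<Rightarrow> 'a measure \<Rightarrow> 'a \<Rightarrow> bool" where
  "fb_generic T M x \<longleftrightarrow>
     generic_point T M x \<and>
     (\<forall>f. \<forall>\<xi>\<in>sphere 0 1. convergent (\<lambda>n. fb_avg T f \<xi> n x))"

definition Freq :: "('a::metric_space \<Rightarrow> 'a) \<Rightarrow> 'a \<Rightarrow> complex set" where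
  "Freq T x = {\<xi>\<in>sphere 0 1. \<exists>f. limsup (\<lambda>n. ereal (cmod (fb_avg T f \<xi> n x))) > 0}"

text \<open>
  \<open>L\<^sup>2\<close> is represented by square-integrable functions rather than by their classes modulo
  a.e. equality. Hence \<open>L2_norm\<close> is a seminorm, eigenfunctions must not vanish a.e., and
  \<open>orth_proj\<close> is determined up to a.e. equality only (so its \<open>L2_norm\<close> is well defined).
\<close>

definition L2_space :: "'a measure \<Rightarrow> ('a \<Rightarrow> complex) set" where
  "L2_space M = {f \<in> borel_measurable M. integrable M (\<lambda>x. (cmod (f x))\<^sup>2)}"

definition L2_inner :: "'a measure \<Rightarrow> ('a \<Rightarrow> complex) \<Rightarrow> ('a \<Rightarrow> complex) \<Rightarrow> complex" where
  "L2_inner M f g = (\<integral>x. f x * cnj (g x) \<partial>M)"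

definition L2_norm :: "'a measure \<Rightarrow> ('a \<Rightarrow> complex) \<Rightarrow> real" where
  "L2_norm M f = sqrt (\<integral>x. (cmod (f x))\<^sup>2 \<partial>M)"

definition koopman :: "('a \<Rightarrow> 'a) \<Rightarrow> ('a \<Rightarrow> complex) \<Rightarrow> 'a \<Rightarrow> complex" where
  "koopman T f = f \<circ> T"

definition eigenfunction :: "('a \<Rightarrow> 'a) \<Rightarrow> 'a measure \<Rightarrow> complex \<Rightarrow> ('a \<Rightarrow> complex) \<Rightarrow> bool" where
  "eigenfunction T M \<xi> g \<longleftrightarrow>
     g \<in> L2_space M \<and> \<not> (AE x in M. g x = 0) \<and> (AE x in M. koopman T g x = \<xi> * g x)"

definition Spec :: "('a \<Rightarrow> 'a) \<Rightarrow> 'a measure \<Rightarrow> complex set" where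
  "Spec T M = {\<xi>. \<exists>g. eigenfunction T M \<xi> g}"

definition lin_span :: "('a \<Rightarrow> complex) set \<Rightarrow> ('a \<Rightarrow> complex) set" where
  "lin_span E = {h. \<exists>S c. finite S \<and> S \<subseteq> E \<and> h = (\<lambda>x. \<Sum>g\<in>S. c g * g x)}"

definition L2_closure :: "'a measure \<Rightarrow> ('a \<Rightarrow> complex) set \<Rightarrow> ('a \<Rightarrow> complex) set" where
  "L2_closure M V = {g \<in> L2_space M. \<forall>\<epsilon>>0. \<exists>h\<in>V. L2_norm M (\<lambda>x. g x - h x) < \<epsilon>}"

definition Kron :: "('a \<Rightarrow> 'a) \<Rightarrow> 'a measure \<Rightarrow> ('a \<Rightarrow> complex) set" where
  "Kron T M = L2_closure M (lin_span {g. \<exists>\<xi>. eigenfunction T M \<xi> g})"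

definition orth_proj ::
    "'a measure \<Rightarrow> ('a \<Rightarrow> complex) set \<Rightarrow> ('a \<Rightarrow> complex) \<Rightarrow> 'a \<Rightarrow> complex" where
  "orth_proj M V f = (SOME p. p \<in> V \<and> (\<forall>g\<in>V. L2_inner M (\<lambda>x. f x - p x) g = 0))"

definition nonneg_sum :: "('b \<Rightarrow> real) \<Rightarrow> 'b set \<Rightarrow> ennreal" where
  "nonneg_sum a I = (SUP F\<in>{F. finite F \<and> F \<subseteq> I}. ennreal (\<Sum>i\<in>F. a i))"

text \<open>\<open>\<parallel>P\<^sub>K f\<parallel>\<^sup>2 = \<Sum>\<xi>\<in>I. |A[f, \<xi>\<^sup>-](x)|\<^sup>2\<close>, where the sum may a priori be infinite.\<close>

definition spectral_identity ::
    "('a::metric_space \<Rightarrow> 'a) \<Rightarrow> 'a measure \<Rightarrow> complex set \<Rightarrow> 'a \<Rightarrow> ('a \<Rightarrow>\<^sub>C complex) \<Rightarrow> bool" where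
  "spectral_identity T M I x f \<longleftrightarrow>
     ennreal ((L2_norm M (orth_proj M (Kron T M) f))\<^sup>2) =
     nonneg_sum (\<lambda>\<xi>. (cmod (fb_lim T f \<xi> x))\<^sup>2) I"

definition ww_generic :: "('a::metric_space \<Rightarrow> 'a) \<Rightarrow> 'a measure \<Rightarrow> 'a \<Rightarrow> bool" where
  "ww_generic T M x \<longleftrightarrow>
     fb_generic T M x \<and> (\<forall>f. spectral_identity T M (Freq T x) x f)"

end

theory Submission
  imports Defs
begin

text \<open>
  For \<open>\<xi>\<close> on the unit circle let \<open>P\<^sub>\<xi>\<close> be the orthogonal projection of \<open>L\<^sup>2\<close> onto the eigenspace of
  the Koopman operator for \<open>\<xi>\<close>. All four conditions express that the Fourier-Bohr coefficients along an
  orbit are as large as the spectrum permits, and the proof rests on three facts.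

  \<^item> At every generic point \<open>x\<close> the coefficients obey the bound
    \<open>\<bar>A[f, \<xi>\<^sup>-](x)\<bar> \<le> \<parallel>P\<^sub>\<xi> f\<parallel>\<close> (\<open>generic_fb_avg_eventually_le\<close>, \<open>generic_fb_limit_le\<close>). Averages
    of \<open>f\<close> may be replaced by averages of \<open>F = A\<^sub>k[f, \<xi>\<^sup>-]\<close> for a fixed \<open>k\<close>; by the Cauchy-Schwarz
    inequality and genericity for \<open>\<bar>F\<bar>\<^sup>2\<close> they are asymptotically at most \<open>\<parallel>F\<parallel>\<close>, and the mean ergodic
    theorem brings \<open>\<parallel>F\<parallel>\<close> down to \<open>\<parallel>P\<^sub>\<xi> f\<parallel>\<close> as \<open>k\<close> grows.

  \<^item> \<open>\<parallel>P\<^sub>K f\<parallel>\<^sup>2\<close> is the sum of \<open>\<parallel>P\<^sub>\<xi> f\<parallel>\<^sup>2\<close> over the unit circle (\<open>Kron_Parseval\<close>).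

  \<^item> For an ergodic measure the bound is attained at almost every point, for all \<open>f\<close> and \<open>\<xi>\<close> at once
    (\<open>AE_sharp_limits\<close>). The twisted averages converge almost everywhere to
    \<open>P\<^sub>\<xi> f\<close> (\<open>twisted_avg_tendsto_eigen_proj\<close>), whose modulus is invariant, hence constant. For each
    \<open>f\<close> only countably many \<open>\<xi>\<close> have \<open>P\<^sub>\<xi> f \<noteq> 0\<close>, the others being covered by the bound at generic
    points, and \<open>C(X)\<close> is separable.

  If the measure is ergodic with spectrum in \<open>\<Xi>\<close>, then at almost every point Parseval's identity is the
  spectral identity, over \<open>\<Xi>\<close> as well as over the set of frequencies. Conversely,
  let the spectral identity over \<open>\<Xi>\<close> hold at a generic point for a dense set of \<open>f\<close>. Comparison
  with Parseval's identity term by term yields \<open>P\<^sub>\<xi> f = 0\<close> for \<open>\<xi> \<notin> \<Xi>\<close>, so that there are no eigenvalues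
  outside \<open>\<Xi>\<close>, and \<open>\<parallel>P\<^sub>1 f\<parallel> = \<bar>\<integral>f\<bar>\<close>, so that the invariant functions are constant
  (\<open>spectral_identity_imp_ergodic\<close>).
\<close>

section \<open>The semi-Hilbert space of square-integrable functions\<close>

lemma borel_measurable_cnj [measurable (raw)]:
  assumes "f \<in> borel_measurable M"
  shows "(\<lambda>x. cnj (f x)) \<in> borel_measurable M"
  using borel_measurable_continuous_onI[OF continuous_on_cnj[OF continuous_on_id]] assms
  by (rule measurable_compose_rev)

lemma L2_spaceD:
  assumes "f \<in> L2_space M"
  shows "f \<in> borel_measurable M" "integrable M (\<lambda>x. (cmod (f x))\<^sup>2)"
  using assms by (auto simp: L2_space_def)

lemma L2_space_integrable_mult:
  assumes "f \<in> L2_space M" "g \<in> L2_space M"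
  shows "integrable M (\<lambda>x. f x * cnj (g x))"
proof (rule Bochner_Integration.integrable_bound)
  show "integrable M (\<lambda>x. (cmod (f x))\<^sup>2 + (cmod (g x))\<^sup>2)"
    using assms by (auto simp: L2_space_def)
  note [measurable] = L2_spaceD(1)[OF assms(1)] L2_spaceD(1)[OF assms(2)]
  show "(\<lambda>x. f x * cnj (g x)) \<in> borel_measurable M" by measurable
  have "a * b \<le> a\<^sup>2 + b\<^sup>2" if "0 \<le> a" "0 \<le> b" for a b :: real
    using sum_squares_bound[of a b] mult_nonneg_nonneg[OF that] by linarith
  then show "AE x in M. norm (f x * cnj (g x)) \<le> norm ((cmod (f x))\<^sup>2 + (cmod (g x))\<^sup>2)"
    by (auto simp: norm_mult)
qed

lemma L2_space_add:
  assumes "f \<in> L2_space M" "g \<in> L2_space M"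
  shows "(\<lambda>x. f x + g x) \<in> L2_space M"
proof -
  note [measurable] = L2_spaceD(1)[OF assms(1)] L2_spaceD(1)[OF assms(2)]
  have "integrable M (\<lambda>x. (cmod (f x + g x))\<^sup>2)"
  proof (rule Bochner_Integration.integrable_bound)
    show "integrable M (\<lambda>x. 2 * (cmod (f x))\<^sup>2 + 2 * (cmod (g x))\<^sup>2)"
      using assms by (auto simp: L2_space_def)
    have "(cmod (a + b))\<^sup>2 \<le> 2 * (cmod a)\<^sup>2 + 2 * (cmod b)\<^sup>2" for a b
    proof -
      have "(cmod (a + b))\<^sup>2 \<le> (cmod a + cmod b)\<^sup>2"
        by (intro power_mono norm_triangle_ineq) auto
      also have "\<dots> \<le> 2 * (cmod a)\<^sup>2 + 2 * (cmod b)\<^sup>2"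
        using sum_squares_bound[of "cmod a" "cmod b"] by (simp add: power2_sum)
      finally show ?thesis .
    qed
    then show "AE x in M. norm ((cmod (f x + g x))\<^sup>2) \<le> norm (2 * (cmod (f x))\<^sup>2 + 2 * (cmod (g x))\<^sup>2)"
      by auto
  qed measurable
  then show ?thesis by (auto simp: L2_space_def)
qed

lemma L2_space_cmult:
  assumes "f \<in> L2_space M"
  shows "(\<lambda>x. c * f x) \<in> L2_space M"
  using assms by (auto simp: L2_space_def norm_mult power_mult_distrib)

lemma L2_space_diff:
  assumes "f \<in> L2_space M" "g \<in> L2_space M"
  shows "(\<lambda>x. f x - g x) \<in> L2_space M"
  using L2_space_add[OF assms(1) L2_space_cmult[OF assms(2), of "-1"]] by simp

lemma L2_space_zero: "(\<lambda>x. 0) \<in> L2_space M"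
  by (auto simp: L2_space_def)

lemma L2_space_sum:
  assumes "\<And>i. i \<in> I \<Longrightarrow> f i \<in> L2_space M"
  shows "(\<lambda>x. \<Sum>i\<in>I. f i x) \<in> L2_space M"
  using assms
  by (induction I rule: infinite_finite_induct) (auto intro: L2_space_zero L2_space_add)

lemmas L2_space_intros =
  L2_space_add L2_space_diff L2_space_cmult L2_space_zero L2_space_sum

lemma L2_inner_add_left:
  assumes "f \<in> L2_space M" "g \<in> L2_space M" "h \<in> L2_space M"
  shows "L2_inner M (\<lambda>x. f x + g x) h = L2_inner M f h + L2_inner M g h"
  unfolding L2_inner_def
  using L2_space_integrable_mult[OF assms(1,3)] L2_space_integrable_mult[OF assms(2,3)]
  by (simp add: distrib_right)

lemma L2_inner_cmult_left: "L2_inner M (\<lambda>x. c * f x) h = c * L2_inner M f h"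
  unfolding L2_inner_def by (simp add: mult.assoc)

lemma L2_inner_diff_left:
  assumes "f \<in> L2_space M" "g \<in> L2_space M" "h \<in> L2_space M"
  shows "L2_inner M (\<lambda>x. f x - g x) h = L2_inner M f h - L2_inner M g h"
  unfolding L2_inner_def
  using L2_space_integrable_mult[OF assms(1,3)] L2_space_integrable_mult[OF assms(2,3)]
  by (simp add: left_diff_distrib)

lemma L2_inner_commute: "L2_inner M f g = cnj (L2_inner M g f)"
proof -
  have "cnj (L2_inner M g f) = (\<integral>x. cnj (g x * cnj (f x)) \<partial>M)"
    unfolding L2_inner_def by (rule Bochner_Integration.integral_cnj[symmetric])
  also have "\<dots> = L2_inner M f g" by (simp add: L2_inner_def mult.commute)
  finally show ?thesis by simp
qed

lemma L2_inner_add_right: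
  assumes "f \<in> L2_space M" "g \<in> L2_space M" "h \<in> L2_space M"
  shows "L2_inner M h (\<lambda>x. f x + g x) = L2_inner M h f + L2_inner M h g"
  using L2_inner_add_left[OF assms] by (simp only: L2_inner_commute[of M h] complex_cnj_add)

lemma L2_inner_cmult_right: "L2_inner M h (\<lambda>x. c * f x) = cnj c * L2_inner M h f"
  by (simp only: L2_inner_commute[of M h] L2_inner_cmult_left complex_cnj_mult)

lemma L2_inner_diff_right:
  assumes "f \<in> L2_space M" "g \<in> L2_space M" "h \<in> L2_space M"
  shows "L2_inner M h (\<lambda>x. f x - g x) = L2_inner M h f - L2_inner M h g"
  using L2_inner_diff_left[OF assms] by (simp only: L2_inner_commute[of M h] complex_cnj_diff)

lemma L2_inner_sum_left:
  assumes "\<And>i. i \<in> I \<Longrightarrow> f i \<in> L2_space M" "h \<in> L2_space M"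
  shows "L2_inner M (\<lambda>x. \<Sum>i\<in>I. f i x) h = (\<Sum>i\<in>I. L2_inner M (f i) h)"
  using assms
proof (induction I rule: infinite_finite_induct)
  case (insert i I)
  then show ?case
    by (simp add: L2_inner_add_left L2_space_sum)
qed (auto simp: L2_inner_def)

lemma L2_inner_sum_right:
  assumes "\<And>i. i \<in> I \<Longrightarrow> f i \<in> L2_space M" "h \<in> L2_space M"
  shows "L2_inner M h (\<lambda>x. \<Sum>i\<in>I. f i x) = (\<Sum>i\<in>I. L2_inner M h (f i))"
  by (subst (1 2) L2_inner_commute) (simp add: L2_inner_sum_left assms)

lemma L2_inner_cong_AE:
  assumes "AE x in M. f x = f' x" "AE x in M. g x = g' x"
    "f \<in> borel_measurable M" "f' \<in> borel_measurable M"
    "g \<in> borel_measurable M" "g' \<in> borel_measurable M"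
  shows "L2_inner M f g = L2_inner M f' g'"
  unfolding L2_inner_def
proof (rule integral_cong_AE)
  note [measurable] = assms(3-6)
  show "(\<lambda>x. f x * cnj (g x)) \<in> borel_measurable M" "(\<lambda>x. f' x * cnj (g' x)) \<in> borel_measurable M"
    by measurable
  show "AE x in M. f x * cnj (g x) = f' x * cnj (g' x)"
    using assms(1,2) by eventually_elim simp
qed

lemma L2_norm_cong_AE:
  assumes "AE x in M. f x = f' x" "f \<in> borel_measurable M" "f' \<in> borel_measurable M"
  shows "L2_norm M f = L2_norm M f'"
proof -
  note [measurable] = assms(2,3)
  have "(\<integral>x. (cmod (f x))\<^sup>2 \<partial>M) = (\<integral>x. (cmod (f' x))\<^sup>2 \<partial>M)"
    by (rule integral_cong_AE) (use assms(1) in auto)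
  then show ?thesis by (simp add: L2_norm_def)
qed

lemma L2_norm_nonneg [simp]: "0 \<le> L2_norm M f"
  by (simp add: L2_norm_def)

lemma L2_norm_square: "(L2_norm M f)\<^sup>2 = (\<integral>x. (cmod (f x))\<^sup>2 \<partial>M)"
  by (simp add: L2_norm_def)

lemma L2_inner_self: "L2_inner M f f = of_real ((L2_norm M f)\<^sup>2)"
  unfolding L2_inner_def L2_norm_square
  by (simp add: complex_norm_square[symmetric] flip: integral_complex_of_real of_real_power)

lemma L2_norm_zero [simp]: "L2_norm M (\<lambda>x. 0) = 0"
  by (simp add: L2_norm_def)

lemma L2_norm_cmult: "L2_norm M (\<lambda>x. c * f x) = cmod c * L2_norm M f"
  by (simp add: L2_norm_def norm_mult power_mult_distrib real_sqrt_mult)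

lemma L2_norm_diff_commute: "L2_norm M (\<lambda>x. f x - g x) = L2_norm M (\<lambda>x. g x - f x)"
  by (simp add: L2_norm_def norm_minus_commute)

lemma L2_norm_eq_0_iff:
  assumes "f \<in> L2_space M"
  shows "L2_norm M f = 0 \<longleftrightarrow> (AE x in M. f x = 0)"
  using integral_nonneg_eq_0_iff_AE[OF L2_spaceD(2)[OF assms]] by (simp add: L2_norm_def)

lemma L2_norm_square_add:
  assumes "f \<in> L2_space M" "g \<in> L2_space M"
  shows "(L2_norm M (\<lambda>x. f x + g x))\<^sup>2
    = (L2_norm M f)\<^sup>2 + 2 * Re (L2_inner M f g) + (L2_norm M g)\<^sup>2"
proof -
  have "L2_inner M (\<lambda>x. f x + g x) (\<lambda>x. f x + g x)
    = L2_inner M f f + L2_inner M g g + (L2_inner M f g + L2_inner M g f)"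
    using assms
    by (simp add: L2_inner_add_left L2_inner_add_right L2_space_add algebra_simps)
  also have "L2_inner M g f = cnj (L2_inner M f g)" by (rule L2_inner_commute)
  finally have *: "L2_inner M (\<lambda>x. f x + g x) (\<lambda>x. f x + g x)
    = L2_inner M f f + L2_inner M g g + (L2_inner M f g + cnj (L2_inner M f g))" .
  from * have "of_real ((L2_norm M (\<lambda>x. f x + g x))\<^sup>2)
    = complex_of_real ((L2_norm M f)\<^sup>2 + 2 * Re (L2_inner M f g) + (L2_norm M g)\<^sup>2)"
    unfolding L2_inner_self complex_add_cnj by (simp add: algebra_simps)
  then show ?thesis unfolding of_real_eq_iff .
qed

lemma L2_norm_square_diff:
  assumes "f \<in> L2_space M" "g \<in> L2_space M"
  shows "(L2_norm M (\<lambda>x. f x - g x))\<^sup>2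
    = (L2_norm M f)\<^sup>2 - 2 * Re (L2_inner M f g) + (L2_norm M g)\<^sup>2"
  using L2_norm_square_add[OF assms(1) L2_space_cmult[OF assms(2), of "-1"]]
    L2_norm_cmult[of M "-1" g] L2_inner_cmult_right[of M f "-1" g]
  by simp

text \<open>The quadratic polynomial \<open>\<lambda>t. \<parallel>f - t \<langle>f, g\<rangle> g\<parallel>\<^sup>2\<close> underlies both the Cauchy-Schwarz
  inequality and the fact that a closest point is a foot of a perpendicular.\<close>

lemma L2_norm_square_diff_inner_multiple:
  assumes "f \<in> L2_space M" "g \<in> L2_space M"
  shows "(L2_norm M (\<lambda>x. f x - (of_real t * L2_inner M f g) * g x))\<^sup>2
    = (L2_norm M f)\<^sup>2 - (2 * t - t\<^sup>2 * (L2_norm M g)\<^sup>2) * (cmod (L2_inner M f g))\<^sup>2"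
proof -
  let ?c = "of_real t * L2_inner M f g"
  have "L2_inner M f (\<lambda>x. ?c * g x) = of_real t * (L2_inner M f g * cnj (L2_inner M f g))"
    by (subst L2_inner_cmult_right) simp
  also have "\<dots> = of_real (t * (cmod (L2_inner M f g))\<^sup>2)"
    by (simp only: complex_norm_square[symmetric] of_real_mult)
  finally have "Re (L2_inner M f (\<lambda>x. ?c * g x)) = t * (cmod (L2_inner M f g))\<^sup>2"
    by (simp only: Re_complex_of_real)
  moreover have "(L2_norm M (\<lambda>x. ?c * g x))\<^sup>2 = t\<^sup>2 * (cmod (L2_inner M f g))\<^sup>2 * (L2_norm M g)\<^sup>2"
    by (simp add: L2_norm_cmult norm_mult power_mult_distrib)
  ultimately show ?thesis
    using L2_norm_square_diff[OF assms(1) L2_space_cmult[OF assms(2), of ?c]]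
    by (simp add: algebra_simps)
qed

lemma L2_Cauchy_Schwarz:
  assumes "f \<in> L2_space M" "g \<in> L2_space M"
  shows "cmod (L2_inner M f g) \<le> L2_norm M f * L2_norm M g"
proof (cases "L2_norm M g = 0")
  case True
  then have "AE x in M. g x = 0" using L2_norm_eq_0_iff assms by blast
  then have "L2_inner M f g = L2_inner M f (\<lambda>x. 0)"
    using assms by (intro L2_inner_cong_AE) (auto simp: L2_space_def)
  then show ?thesis by (simp add: L2_inner_def)
next
  case False
  define b where "b = (L2_norm M g)\<^sup>2"
  have b: "b > 0" using False by (simp add: b_def)
  have "0 \<le> (L2_norm M f)\<^sup>2 - (2 * (1/b) - (1/b)\<^sup>2 * b) * (cmod (L2_inner M f g))\<^sup>2"
    unfolding b_def L2_norm_square_diff_inner_multiple[OF assms, of "1/(L2_norm M g)\<^sup>2", symmetric]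
    by (rule zero_le_power2)
  also have "2 * (1/b) - (1/b)\<^sup>2 * b = 1/b" using b by (simp add: power2_eq_square)
  finally have "(cmod (L2_inner M f g))\<^sup>2 / b \<le> (L2_norm M f)\<^sup>2" by simp
  then have "(cmod (L2_inner M f g))\<^sup>2 \<le> (L2_norm M f)\<^sup>2 * b"
    using b by (simp add: pos_divide_le_eq)
  then have "(cmod (L2_inner M f g))\<^sup>2 \<le> (L2_norm M f * L2_norm M g)\<^sup>2"
    by (simp only: b_def power_mult_distrib)
  then show ?thesis by (rule power2_le_imp_le) simp
qed

lemma L2_norm_triangle:
  assumes "f \<in> L2_space M" "g \<in> L2_space M"
  shows "L2_norm M (\<lambda>x. f x + g x) \<le> L2_norm M f + L2_norm M g"
proof (rule power2_le_imp_le)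
  have "Re (L2_inner M f g) \<le> L2_norm M f * L2_norm M g"
    using L2_Cauchy_Schwarz[OF assms] complex_Re_le_cmod order_trans by blast
  then show "(L2_norm M (\<lambda>x. f x + g x))\<^sup>2 \<le> (L2_norm M f + L2_norm M g)\<^sup>2"
    by (simp add: L2_norm_square_add[OF assms] power2_sum)
qed simp

lemma L2_norm_triangle_diff:
  assumes "f \<in> L2_space M" "g \<in> L2_space M"
  shows "L2_norm M (\<lambda>x. f x - g x) \<le> L2_norm M f + L2_norm M g"
  using L2_norm_triangle[OF assms(1) L2_space_cmult[OF assms(2), of "-1"]]
    L2_norm_cmult[of M "-1" g] by simp

lemma L2_norm_triangle_diff_trans:
  assumes "f \<in> L2_space M" "g \<in> L2_space M" "h \<in> L2_space M"
  shows "L2_norm M (\<lambda>x. f x - h x) \<le> L2_norm M (\<lambda>x. f x - g x) + L2_norm M (\<lambda>x. g x - h x)"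
  using L2_norm_triangle[OF L2_space_diff[OF assms(1,2)] L2_space_diff[OF assms(2,3)]] by simp

lemma L2_norm_reverse_triangle:
  assumes "f \<in> L2_space M" "g \<in> L2_space M"
  shows "\<bar>L2_norm M f - L2_norm M g\<bar> \<le> L2_norm M (\<lambda>x. f x - g x)"
proof -
  have "L2_norm M f \<le> L2_norm M (\<lambda>x. f x - g x) + L2_norm M g"
    using L2_norm_triangle[OF L2_space_diff[OF assms] assms(2)] by simp
  moreover have "L2_norm M g \<le> L2_norm M (\<lambda>x. f x - g x) + L2_norm M f"
    using L2_norm_triangle[OF L2_space_diff[OF assms(2,1)] assms(1)]
    by (simp add: L2_norm_diff_commute[of M f g])
  ultimately show ?thesis by simp
qed

lemma L2_norm_sum_le:
  assumes "\<And>i. i \<in> I \<Longrightarrow> f i \<in> L2_space M"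
  shows "L2_norm M (\<lambda>x. \<Sum>i\<in>I. f i x) \<le> (\<Sum>i\<in>I. L2_norm M (f i))"
  using assms
proof (induction I rule: infinite_finite_induct)
  case (insert i I)
  then show ?case
    using L2_norm_triangle[of "f i" M "\<lambda>x. \<Sum>i\<in>I. f i x"] L2_space_sum[of I f M] by auto
qed auto

lemma L2_pythagoras:
  assumes "f \<in> L2_space M" "g \<in> L2_space M" "L2_inner M f g = 0"
  shows "(L2_norm M (\<lambda>x. f x + g x))\<^sup>2 = (L2_norm M f)\<^sup>2 + (L2_norm M g)\<^sup>2"
  using L2_norm_square_add[OF assms(1,2)] assms(3) by simp

lemma (in prob_space) L2_norm_bounded:
  assumes "f \<in> borel_measurable M" "\<And>x. x \<in> space M \<Longrightarrow> cmod (f x) \<le> B" "0 \<le> B"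
  shows "f \<in> L2_space M" "L2_norm M f \<le> B"
proof -
  note [measurable] = assms(1)
  have le: "(cmod (f x))\<^sup>2 \<le> B\<^sup>2" if "x \<in> space M" for x
    using assms(2)[OF that] by (intro power_mono) auto
  have int: "integrable M (\<lambda>x. (cmod (f x))\<^sup>2)"
    by (rule integrable_const_bound[where B="B\<^sup>2"]) (use le in auto)
  then show "f \<in> L2_space M" by (simp add: L2_space_def)
  have "(L2_norm M f)\<^sup>2 \<le> (\<integral>x. B\<^sup>2 \<partial>M)"
    unfolding L2_norm_square using int le by (intro integral_mono) auto
  also have "\<dots> = B\<^sup>2" by (simp add: prob_space)
  finally show "L2_norm M f \<le> B" using assms(3) by (rule power2_le_imp_le)
qed

lemma (in prob_space) L2_space_const: "(\<lambda>x. c) \<in> L2_space M"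
  by (auto simp: L2_space_def)

lemma (in prob_space) L2_space_integrable:
  assumes "f \<in> L2_space M"
  shows "integrable M f"
  using L2_space_integrable_mult[OF assms L2_space_const[of 1]] by simp

text \<open>The Cauchy-Schwarz inequality against the constant function 1.\<close>

lemma (in prob_space) L1_norm_le_L2_norm:
  assumes "f \<in> L2_space M"
  shows "(\<integral>x. cmod (f x) \<partial>M) \<le> L2_norm M f"
proof -
  have abs: "(\<lambda>x. of_real (cmod (f x))) \<in> L2_space M" using assms by (auto simp: L2_space_def)
  have one: "L2_norm M (\<lambda>x. 1) = 1" by (simp add: L2_norm_def prob_space)
  have "cmod (L2_inner M (\<lambda>x. of_real (cmod (f x))) (\<lambda>x. 1)) \<le> L2_norm M (\<lambda>x. of_real (cmod (f x)))"
    using L2_Cauchy_Schwarz[OF abs L2_space_const[of 1]] one by simp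
  moreover have "L2_inner M (\<lambda>x. of_real (cmod (f x))) (\<lambda>x. 1) = of_real (\<integral>x. cmod (f x) \<partial>M)"
    by (simp add: L2_inner_def)
  moreover have "L2_norm M (\<lambda>x. of_real (cmod (f x))) = L2_norm M f"
    by (simp add: L2_norm_def)
  ultimately show ?thesis by simp
qed

section \<open>Completeness and orthogonal projections\<close>

text \<open>The Riesz-Fischer theorem in the form in which it is applied: a sequence whose
  oscillation is summable converges. Since the measure is finite, the increments are summable in
  \<open>L\<^sup>1\<close>, so the sequence converges almost everywhere; Fatou's lemma then
  turns the Cauchy estimate into an estimate for the distance to the limit.\<close>

lemma (in prob_space) L2_fast_Cauchy_convergent:
  fixes u :: "nat \<Rightarrow> 'a \<Rightarrow> complex"
  assumes u: "\<And>n. u n \<in> L2_space M" and e: "summable e"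
    and le: "\<And>m n. n \<le> m \<Longrightarrow> L2_norm M (\<lambda>x. u m x - u n x) \<le> e n"
  shows "\<exists>v\<in>L2_space M. \<forall>n. L2_norm M (\<lambda>x. u n x - v x) \<le> e n"
proof -
  have [measurable]: "u n \<in> borel_measurable M" for n using L2_spaceD(1)[OF u] .
  have e0: "0 \<le> e n" for n using le[of n n] L2_norm_nonneg order_trans by fastforce
  have diff: "(\<lambda>x. u m x - u n x) \<in> L2_space M" for m n
    by (intro L2_space_diff u)
  have "(\<integral>\<^sup>+x. (\<Sum>n. ennreal (cmod (u (Suc n) x - u n x))) \<partial>M)
      = (\<Sum>n. \<integral>\<^sup>+x. ennreal (cmod (u (Suc n) x - u n x)) \<partial>M)"
    by (rule nn_integral_suminf) measurable
  also have "\<dots> \<le> (\<Sum>n. ennreal (e n))"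
  proof (intro suminf_le summableI)
    fix n
    have "(\<integral>\<^sup>+x. ennreal (cmod (u (Suc n) x - u n x)) \<partial>M)
        = ennreal (\<integral>x. cmod (u (Suc n) x - u n x) \<partial>M)"
      using L2_space_integrable[OF diff] by (intro nn_integral_eq_integral) auto
    also have "\<dots> \<le> ennreal (e n)"
      using L1_norm_le_L2_norm[OF diff[of "Suc n" n]] le[of n "Suc n"] by (intro ennreal_leI) auto
    finally show "(\<integral>\<^sup>+x. ennreal (cmod (u (Suc n) x - u n x)) \<partial>M) \<le> ennreal (e n)" .
  qed
  also have "\<dots> = ennreal (\<Sum>n. e n)"
    using e e0 by (intro suminf_ennreal2) auto
  finally have "(\<integral>\<^sup>+x. (\<Sum>n. ennreal (cmod (u (Suc n) x - u n x))) \<partial>M) \<noteq> \<infinity>"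
    by (auto simp: top_unique)
  then have "AE x in M. (\<Sum>n. ennreal (cmod (u (Suc n) x - u n x))) \<noteq> \<infinity>"
    by (intro nn_integral_PInf_AE) measurable
  then have conv: "AE x in M. convergent (\<lambda>n. u n x)"
  proof eventually_elim
    fix x assume "(\<Sum>n. ennreal (cmod (u (Suc n) x - u n x))) \<noteq> \<infinity>"
    then have "summable (\<lambda>n. cmod (u (Suc n) x - u n x))"
      by (intro summable_suminf_not_top) auto
    then have "summable (\<lambda>n. u (Suc n) x - u n x)" by (rule summable_norm_cancel)
    then have "convergent (\<lambda>n. u n x - u 0 x)"
      unfolding summable_iff_convergent by (simp only: sum_lessThan_telescope[of "\<lambda>n. u n x"])
    from convergent_add[OF this convergent_const[of "u 0 x"]]
    show "convergent (\<lambda>n. u n x)" by simp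
  qed
  define v where "v = (\<lambda>x. lim (\<lambda>n. u n x))"
  have [measurable]: "v \<in> borel_measurable M"
    unfolding v_def by (rule borel_measurable_lim_metric) measurable
  have bound: "(\<integral>\<^sup>+x. ennreal ((cmod (u n x - v x))\<^sup>2) \<partial>M) \<le> ennreal ((e n)\<^sup>2)" for n
  proof -
    have "AE x in M. liminf (\<lambda>m. ennreal ((cmod (u n x - u m x))\<^sup>2)) = ennreal ((cmod (u n x - v x))\<^sup>2)"
      using conv
    proof eventually_elim
      fix x assume "convergent (\<lambda>n. u n x)"
      then have "(\<lambda>n. u n x) \<longlonglongrightarrow> v x" by (simp add: v_def convergent_LIMSEQ_iff)
      then have "(\<lambda>m. ennreal ((cmod (u n x - u m x))\<^sup>2)) \<longlonglongrightarrow> ennreal ((cmod (u n x - v x))\<^sup>2)"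
        by (intro tendsto_intros)
      then show "liminf (\<lambda>m. ennreal ((cmod (u n x - u m x))\<^sup>2)) = ennreal ((cmod (u n x - v x))\<^sup>2)"
        by (rule lim_imp_Liminf[rotated]) simp
    qed
    then have "(\<integral>\<^sup>+x. ennreal ((cmod (u n x - v x))\<^sup>2) \<partial>M)
      = (\<integral>\<^sup>+x. liminf (\<lambda>m. ennreal ((cmod (u n x - u m x))\<^sup>2)) \<partial>M)"
      by (intro nn_integral_cong_AE) (auto elim: eventually_mono)
    also have "\<dots> \<le> liminf (\<lambda>m. \<integral>\<^sup>+x. ennreal ((cmod (u n x - u m x))\<^sup>2) \<partial>M)"
      by (rule nn_integral_liminf) measurable
    also have "\<dots> \<le> liminf (\<lambda>m. ennreal ((e n)\<^sup>2))"
    proof (rule Liminf_mono)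
      show "\<forall>\<^sub>F m in sequentially. (\<integral>\<^sup>+x. ennreal ((cmod (u n x - u m x))\<^sup>2) \<partial>M) \<le> ennreal ((e n)\<^sup>2)"
        using eventually_ge_at_top[of n]
      proof eventually_elim
        fix m assume "n \<le> m"
        have "(\<integral>\<^sup>+x. ennreal ((cmod (u n x - u m x))\<^sup>2) \<partial>M) = ennreal ((L2_norm M (\<lambda>x. u n x - u m x))\<^sup>2)"
          unfolding L2_norm_square using L2_spaceD(2)[OF diff]
          by (intro nn_integral_eq_integral) auto
        also have "\<dots> \<le> ennreal ((e n)\<^sup>2)"
          using le[OF \<open>n \<le> m\<close>] by (intro ennreal_leI power_mono) (simp_all add: L2_norm_diff_commute[of M "u n" "u m"])
        finally show "(\<integral>\<^sup>+x. ennreal ((cmod (u n x - u m x))\<^sup>2) \<partial>M) \<le> ennreal ((e n)\<^sup>2)" .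
      qed
    qed
    also have "\<dots> = ennreal ((e n)\<^sup>2)" by (simp add: Liminf_const)
    finally show ?thesis .
  qed
  have uv: "(\<lambda>x. u n x - v x) \<in> L2_space M" for n
    unfolding L2_space_def
    using bound[of n] by (auto intro!: integrableI_bounded simp: ennreal_less_top le_less_trans)
  have "(\<lambda>x. u 0 x - (u 0 x - v x)) \<in> L2_space M" by (intro L2_space_diff u uv)
  then have "v \<in> L2_space M" by simp
  moreover have "L2_norm M (\<lambda>x. u n x - v x) \<le> e n" for n
  proof -
    have "ennreal ((L2_norm M (\<lambda>x. u n x - v x))\<^sup>2) = (\<integral>\<^sup>+x. ennreal ((cmod (u n x - v x))\<^sup>2) \<partial>M)"
      unfolding L2_norm_square using L2_spaceD(2)[OF uv]
      by (intro nn_integral_eq_integral[symmetric]) auto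
    with bound[of n] have "ennreal ((L2_norm M (\<lambda>x. u n x - v x))\<^sup>2) \<le> ennreal ((e n)\<^sup>2)"
      by (simp only:)
    then have "(L2_norm M (\<lambda>x. u n x - v x))\<^sup>2 \<le> (e n)\<^sup>2" by (subst (asm) ennreal_le_iff) auto
    then show ?thesis by (rule power2_le_imp_le) (rule e0)
  qed
  ultimately show ?thesis by blast
qed

definition L2_subspace :: "'a measure \<Rightarrow> ('a \<Rightarrow> complex) set \<Rightarrow> bool" where
  "L2_subspace M V \<longleftrightarrow> V \<subseteq> L2_space M \<and> (\<lambda>x. 0) \<in> V \<and>
     (\<forall>f\<in>V. \<forall>g\<in>V. (\<lambda>x. f x + g x) \<in> V) \<and> (\<forall>c. \<forall>f\<in>V. (\<lambda>x. c * f x) \<in> V)"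

lemma L2_subspaceD:
  assumes "L2_subspace M V"
  shows "f \<in> V \<Longrightarrow> f \<in> L2_space M" "(\<lambda>x. 0) \<in> V"
    "f \<in> V \<Longrightarrow> g \<in> V \<Longrightarrow> (\<lambda>x. f x + g x) \<in> V"
    "f \<in> V \<Longrightarrow> (\<lambda>x. c * f x) \<in> V"
  using assms by (auto simp: L2_subspace_def)

lemma L2_closure_superset:
  assumes "L2_subspace M V" "f \<in> V"
  shows "f \<in> L2_closure M V"
  using L2_subspaceD(1)[OF assms] assms(2)
  by (auto simp: L2_closure_def intro!: bexI[of _ f])

lemma L2_closure_orthogonal:
  assumes V: "L2_subspace M V" and w: "w \<in> L2_space M"
    and orth: "\<And>v. v \<in> V \<Longrightarrow> L2_inner M w v = 0" and g: "g \<in> L2_closure M V"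
  shows "L2_inner M w g = 0"
proof -
  have g2: "g \<in> L2_space M" using g by (simp add: L2_closure_def)
  have "cmod (L2_inner M w g) \<le> 0 + e" if "e > 0" for e
  proof -
    define d where "d = e / (L2_norm M w + 1)"
    have pos: "0 < L2_norm M w + 1" by (simp add: add_nonneg_pos)
    then have "d > 0" using that by (simp add: d_def)
    then obtain h where h: "h \<in> V" "L2_norm M (\<lambda>x. g x - h x) < d"
      using g by (auto simp: L2_closure_def)
    have h2: "h \<in> L2_space M" using L2_subspaceD(1)[OF V h(1)] .
    have "L2_inner M w g = L2_inner M w (\<lambda>x. g x - h x)"
      using L2_inner_diff_right[OF g2 h2 w] orth[OF h(1)] by simp
    then have "cmod (L2_inner M w g) \<le> L2_norm M w * L2_norm M (\<lambda>x. g x - h x)"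
      using L2_Cauchy_Schwarz[OF w L2_space_diff[OF g2 h2]] by simp
    also have "\<dots> \<le> (L2_norm M w + 1) * d"
      using h(2) by (intro mult_mono) auto
    also have "\<dots> = e" using pos by (simp add: d_def)
    finally show ?thesis by simp
  qed
  then have "cmod (L2_inner M w g) \<le> 0" by (rule field_le_epsilon)
  then show ?thesis by simp
qed

text \<open>The projection theorem: by the parallelogram identity a minimizing sequence for the
  distance from \<open>f\<close> to \<open>V\<close> is Cauchy, and its limit is the foot of the perpendicular.\<close>

lemma (in prob_space) orthogonal_decomposition:
  assumes V: "L2_subspace M V" and f: "f \<in> L2_space M"
  shows "\<exists>p\<in>L2_closure M V. \<forall>g\<in>L2_closure M V. L2_inner M (\<lambda>x. f x - p x) g = 0"
proof -
  note V2 = L2_subspaceD(1)[OF V]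
  define d where "d = (INF v\<in>V. L2_norm M (\<lambda>x. f x - v x))"
  have bdd: "bdd_below ((\<lambda>v. L2_norm M (\<lambda>x. f x - v x)) ` V)"
    by (rule bdd_belowI[of _ 0]) auto
  have d_le: "d \<le> L2_norm M (\<lambda>x. f x - v x)" if "v \<in> V" for v
    unfolding d_def using that bdd by (rule cINF_lower[rotated])
  have ne: "V \<noteq> {}" using L2_subspaceD(2)[OF V] by auto
  then have d0: "0 \<le> d" unfolding d_def by (intro cINF_greatest) auto
  \<comment> \<open>An excess of \<open>4\<^sup>-\<^sup>n\<close> in the squares bounds the oscillation of the sequence by
    \<open>2 * 2\<^sup>-\<^sup>n\<close>, which is summable.\<close>
  have "\<exists>v\<in>V. (L2_norm M (\<lambda>x. f x - v x))\<^sup>2 \<le> d\<^sup>2 + (1/4)^n" for n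
  proof -
    have "d < sqrt (d\<^sup>2 + (1/4)^n)" by (rule real_less_rsqrt) simp
    then obtain v where v: "v \<in> V" "L2_norm M (\<lambda>x. f x - v x) < sqrt (d\<^sup>2 + (1/4)^n)"
      unfolding d_def using cINF_less_iff[OF ne bdd] by blast
    have "(L2_norm M (\<lambda>x. f x - v x))\<^sup>2 \<le> (sqrt (d\<^sup>2 + (1/4)^n))\<^sup>2"
      using v(2) by (intro power_mono) auto
    then show ?thesis using v(1) by (intro bexI[of _ v]) auto
  qed
  then obtain v where v: "\<And>n. v n \<in> V"
    and vd: "\<And>n. (L2_norm M (\<lambda>x. f x - v n x))\<^sup>2 \<le> d\<^sup>2 + (1/4)^n"
    by metis
  have fv: "(\<lambda>x. f x - v n x) \<in> L2_space M" for n by (intro L2_space_diff f V2 v)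
  define e :: "nat \<Rightarrow> real" where "e n = 2 * (1/2)^n" for n
  have cauchy: "L2_norm M (\<lambda>x. v m x - v n x) \<le> e n" if "n \<le> m" for m n
  proof -
    let ?a = "\<lambda>x. f x - v n x" and ?b = "\<lambda>x. f x - v m x"
    have "(\<lambda>x. (1/2) * (v n x + v m x)) \<in> V" by (intro L2_subspaceD[OF V] v)
    from d_le[OF this] have "d\<^sup>2 \<le> (L2_norm M (\<lambda>x. f x - (1/2) * (v n x + v m x)))\<^sup>2"
      using d0 by (intro power_mono)
    moreover have "L2_norm M (\<lambda>x. ?a x + ?b x) = 2 * L2_norm M (\<lambda>x. f x - (1/2) * (v n x + v m x))"
      using L2_norm_cmult[of M 2 "\<lambda>x. f x - (1/2) * (v n x + v m x)"] by (simp add: algebra_simps)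
    ultimately have "4 * d\<^sup>2 \<le> (L2_norm M (\<lambda>x. ?a x + ?b x))\<^sup>2" by (simp add: power_mult_distrib)
    moreover have "(L2_norm M (\<lambda>x. ?a x + ?b x))\<^sup>2 + (L2_norm M (\<lambda>x. ?a x - ?b x))\<^sup>2
      = 2 * (L2_norm M ?a)\<^sup>2 + 2 * (L2_norm M ?b)\<^sup>2"
      using L2_norm_square_add[OF fv fv, of n m] L2_norm_square_diff[OF fv fv, of n m] by linarith
    moreover have "(1/4::real)^m \<le> (1/4)^n" using that by (intro power_decreasing) auto
    ultimately have "(L2_norm M (\<lambda>x. ?a x - ?b x))\<^sup>2 \<le> 4 * (1/4)^n"
      using vd[of n] vd[of m] by linarith
    also have "\<dots> = (e n)\<^sup>2"
      by (simp add: e_def power_mult_distrib power2_eq_square flip: power_mult_distrib)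
    finally have "L2_norm M (\<lambda>x. ?a x - ?b x) \<le> e n"
      by (rule power2_le_imp_le) (simp add: e_def)
    then show ?thesis by simp
  qed
  have "summable e" unfolding e_def by (intro summable_mult summable_geometric) auto
  from L2_fast_Cauchy_convergent[OF V2[OF v] this cauchy]
  obtain p where p: "p \<in> L2_space M" and vp: "\<And>n. L2_norm M (\<lambda>x. v n x - p x) \<le> e n"
    by blast
  have e_lim: "e \<longlonglongrightarrow> 0"
    unfolding e_def by (rule tendsto_mult_right_zero) (auto intro: LIMSEQ_power_zero)
  have p_closure: "p \<in> L2_closure M V"
    unfolding L2_closure_def
  proof (intro CollectI conjI p allI impI)
    fix \<epsilon> :: real assume "\<epsilon> > 0"
    then have "\<forall>\<^sub>F n in sequentially. e n < \<epsilon>" using e_lim by (intro order_tendstoD)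
    then obtain n where "e n < \<epsilon>" by (auto dest: eventually_happens)
    then show "\<exists>h\<in>V. L2_norm M (\<lambda>x. p x - h x) < \<epsilon>"
      using vp[of n] v[of n] L2_norm_diff_commute[of M p "v n"] by (intro bexI[of _ "v n"]) auto
  qed
  have fp: "(\<lambda>x. f x - p x) \<in> L2_space M" by (intro L2_space_diff f p)
  have close: "L2_norm M (\<lambda>x. f x - p x) \<le> d"
  proof (rule power2_le_imp_le[OF _ d0], rule LIMSEQ_le_const)
    show "(\<lambda>n. (sqrt (d\<^sup>2 + (1/4)^n) + e n)\<^sup>2) \<longlonglongrightarrow> d\<^sup>2"
    proof -
      have "(\<lambda>n. (sqrt (d\<^sup>2 + (1/4)^n) + e n)\<^sup>2) \<longlonglongrightarrow> (sqrt (d\<^sup>2 + 0) + 0)\<^sup>2"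
        by (intro tendsto_intros e_lim LIMSEQ_power_zero) simp
      then show ?thesis using d0 by simp
    qed
    have "L2_norm M (\<lambda>x. f x - p x) \<le> sqrt (d\<^sup>2 + (1/4)^n) + e n" for n
      using L2_norm_triangle_diff_trans[OF f V2[OF v] p, of n] vp[of n] real_le_rsqrt[OF vd[of n]]
      by linarith
    then show "\<exists>N. \<forall>n\<ge>N. (L2_norm M (\<lambda>x. f x - p x))\<^sup>2 \<le> (sqrt (d\<^sup>2 + (1/4)^n) + e n)\<^sup>2"
      by (intro exI[of _ 0] allI impI power_mono) auto
  qed
  have far: "d \<le> L2_norm M (\<lambda>x. (f x - p x) - g x)" if "g \<in> V" for g
  proof (rule LIMSEQ_le_const)
    have "(\<lambda>n. L2_norm M (\<lambda>x. (f x - p x) - g x) + e n) \<longlonglongrightarrow> L2_norm M (\<lambda>x. (f x - p x) - g x) + 0"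
      by (intro tendsto_intros e_lim)
    then show "(\<lambda>n. L2_norm M (\<lambda>x. (f x - p x) - g x) + e n) \<longlonglongrightarrow> L2_norm M (\<lambda>x. (f x - p x) - g x)"
      by simp
    have "d \<le> L2_norm M (\<lambda>x. (f x - p x) - g x) + e n" for n
    proof -
      have "d \<le> L2_norm M (\<lambda>x. f x - (v n x + g x))"
        by (intro d_le L2_subspaceD[OF V] v that)
      also have "(\<lambda>x. f x - (v n x + g x)) = (\<lambda>x. ((f x - p x) - g x) - (v n x - p x))"
        by (auto simp: algebra_simps)
      also have "L2_norm M \<dots> \<le> L2_norm M (\<lambda>x. (f x - p x) - g x) + L2_norm M (\<lambda>x. v n x - p x)"
        by (intro L2_norm_triangle_diff L2_space_diff f p V2 v that)
      finally show ?thesis using vp[of n] by linarith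
    qed
    then show "\<exists>N. \<forall>n\<ge>N. d \<le> L2_norm M (\<lambda>x. (f x - p x) - g x) + e n" by blast
  qed
  have orth: "L2_inner M (\<lambda>x. f x - p x) g = 0" if g: "g \<in> V" for g
  proof -
    define b where "b = (L2_norm M g)\<^sup>2"
    \<comment> \<open>This \<open>t\<close> makes the coefficient \<open>2 t - t\<^sup>2 b\<close> positive also when \<open>b = 0\<close>.\<close>
    define t where "t = 1 / (b + 1)"
    define c where "c = of_real t * L2_inner M (\<lambda>x. f x - p x) g"
    have b: "0 \<le> b" by (simp add: b_def)
    have t: "0 < t" "t * b < 1" using b by (auto simp: t_def divide_simps)
    have "(L2_norm M (\<lambda>x. f x - p x))\<^sup>2 \<le> (L2_norm M (\<lambda>x. (f x - p x) - c * g x))\<^sup>2"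
      using far[OF L2_subspaceD(4)[OF V g, of c]] close by (intro power_mono) auto
    also have "\<dots> = (L2_norm M (\<lambda>x. f x - p x))\<^sup>2
        - (2 * t - t\<^sup>2 * b) * (cmod (L2_inner M (\<lambda>x. f x - p x) g))\<^sup>2"
      unfolding c_def b_def by (rule L2_norm_square_diff_inner_multiple[OF fp V2[OF g]])
    finally have "(2 * t - t\<^sup>2 * b) * (cmod (L2_inner M (\<lambda>x. f x - p x) g))\<^sup>2 \<le> 0" by simp
    moreover have "2 * t - t\<^sup>2 * b > 0"
    proof -
      have "2 * t - t\<^sup>2 * b = t * (2 - t * b)" by (simp add: power2_eq_square algebra_simps)
      then show ?thesis using t by (simp add: zero_less_mult_iff)
    qed
    ultimately have "(cmod (L2_inner M (\<lambda>x. f x - p x) g))\<^sup>2 \<le> 0"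
      by (simp add: mult_le_0_iff)
    then show ?thesis by simp
  qed
  show ?thesis
    using p_closure L2_closure_orthogonal[OF V fp orth] by blast
qed

lemma orth_proj_properties:
  assumes "\<exists>p\<in>V. \<forall>g\<in>V. L2_inner M (\<lambda>x. f x - p x) g = 0"
  shows "orth_proj M V f \<in> V" "\<And>g. g \<in> V \<Longrightarrow> L2_inner M (\<lambda>x. f x - orth_proj M V f x) g = 0"
proof -
  from assms have "\<exists>p. p \<in> V \<and> (\<forall>g\<in>V. L2_inner M (\<lambda>x. f x - p x) g = 0)" by blast
  from someI_ex[OF this]
  show "orth_proj M V f \<in> V" "\<And>g. g \<in> V \<Longrightarrow> L2_inner M (\<lambda>x. f x - orth_proj M V f x) g = 0"
    by (auto simp: orth_proj_def)
qed

lemma lin_span_subspace: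
  assumes "E \<subseteq> L2_space M"
  shows "L2_subspace M (lin_span E)"
  unfolding L2_subspace_def
proof (intro conjI ballI allI)
  show "lin_span E \<subseteq> L2_space M"
    using assms by (auto simp: lin_span_def intro!: L2_space_sum L2_space_cmult)
  show "(\<lambda>x. 0) \<in> lin_span E" by (auto simp: lin_span_def intro!: exI[of _ "{}"])
next
  fix f g assume "f \<in> lin_span E" "g \<in> lin_span E"
  then obtain S c R d where S: "finite S" "S \<subseteq> E" "f = (\<lambda>x. \<Sum>h\<in>S. c h * h x)"
    and R: "finite R" "R \<subseteq> E" "g = (\<lambda>x. \<Sum>h\<in>R. d h * h x)"
    by (auto simp: lin_span_def)
  have f: "f x = (\<Sum>h\<in>S \<union> R. (if h \<in> S then c h else 0) * h x)" for x
    unfolding S(3) using S R by (intro sum.mono_neutral_cong_left) auto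
  have g: "g x = (\<Sum>h\<in>S \<union> R. (if h \<in> R then d h else 0) * h x)" for x
    unfolding R(3) using S R by (intro sum.mono_neutral_cong_left) auto
  have "(\<lambda>x. f x + g x)
    = (\<lambda>x. \<Sum>h\<in>S \<union> R. ((if h \<in> S then c h else 0) + (if h \<in> R then d h else 0)) * h x)"
    unfolding f g by (simp add: sum.distrib distrib_right)
  then show "(\<lambda>x. f x + g x) \<in> lin_span E"
    unfolding lin_span_def using S R
    by (intro CollectI exI[of _ "S \<union> R"] exI conjI) auto
next
  fix a f assume "f \<in> lin_span E"
  then obtain S c where S: "finite S" "S \<subseteq> E" "f = (\<lambda>x. \<Sum>h\<in>S. c h * h x)"
    by (auto simp: lin_span_def)
  then have "(\<lambda>x. a * f x) = (\<lambda>x. \<Sum>h\<in>S. (a * c h) * h x)"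
    by (simp add: sum_distrib_left mult.assoc)
  then show "(\<lambda>x. a * f x) \<in> lin_span E"
    unfolding lin_span_def using S by (intro CollectI exI[of _ S] exI conjI) auto
qed

lemma lin_span_superset:
  assumes "g \<in> E"
  shows "g \<in> lin_span E"
  unfolding lin_span_def
  using assms by (intro CollectI exI[of _ "{g}"] exI[of _ "\<lambda>_. 1"]) auto

section \<open>Eigenspaces of the Koopman operator\<close>

definition eigenspace :: "('a \<Rightarrow> 'a) \<Rightarrow> 'a measure \<Rightarrow> complex \<Rightarrow> ('a \<Rightarrow> complex) set" where
  "eigenspace T M \<xi> = {g \<in> L2_space M. AE x in M. g (T x) = \<xi> * g x}"

definition eigen_proj ::
    "('a \<Rightarrow> 'a) \<Rightarrow> 'a measure \<Rightarrow> complex \<Rightarrow> ('a \<Rightarrow> complex) \<Rightarrow> 'a \<Rightarrow> complex" where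
  "eigen_proj T M \<xi> f = orth_proj M (eigenspace T M \<xi>) f"

text \<open>The Fourier-Bohr averages of arbitrary functions: for \<open>\<xi>\<close> on the unit circle \<open>cnj \<xi>\<close> is the inverse
  of \<open>\<xi>\<close>.\<close>

definition twisted_avg ::
    "('a \<Rightarrow> 'a) \<Rightarrow> complex \<Rightarrow> nat \<Rightarrow> ('a \<Rightarrow> complex) \<Rightarrow> 'a \<Rightarrow> complex" where
  "twisted_avg T \<xi> n f x = (\<Sum>j<n. cnj \<xi> ^ j * f ((T ^^ j) x)) / of_nat n"

lemma unimodular_cnj_mult:
  assumes "cmod \<xi> = 1"
  shows "\<xi> * cnj \<xi> = 1" "cnj \<xi> * \<xi> = 1" "cnj \<xi> * (\<xi> * z) = z" "\<xi> * (cnj \<xi> * z) = z"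
  using assms complex_norm_square[of \<xi>] by (simp_all add: mult.commute flip: mult.assoc)

lemma unimodular_powi_minus:
  assumes "cmod \<xi> = 1"
  shows "\<xi> powi (- int j) = cnj \<xi> ^ j"
proof -
  have "inverse \<xi> = cnj \<xi>" using unimodular_cnj_mult(1)[OF assms] by (rule inverse_unique)
  then show ?thesis by (simp add: power_int_minus flip: power_inverse)
qed

lemma fb_avg_eq_twisted_avg:
  assumes "cmod \<xi> = 1"
  shows "fb_avg T f \<xi> n x = twisted_avg T \<xi> n f x"
  unfolding fb_avg_def twisted_avg_def by (simp only: unimodular_powi_minus[OF assms])

lemma twisted_avg_diff:
  "twisted_avg T \<xi> n (\<lambda>x. f x - g x) x = twisted_avg T \<xi> n f x - twisted_avg T \<xi> n g x"
  by (simp add: twisted_avg_def right_diff_distrib sum_subtractf diff_divide_distrib)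

lemma cmod_twisted_avg_le:
  assumes "cmod \<xi> = 1"
  shows "cmod (twisted_avg T \<xi> n f x) \<le> (\<Sum>j<n. cmod (f ((T ^^ j) x))) / of_nat n"
proof -
  have "cmod (\<Sum>j<n. cnj \<xi> ^ j * f ((T ^^ j) x)) \<le> (\<Sum>j<n. cmod (f ((T ^^ j) x)))"
    by (rule sum_norm_le) (simp add: norm_mult norm_power assms)
  then show ?thesis by (simp add: twisted_avg_def norm_divide divide_right_mono)
qed

lemma cmod_twisted_avg_bounded:
  assumes "cmod \<xi> = 1" "\<And>x. cmod (f x) \<le> B"
  shows "cmod (twisted_avg T \<xi> n f x) \<le> B"
proof (cases "n = 0")
  case True
  then show ?thesis using order_trans[OF norm_ge_zero assms(2)[of undefined]]
    by (simp add: twisted_avg_def)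
next
  case False
  have "(\<Sum>j<n. cmod (f ((T ^^ j) x))) \<le> of_nat n * B"
    using sum_bounded_above[of "{..<n}" "\<lambda>j. cmod (f ((T ^^ j) x))" B] assms(2) by simp
  then have "(\<Sum>j<n. cmod (f ((T ^^ j) x))) / of_nat n \<le> B"
    using False by (intro mult_imp_div_pos_le) (simp_all only: mult.commute of_nat_0_less_iff neq0_conv)
  with cmod_twisted_avg_le[OF assms(1)] show ?thesis by (rule order_trans)
qed

lemma square_of_average_le:
  fixes a :: "nat \<Rightarrow> real"
  shows "((\<Sum>j<n. a j) / of_nat n)\<^sup>2 \<le> (\<Sum>j<n. (a j)\<^sup>2) / of_nat n"
proof (cases "n = 0")
  case False
  have "(\<Sum>j<n. a j)\<^sup>2 \<le> (\<Sum>j<n. (a j)\<^sup>2) * of_nat n"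
    using Cauchy_Schwarz_ineq_sum[of a "\<lambda>_. 1" "{..<n}"] by simp
  then show ?thesis using False by (simp add: power_divide power2_eq_square divide_simps mult_ac)
qed simp

lemma twisted_avg_coboundary:
  "twisted_avg T \<xi> n (\<lambda>x. h x - cnj \<xi> * h (T x)) x
    = (h x - cnj \<xi> ^ n * h ((T ^^ n) x)) / of_nat n"
proof -
  have "(\<Sum>j<n. cnj \<xi> ^ j * (h ((T ^^ j) x) - cnj \<xi> * h (T ((T ^^ j) x))))
      = (\<Sum>j<n. cnj \<xi> ^ j * h ((T ^^ j) x) - cnj \<xi> ^ Suc j * h ((T ^^ Suc j) x))"
    by (simp add: right_diff_distrib mult_ac)
  also have "\<dots> = h x - cnj \<xi> ^ n * h ((T ^^ n) x)"
    by (subst sum_lessThan_telescope'[of "\<lambda>j. cnj \<xi> ^ j * h ((T ^^ j) x)"]) simp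
  finally show ?thesis by (simp add: twisted_avg_def)
qed

locale measure_preserving_system = prob_space M for M :: "'a measure" +
  fixes T :: "'a \<Rightarrow> 'a"
  assumes measurable_T [measurable]: "T \<in> measurable M M" and distr_T: "distr M M T = M"
begin

lemma measurable_funpow [measurable]: "T ^^ j \<in> measurable M M"
  by (induction j) (auto intro: measurable_comp simp: measurable_ident_sets)

lemma distr_funpow: "distr M M (T ^^ j) = M"
proof (induction j)
  case (Suc j)
  have "distr M M (T ^^ Suc j) = distr (distr M M (T ^^ j)) M T"
    unfolding funpow.simps by (rule distr_distr[symmetric]) measurable
  then show ?case by (simp only: Suc distr_T)
qed (simp add: distr_id2 id_def)

lemma integral_funpow:
  fixes f :: "'a \<Rightarrow> 'b::{banach, second_countable_topology}"
  assumes [measurable]: "f \<in> borel_measurable M"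
  shows "(\<integral>x. f ((T ^^ j) x) \<partial>M) = (\<integral>x. f x \<partial>M)"
proof -
  have "(\<integral>x. f x \<partial>distr M M (T ^^ j)) = (\<integral>x. f ((T ^^ j) x) \<partial>M)"
    by (rule integral_distr) measurable
  then show ?thesis by (simp add: distr_funpow)
qed

lemma integrable_funpow:
  fixes f :: "'a \<Rightarrow> 'b::{banach, second_countable_topology}"
  assumes "integrable M f"
  shows "integrable M (\<lambda>x. f ((T ^^ j) x))"
  using integrable_distr[OF measurable_funpow[of j], of f] assms by (simp only: distr_funpow)

lemma AE_funpow:
  assumes "AE x in M. P x"
  shows "AE x in M. P ((T ^^ j) x)"
proof -
  have "AE x in distr M M (T ^^ j). P x" using assms by (simp only: distr_funpow)
  then show ?thesis by (rule AE_distrD[OF measurable_funpow])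
qed

lemma integral_T:
  fixes f :: "'a \<Rightarrow> 'b::{banach, second_countable_topology}"
  assumes "f \<in> borel_measurable M"
  shows "(\<integral>x. f (T x) \<partial>M) = (\<integral>x. f x \<partial>M)"
  using integral_funpow[OF assms, of 1] by simp

lemma L2_space_funpow:
  assumes "f \<in> L2_space M"
  shows "(\<lambda>x. f ((T ^^ j) x)) \<in> L2_space M"
  using integrable_funpow[OF L2_spaceD(2)[OF assms]] L2_spaceD(1)[OF assms]
  by (auto simp: L2_space_def)

lemma L2_space_T: "f \<in> L2_space M \<Longrightarrow> (\<lambda>x. f (T x)) \<in> L2_space M"
  using L2_space_funpow[of f 1] by simp

lemma L2_norm_funpow:
  assumes "f \<in> L2_space M"
  shows "L2_norm M (\<lambda>x. f ((T ^^ j) x)) = L2_norm M f"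
proof -
  have [measurable]: "f \<in> borel_measurable M" using L2_spaceD(1)[OF assms] .
  show ?thesis using integral_funpow[of "\<lambda>x. (cmod (f x))\<^sup>2" j] by (simp add: L2_norm_def)
qed

lemma L2_inner_T:
  assumes "f \<in> L2_space M" "g \<in> L2_space M"
  shows "L2_inner M (\<lambda>x. f (T x)) (\<lambda>x. g (T x)) = L2_inner M f g"
proof -
  have [measurable]: "f \<in> borel_measurable M" "g \<in> borel_measurable M"
    using L2_spaceD(1) assms by blast+
  show ?thesis using integral_T[of "\<lambda>x. f x * cnj (g x)"] by (simp add: L2_inner_def)
qed

lemma twisted_avg_L2:
  assumes "f \<in> L2_space M"
  shows "twisted_avg T \<xi> n f \<in> L2_space M"
proof -
  have "(\<lambda>x. (1 / of_nat n) * (\<Sum>j<n. cnj \<xi> ^ j * f ((T ^^ j) x))) \<in> L2_space M"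
    by (intro L2_space_intros L2_space_funpow assms)
  then show ?thesis by (simp add: twisted_avg_def[abs_def])
qed

lemma L2_norm_twisted_avg_le:
  assumes "f \<in> L2_space M" "cmod \<xi> = 1"
  shows "L2_norm M (twisted_avg T \<xi> n f) \<le> L2_norm M f"
proof (cases "n = 0")
  case False
  have "L2_norm M (\<lambda>x. \<Sum>j<n. cnj \<xi> ^ j * f ((T ^^ j) x))
      \<le> (\<Sum>j<n. L2_norm M (\<lambda>x. cnj \<xi> ^ j * f ((T ^^ j) x)))"
    by (rule L2_norm_sum_le) (intro L2_space_cmult L2_space_funpow assms)
  also have "\<dots> = of_nat n * L2_norm M f"
    unfolding L2_norm_cmult by (simp add: norm_power assms L2_norm_funpow)
  finally have "L2_norm M (\<lambda>x. \<Sum>j<n. cnj \<xi> ^ j * f ((T ^^ j) x)) / of_nat n \<le> L2_norm M f"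
    using False by (intro mult_imp_div_pos_le) (simp_all only: mult.commute of_nat_0_less_iff neq0_conv)
  moreover have "L2_norm M (twisted_avg T \<xi> n f)
      = L2_norm M (\<lambda>x. \<Sum>j<n. cnj \<xi> ^ j * f ((T ^^ j) x)) / of_nat n"
    using L2_norm_cmult[of M "1 / of_nat n" "\<lambda>x. \<Sum>j<n. cnj \<xi> ^ j * f ((T ^^ j) x)"]
    by (simp add: twisted_avg_def[abs_def] norm_divide)
  ultimately show ?thesis by simp
qed (simp add: twisted_avg_def[abs_def])

lemma eigenspaceD:
  assumes "g \<in> eigenspace T M \<xi>"
  shows "g \<in> L2_space M" "AE x in M. g (T x) = \<xi> * g x"
  using assms by (auto simp: eigenspace_def)

lemma eigenspace_funpow:
  assumes "g \<in> eigenspace T M \<xi>"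
  shows "AE x in M. \<forall>j. g ((T ^^ j) x) = \<xi> ^ j * g x"
proof -
  have "AE x in M. \<forall>j. g (T ((T ^^ j) x)) = \<xi> * g ((T ^^ j) x)"
    unfolding AE_all_countable using AE_funpow[OF eigenspaceD(2)[OF assms]] by blast
  then show ?thesis
  proof eventually_elim
    fix x assume *: "\<forall>j. g (T ((T ^^ j) x)) = \<xi> * g ((T ^^ j) x)"
    have "g ((T ^^ j) x) = \<xi> ^ j * g x" for j
      by (induction j) (simp_all add: *[rule_format])
    then show "\<forall>j. g ((T ^^ j) x) = \<xi> ^ j * g x" by blast
  qed
qed

lemma twisted_avg_eigenfunction:
  assumes "g \<in> eigenspace T M \<xi>" "cmod \<xi> = 1"
  shows "AE x in M. \<forall>n>0. twisted_avg T \<xi> n g x = g x"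
  using eigenspace_funpow[OF assms(1)]
proof eventually_elim
  fix x assume *: "\<forall>j. g ((T ^^ j) x) = \<xi> ^ j * g x"
  have "cnj \<xi> ^ j * g ((T ^^ j) x) = g x" for j
  proof -
    have "cnj \<xi> ^ j * g ((T ^^ j) x) = (cnj \<xi> * \<xi>) ^ j * g x"
      by (simp add: * power_mult_distrib)
    then show ?thesis by (simp add: unimodular_cnj_mult(2)[OF assms(2)])
  qed
  then show "\<forall>n>0. twisted_avg T \<xi> n g x = g x"
    by (simp add: twisted_avg_def)
qed

lemma eigenspaces_orthogonal:
  assumes g: "g \<in> eigenspace T M \<xi>" and h: "h \<in> eigenspace T M \<eta>"
    and "cmod \<xi> = 1" "cmod \<eta> = 1" "\<xi> \<noteq> \<eta>"
  shows "L2_inner M g h = 0"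
proof -
  note g2 = eigenspaceD(1)[OF g] and h2 = eigenspaceD(1)[OF h]
  have "L2_inner M g h = L2_inner M (\<lambda>x. g (T x)) (\<lambda>x. h (T x))"
    by (rule L2_inner_T[OF g2 h2, symmetric])
  also have "\<dots> = L2_inner M (\<lambda>x. \<xi> * g x) (\<lambda>x. \<eta> * h x)"
    using L2_space_T[OF g2] L2_space_T[OF h2] L2_space_cmult[OF g2] L2_space_cmult[OF h2]
    by (intro L2_inner_cong_AE eigenspaceD[OF g] eigenspaceD[OF h]) (auto dest: L2_spaceD(1))
  also have "\<dots> = \<xi> * cnj \<eta> * L2_inner M g h"
    by (simp add: L2_inner_cmult_left L2_inner_cmult_right)
  finally have eq: "L2_inner M g h = \<xi> * cnj \<eta> * L2_inner M g h" .
  have "\<xi> * cnj \<eta> \<noteq> 1"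
  proof
    assume "\<xi> * cnj \<eta> = 1"
    then have "\<xi> * (cnj \<eta> * \<eta>) = \<eta>" by (simp flip: mult.assoc)
    then show False using assms(5) unimodular_cnj_mult(2)[OF assms(4)] by simp
  qed
  then show ?thesis using eq by (metis mult_cancel_right2)
qed

text \<open>The Koopman operator is an isometry.\<close>

lemma eigenvalue_unimodular:
  assumes "g \<in> eigenspace T M \<xi>" "\<not> (AE x in M. g x = 0)"
  shows "cmod \<xi> = 1"
proof -
  note g2 = eigenspaceD(1)[OF assms(1)]
  have "L2_norm M g = L2_norm M (\<lambda>x. g (T x))" using L2_norm_funpow[OF g2, of 1] by simp
  also have "\<dots> = L2_norm M (\<lambda>x. \<xi> * g x)"
    using L2_space_T[OF g2] L2_space_cmult[OF g2]
    by (intro L2_norm_cong_AE eigenspaceD[OF assms(1)]) (auto dest: L2_spaceD(1))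
  also have "\<dots> = cmod \<xi> * L2_norm M g" by (rule L2_norm_cmult)
  finally show ?thesis using L2_norm_eq_0_iff[OF g2] assms(2) by simp
qed

lemma eigenfunction_iff:
  "eigenfunction T M \<xi> g \<longleftrightarrow> g \<in> eigenspace T M \<xi> \<and> \<not> (AE x in M. g x = 0)"
  by (auto simp: eigenfunction_def eigenspace_def koopman_def)

text \<open>The range of \<open>1 - \<xi>\<^sup>-\<^sup>1 U\<close> for the Koopman operator \<open>U\<close>.\<close>

definition coboundaries :: "complex \<Rightarrow> ('a \<Rightarrow> complex) set" where
  "coboundaries \<xi> = (\<lambda>h x. h x - cnj \<xi> * h (T x)) ` L2_space M"

lemma coboundaries_subspace: "L2_subspace M (coboundaries \<xi>)"
  unfolding L2_subspace_def
proof (intro conjI ballI allI)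
  show "coboundaries \<xi> \<subseteq> L2_space M"
    by (auto simp: coboundaries_def intro!: L2_space_diff L2_space_cmult L2_space_T)
  show "(\<lambda>x. 0) \<in> coboundaries \<xi>"
    unfolding coboundaries_def by (rule image_eqI[OF _ L2_space_zero]) simp
next
  fix f g assume "f \<in> coboundaries \<xi>" "g \<in> coboundaries \<xi>"
  then obtain h k where hk: "h \<in> L2_space M" "k \<in> L2_space M"
    "f = (\<lambda>x. h x - cnj \<xi> * h (T x))" "g = (\<lambda>x. k x - cnj \<xi> * k (T x))"
    by (auto simp: coboundaries_def)
  show "(\<lambda>x. f x + g x) \<in> coboundaries \<xi>"
    unfolding coboundaries_def
    by (rule image_eqI[OF _ L2_space_add[OF hk(1,2)]]) (simp add: hk fun_eq_iff algebra_simps)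
next
  fix c f assume "f \<in> coboundaries \<xi>"
  then obtain h where h: "h \<in> L2_space M" "f = (\<lambda>x. h x - cnj \<xi> * h (T x))"
    by (auto simp: coboundaries_def)
  show "(\<lambda>x. c * f x) \<in> coboundaries \<xi>"
    unfolding coboundaries_def
    by (rule image_eqI[OF _ L2_space_cmult[OF h(1), of c]]) (simp add: h fun_eq_iff algebra_simps)
qed

lemma eigenspace_orthogonal_coboundary:
  assumes g: "g \<in> eigenspace T M \<xi>" and \<xi>: "cmod \<xi> = 1" and v: "v \<in> coboundaries \<xi>"
  shows "L2_inner M g v = 0"
proof -
  obtain h where h: "h \<in> L2_space M" "v = (\<lambda>x. h x - cnj \<xi> * h (T x))"
    using v by (auto simp: coboundaries_def)
  note g2 = eigenspaceD(1)[OF g]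
  have "L2_inner M g (\<lambda>x. cnj \<xi> * h (T x)) = L2_inner M (\<lambda>x. \<xi> * g x) (\<lambda>x. h (T x))"
    by (simp add: L2_inner_cmult_left L2_inner_cmult_right)
  also have "\<dots> = L2_inner M (\<lambda>x. g (T x)) (\<lambda>x. h (T x))"
    using L2_space_T[OF g2] L2_space_T[OF h(1)] L2_space_cmult[OF g2] eigenspaceD(2)[OF g]
    by (intro L2_inner_cong_AE) (auto dest: L2_spaceD(1) elim: eventually_mono)
  also have "\<dots> = L2_inner M g h" by (rule L2_inner_T[OF g2 h(1)])
  finally show ?thesis
    unfolding h(2) using L2_inner_diff_right[OF h(1) L2_space_cmult[OF L2_space_T[OF h(1)]] g2]
    by simp
qed

text \<open>If \<open>s\<close> is orthogonal to \<open>s - cnj \<xi> * s \<circ> T\<close>, then, \<open>s \<circ> T\<close> having the same norm as \<open>s\<close>,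
  equality holds in the Cauchy-Schwarz inequality for \<open>s\<close> and \<open>cnj \<xi> * s \<circ> T\<close>, which are
  therefore equal.\<close>

lemma orthogonal_coboundaries_eigenspace:
  assumes s: "s \<in> L2_space M" and \<xi>: "cmod \<xi> = 1"
    and orth: "\<And>v. v \<in> coboundaries \<xi> \<Longrightarrow> L2_inner M s v = 0"
  shows "s \<in> eigenspace T M \<xi>"
proof -
  let ?Us = "\<lambda>x. cnj \<xi> * s (T x)"
  have Us: "?Us \<in> L2_space M" by (intro L2_space_cmult L2_space_T s)
  have "(\<lambda>x. s x - ?Us x) \<in> coboundaries \<xi>" using s by (auto simp: coboundaries_def)
  from orth[OF this] have "L2_inner M s ?Us = L2_inner M s s"
    using L2_inner_diff_right[OF s Us s] by simp
  moreover have "L2_norm M ?Us = L2_norm M s"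
    using L2_norm_funpow[OF s, of 1] \<xi> by (simp add: L2_norm_cmult)
  ultimately have "(L2_norm M (\<lambda>x. s x - ?Us x))\<^sup>2 = 0"
    by (simp add: L2_norm_square_diff[OF s Us] L2_inner_self)
  then have "AE x in M. s x - ?Us x = 0"
    using L2_norm_eq_0_iff[OF L2_space_diff[OF s Us]] by simp
  then have "AE x in M. s (T x) = \<xi> * s x"
  proof eventually_elim
    fix x assume "s x - cnj \<xi> * s (T x) = 0"
    then have "\<xi> * s x = \<xi> * (cnj \<xi> * s (T x))" by simp
    then show "s (T x) = \<xi> * s x" by (simp add: unimodular_cnj_mult[OF \<xi>])
  qed
  with s show ?thesis by (simp add: eigenspace_def)
qed

text \<open>The decomposition behind the mean ergodic theorem: the eigenspace is the orthogonal
  complement of the coboundaries.\<close>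

lemma eigen_proj_properties:
  assumes f: "f \<in> L2_space M" and \<xi>: "cmod \<xi> = 1"
  shows "eigen_proj T M \<xi> f \<in> eigenspace T M \<xi>"
    "\<And>g. g \<in> eigenspace T M \<xi> \<Longrightarrow> L2_inner M (\<lambda>x. f x - eigen_proj T M \<xi> f x) g = 0"
    "(\<lambda>x. f x - eigen_proj T M \<xi> f x) \<in> L2_closure M (coboundaries \<xi>)"
proof -
  note V = coboundaries_subspace[of \<xi>]
  obtain q where q: "q \<in> L2_closure M (coboundaries \<xi>)"
    and qo: "\<And>g. g \<in> L2_closure M (coboundaries \<xi>) \<Longrightarrow> L2_inner M (\<lambda>x. f x - q x) g = 0"
    using orthogonal_decomposition[OF V f] by blast
  have q2: "q \<in> L2_space M" using q by (simp add: L2_closure_def)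
  let ?s = "\<lambda>x. f x - q x"
  have s2: "?s \<in> L2_space M" by (intro L2_space_diff f q2)
  have s: "?s \<in> eigenspace T M \<xi>"
    by (rule orthogonal_coboundaries_eigenspace[OF s2 \<xi>]) (intro qo L2_closure_superset[OF V])
  have perp: "L2_inner M q g = 0" if "g \<in> eigenspace T M \<xi>" for g
  proof -
    have "L2_inner M g q = 0"
      by (rule L2_closure_orthogonal[OF V eigenspaceD(1)[OF that] _ q])
        (rule eigenspace_orthogonal_coboundary[OF that \<xi>])
    then show ?thesis by (subst L2_inner_commute) simp
  qed
  have "\<exists>p\<in>eigenspace T M \<xi>. \<forall>g\<in>eigenspace T M \<xi>. L2_inner M (\<lambda>x. f x - p x) g = 0"
    using s perp by (intro bexI[of _ ?s]) auto
  from orth_proj_properties[OF this]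
  show P: "eigen_proj T M \<xi> f \<in> eigenspace T M \<xi>"
    and Po: "\<And>g. g \<in> eigenspace T M \<xi> \<Longrightarrow> L2_inner M (\<lambda>x. f x - eigen_proj T M \<xi> f x) g = 0"
    by (auto simp: eigen_proj_def)
  let ?P = "eigen_proj T M \<xi> f"
  have P2: "?P \<in> L2_space M" using eigenspaceD(1)[OF P] .
  have fP2: "(\<lambda>x. f x - ?P x) \<in> L2_space M" by (intro L2_space_diff f P2)
  let ?d = "\<lambda>x. (f x - ?P x) - q x"
  have d2: "?d \<in> L2_space M" by (intro L2_space_diff f P2 q2)
  have d: "?d \<in> eigenspace T M \<xi>"
    unfolding eigenspace_def using d2 eigenspaceD(2)[OF s] eigenspaceD(2)[OF P]
    by (auto elim!: eventually_elim2 simp: algebra_simps)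
  have "L2_inner M ?d ?d = 0"
    using L2_inner_diff_left[OF fP2 q2 d2] Po[OF d] perp[OF d] by simp
  then have d0: "AE x in M. ?d x = 0" using L2_norm_eq_0_iff[OF d2] by (simp add: L2_inner_self)
  have "\<exists>h\<in>coboundaries \<xi>. L2_norm M (\<lambda>x. f x - ?P x - h x) < \<epsilon>" if \<epsilon>: "\<epsilon> > 0" for \<epsilon>
  proof -
    obtain h where h: "h \<in> coboundaries \<xi>" "L2_norm M (\<lambda>x. q x - h x) < \<epsilon>"
      using q \<epsilon> by (auto simp: L2_closure_def)
    have h2: "h \<in> L2_space M" using L2_subspaceD(1)[OF V h(1)] .
    have "L2_norm M (\<lambda>x. f x - ?P x - h x) = L2_norm M (\<lambda>x. q x - h x)"
      using L2_spaceD(1)[OF L2_space_diff[OF fP2 h2]] L2_spaceD(1)[OF L2_space_diff[OF q2 h2]] d0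
      by (intro L2_norm_cong_AE) (auto elim!: eventually_mono)
    then show ?thesis using h by (intro bexI[of _ h]) simp_all
  qed
  then show "(\<lambda>x. f x - ?P x) \<in> L2_closure M (coboundaries \<xi>)"
    using fP2 by (simp add: L2_closure_def)
qed

lemma eigen_proj_L2:
  assumes "f \<in> L2_space M" "cmod \<xi> = 1"
  shows "eigen_proj T M \<xi> f \<in> L2_space M"
  using eigenspaceD(1)[OF eigen_proj_properties(1)[OF assms]] .

lemma L2_inner_eigen_proj:
  assumes "f \<in> L2_space M" "cmod \<xi> = 1" "g \<in> eigenspace T M \<xi>"
  shows "L2_inner M (eigen_proj T M \<xi> f) g = L2_inner M f g"
  using eigen_proj_properties(2)[OF assms]
    L2_inner_diff_left[OF assms(1) eigen_proj_L2[OF assms(1,2)] eigenspaceD(1)[OF assms(3)]]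
  by simp

lemma eigenspace_diff:
  assumes "g \<in> eigenspace T M \<xi>" "h \<in> eigenspace T M \<xi>"
  shows "(\<lambda>x. g x - h x) \<in> eigenspace T M \<xi>"
  using L2_space_diff[OF eigenspaceD(1)[OF assms(1)] eigenspaceD(1)[OF assms(2)]]
    eigenspaceD(2)[OF assms(1)] eigenspaceD(2)[OF assms(2)]
  by (auto simp: eigenspace_def algebra_simps elim!: eventually_elim2)

text \<open>By linearity and contractivity of the projection; this extends statements about
  \<open>\<parallel>P\<^sub>\<xi> f\<parallel>\<close> from a dense set of \<open>f\<close>.\<close>

lemma L2_norm_eigen_proj_diff_le:
  assumes f: "f \<in> L2_space M" and g: "g \<in> L2_space M" and \<xi>: "cmod \<xi> = 1"
  shows "\<bar>L2_norm M (eigen_proj T M \<xi> f) - L2_norm M (eigen_proj T M \<xi> g)\<bar>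
    \<le> L2_norm M (\<lambda>x. f x - g x)"
proof -
  let ?d = "\<lambda>x. eigen_proj T M \<xi> f x - eigen_proj T M \<xi> g x"
  have d: "?d \<in> eigenspace T M \<xi>"
    by (intro eigenspace_diff eigen_proj_properties f g \<xi>)
  note d2 = eigenspaceD(1)[OF d]
  have "of_real ((L2_norm M ?d)\<^sup>2) = L2_inner M ?d ?d" by (rule L2_inner_self[symmetric])
  also have "\<dots> = L2_inner M f ?d - L2_inner M g ?d"
    using L2_inner_diff_left[OF eigen_proj_L2[OF f \<xi>] eigen_proj_L2[OF g \<xi>] d2]
    by (simp add: L2_inner_eigen_proj f g \<xi> d)
  also have "\<dots> = L2_inner M (\<lambda>x. f x - g x) ?d" by (rule L2_inner_diff_left[OF f g d2, symmetric])
  finally have "cmod (of_real ((L2_norm M ?d)\<^sup>2)) = cmod (L2_inner M (\<lambda>x. f x - g x) ?d)"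
    by simp
  also have "\<dots> \<le> L2_norm M (\<lambda>x. f x - g x) * L2_norm M ?d"
    by (rule L2_Cauchy_Schwarz[OF L2_space_diff[OF f g] d2])
  finally have "(L2_norm M ?d)\<^sup>2 \<le> L2_norm M (\<lambda>x. f x - g x) * L2_norm M ?d"
    by (simp only: norm_of_real abs_power2)
  moreover have "a \<le> b" if "a\<^sup>2 \<le> b * a" "0 \<le> a" "0 \<le> b" for a b :: real
    using that by (cases "a = 0") (simp_all add: power2_eq_square)
  ultimately have "L2_norm M ?d \<le> L2_norm M (\<lambda>x. f x - g x)" by simp
  then show ?thesis
    using L2_norm_reverse_triangle[OF eigen_proj_L2[OF f \<xi>] eigen_proj_L2[OF g \<xi>]] by linarith
qed

text \<open>The half of the mean ergodic theorem that bounds Fourier-Bohr averages. Up to a small error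
  \<open>f - P\<^sub>\<xi> f\<close> is a coboundary, and averages of a coboundary telescope to \<open>O(1 / n)\<close>.\<close>

lemma twisted_avg_norm_le_eigen_proj:
  assumes f: "f \<in> L2_space M" and \<xi>: "cmod \<xi> = 1" and \<epsilon>: "\<epsilon> > 0"
  shows "\<exists>n>0. L2_norm M (twisted_avg T \<xi> n f) \<le> L2_norm M (eigen_proj T M \<xi> f) + \<epsilon>"
proof -
  let ?P = "eigen_proj T M \<xi> f"
  let ?q = "\<lambda>x. f x - ?P x"
  note P2 = eigen_proj_L2[OF f \<xi>]
  have q2: "?q \<in> L2_space M" by (intro L2_space_diff f P2)
  obtain h where h: "h \<in> L2_space M" "L2_norm M (\<lambda>x. ?q x - (h x - cnj \<xi> * h (T x))) < \<epsilon> / 2"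
    using eigen_proj_properties(3)[OF f \<xi>] \<epsilon>
    by (auto simp: L2_closure_def coboundaries_def dest!: spec[of _ "\<epsilon> / 2"])
  let ?v = "\<lambda>x. h x - cnj \<xi> * h (T x)"
  have v2: "?v \<in> L2_space M" by (intro L2_space_diff L2_space_cmult L2_space_T h(1))
  obtain n :: nat where n: "n > 0" "2 * L2_norm M h / n < \<epsilon> / 2"
  proof -
    have "(\<lambda>n. 2 * L2_norm M h / real n) \<longlonglongrightarrow> 0" by (rule lim_const_over_n)
    then have "\<forall>\<^sub>F n in sequentially. 2 * L2_norm M h / real n < \<epsilon> / 2"
      using \<epsilon> by (intro order_tendstoD) auto
    then have "\<forall>\<^sub>F n in sequentially. n > 0 \<and> 2 * L2_norm M h / real n < \<epsilon> / 2"
      using eventually_gt_at_top[of 0] by eventually_elim simp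
    then show ?thesis using that by (auto dest: eventually_happens)
  qed
  have "L2_norm M (twisted_avg T \<xi> n ?v) \<le> 2 * L2_norm M h / n"
  proof -
    have "L2_norm M (twisted_avg T \<xi> n ?v) = L2_norm M (\<lambda>x. h x - cnj \<xi> ^ n * h ((T ^^ n) x)) / n"
      using L2_norm_cmult[of M "1 / of_nat n" "\<lambda>x. h x - cnj \<xi> ^ n * h ((T ^^ n) x)"]
      by (simp add: twisted_avg_coboundary[abs_def] norm_divide)
    also have "L2_norm M (\<lambda>x. h x - cnj \<xi> ^ n * h ((T ^^ n) x))
        \<le> L2_norm M h + L2_norm M (\<lambda>x. cnj \<xi> ^ n * h ((T ^^ n) x))"
      by (intro L2_norm_triangle_diff L2_space_cmult L2_space_funpow h(1))
    also have "L2_norm M (\<lambda>x. cnj \<xi> ^ n * h ((T ^^ n) x)) = L2_norm M h"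
      unfolding L2_norm_cmult L2_norm_funpow[OF h(1)] by (simp add: norm_power \<xi>)
    finally show ?thesis by (simp add: divide_right_mono)
  qed
  moreover have "L2_norm M (twisted_avg T \<xi> n (\<lambda>x. ?q x - ?v x)) \<le> \<epsilon> / 2"
    using L2_norm_twisted_avg_le[OF L2_space_diff[OF q2 v2] \<xi>, of n] h(2) by linarith
  moreover have "L2_norm M (twisted_avg T \<xi> n f)
    \<le> L2_norm M ?P + (L2_norm M (twisted_avg T \<xi> n (\<lambda>x. ?q x - ?v x)) + L2_norm M (twisted_avg T \<xi> n ?v))"
  proof -
    have "L2_norm M (twisted_avg T \<xi> n f)
      = L2_norm M (\<lambda>x. ?P x + (twisted_avg T \<xi> n (\<lambda>x. ?q x - ?v x) x + twisted_avg T \<xi> n ?v x))"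
    proof (rule L2_norm_cong_AE)
      show "AE x in M. twisted_avg T \<xi> n f x
        = ?P x + (twisted_avg T \<xi> n (\<lambda>x. ?q x - ?v x) x + twisted_avg T \<xi> n ?v x)"
        using twisted_avg_eigenfunction[OF eigen_proj_properties(1)[OF f \<xi>] \<xi>]
        by eventually_elim (simp add: twisted_avg_diff n(1))
    qed (intro L2_spaceD(1) L2_space_add twisted_avg_L2 L2_space_diff f P2 v2)+
    also have "\<dots> \<le> L2_norm M ?P
        + L2_norm M (\<lambda>x. twisted_avg T \<xi> n (\<lambda>x. ?q x - ?v x) x + twisted_avg T \<xi> n ?v x)"
      by (intro L2_norm_triangle L2_space_add twisted_avg_L2 L2_space_diff f P2 v2)
    also have "L2_norm M (\<lambda>x. twisted_avg T \<xi> n (\<lambda>x. ?q x - ?v x) x + twisted_avg T \<xi> n ?v x)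
        \<le> L2_norm M (twisted_avg T \<xi> n (\<lambda>x. ?q x - ?v x)) + L2_norm M (twisted_avg T \<xi> n ?v)"
      by (intro L2_norm_triangle twisted_avg_L2 L2_space_diff f P2 v2)
    finally show ?thesis by simp
  qed
  ultimately show ?thesis using n by (intro exI[of _ n]) linarith
qed

end

section \<open>The projection onto the Kronecker factor\<close>

lemma nonneg_sum_upper:
  assumes "finite F" "F \<subseteq> I"
  shows "ennreal (\<Sum>i\<in>F. a i) \<le> nonneg_sum a I"
  unfolding nonneg_sum_def by (rule SUP_upper) (use assms in auto)

lemma nonneg_sum_least:
  assumes "\<And>F. finite F \<Longrightarrow> F \<subseteq> I \<Longrightarrow> ennreal (\<Sum>i\<in>F. a i) \<le> s"
  shows "nonneg_sum a I \<le> s"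
  unfolding nonneg_sum_def by (rule SUP_least) (use assms in auto)

lemma nonneg_sum_cong:
  assumes "\<And>i. i \<in> I \<Longrightarrow> a i = b i"
  shows "nonneg_sum a I = nonneg_sum b I"
  unfolding nonneg_sum_def by (rule SUP_cong) (use assms in \<open>auto intro!: sum.cong arg_cong[of _ _ ennreal]\<close>)

lemma nonneg_sum_support:
  assumes "I \<subseteq> J" "\<And>i. i \<in> J - I \<Longrightarrow> a i = 0"
  shows "nonneg_sum a I = nonneg_sum a J"
proof (rule antisym)
  show "nonneg_sum a I \<le> nonneg_sum a J"
    using assms(1) by (intro nonneg_sum_least nonneg_sum_upper) auto
  show "nonneg_sum a J \<le> nonneg_sum a I"
  proof (rule nonneg_sum_least)
    fix F assume F: "finite F" "F \<subseteq> J"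
    then have "(\<Sum>i\<in>F. a i) = (\<Sum>i\<in>F \<inter> I. a i)"
      using assms by (intro sum.mono_neutral_right) auto
    then show "ennreal (\<Sum>i\<in>F. a i) \<le> nonneg_sum a I"
      using F by (simp add: nonneg_sum_upper)
  qed
qed

text \<open>A gap \<open>b j - a j\<close> in a single summand persists in the supremum, provided that the sums are finite.\<close>

lemma nonneg_sum_eq_imp_eq:
  assumes le: "\<And>i. i \<in> J \<Longrightarrow> a i \<le> b i" and nonneg: "\<And>i. i \<in> J \<Longrightarrow> 0 \<le> a i"
    and eq: "nonneg_sum a J = nonneg_sum b J" and fin: "nonneg_sum b J \<noteq> \<infinity>"
    and j: "j \<in> J"
  shows "a j = b j"
proof (rule ccontr)
  assume "a j \<noteq> b j"
  then have pos: "b j - a j > 0" using le[OF j] by simp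
  have "nonneg_sum a J + ennreal (b j - a j) \<le> nonneg_sum b J"
  proof -
    have "nonneg_sum a J \<le> nonneg_sum b J - ennreal (b j - a j)"
    proof (rule nonneg_sum_least)
      fix F assume F: "finite F" "F \<subseteq> J"
      let ?G = "insert j F"
      have G: "finite ?G" "?G \<subseteq> J" using F j by auto
      have "(\<Sum>i\<in>?G. a i) + (b j - a j) \<le> (\<Sum>i\<in>?G. b i)"
      proof -
        have "(\<Sum>i\<in>?G - {j}. a i) \<le> (\<Sum>i\<in>?G - {j}. b i)" using G le by (intro sum_mono) auto
        then show ?thesis
          using sum.remove[OF G(1), of j a] sum.remove[OF G(1), of j b] by simp
      qed
      moreover have "(\<Sum>i\<in>F. a i) \<le> (\<Sum>i\<in>?G. a i)"
        using G nonneg by (intro sum_mono2) auto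
      ultimately have "(\<Sum>i\<in>F. a i) \<le> (\<Sum>i\<in>?G. b i) - (b j - a j)" by simp
      then have "ennreal (\<Sum>i\<in>F. a i) \<le> ennreal ((\<Sum>i\<in>?G. b i) - (b j - a j))"
        by (rule ennreal_leI)
      also have "\<dots> = ennreal (\<Sum>i\<in>?G. b i) - ennreal (b j - a j)"
        using pos by (intro ennreal_minus[symmetric]) simp
      also have "\<dots> \<le> nonneg_sum b J - ennreal (b j - a j)"
        by (intro ennreal_minus_mono nonneg_sum_upper G order_refl)
      finally show "ennreal (\<Sum>i\<in>F. a i) \<le> nonneg_sum b J - ennreal (b j - a j)" .
    qed
    then have "nonneg_sum a J + ennreal (b j - a j)
        \<le> (nonneg_sum b J - ennreal (b j - a j)) + ennreal (b j - a j)"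
      by (rule add_right_mono)
    also have "\<dots> = nonneg_sum b J"
    proof (rule diff_add_cancel_ennreal)
      have "b j - a j \<le> b j" using nonneg[OF j] by simp
      then have "ennreal (b j - a j) \<le> ennreal (\<Sum>i\<in>{j}. b i)" by (simp add: ennreal_leI)
      also have "\<dots> \<le> nonneg_sum b J" by (rule nonneg_sum_upper) (use j in auto)
      finally show "ennreal (b j - a j) \<le> nonneg_sum b J" .
    qed
    finally show ?thesis .
  qed
  then have "nonneg_sum b J + ennreal (b j - a j) \<le> nonneg_sum b J + 0" by (simp add: eq)
  then have "ennreal (b j - a j) \<le> 0" using fin by (subst (asm) ennreal_add_left_cancel_le) auto
  then show False using pos by (simp add: ennreal_eq_0_iff)
qed

text \<open>A sum \<open>s\<close> leaves room for at most \<open>n s\<close> summands that exceed \<open>1 / n\<close>.\<close>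

lemma countable_support_nonneg_sum:
  assumes fin: "nonneg_sum a I \<noteq> \<infinity>" and nonneg: "\<And>i. i \<in> I \<Longrightarrow> 0 \<le> a i"
  shows "countable {i\<in>I. a i \<noteq> 0}"
proof -
  obtain s where s: "0 \<le> s" "nonneg_sum a I = ennreal s"
    using fin by (cases "nonneg_sum a I") auto
  have "finite {i\<in>I. a i > 1 / Suc n}" for n
  proof (rule ccontr)
    assume "infinite {i\<in>I. a i > 1 / Suc n}"
    then obtain F where F: "finite F" "card F = Suc (nat \<lceil>s * Suc n\<rceil>)" "F \<subseteq> {i\<in>I. a i > 1 / Suc n}"
      using infinite_arbitrarily_large by blast
    have "real (card F) * (1 / Suc n) \<le> (\<Sum>i\<in>F. a i)"
      using F(3) by (intro sum_bounded_below) auto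
    moreover have "(\<Sum>i\<in>F. a i) \<le> s"
    proof -
      have "ennreal (\<Sum>i\<in>F. a i) \<le> ennreal s"
        using F unfolding s(2)[symmetric] by (intro nonneg_sum_upper) auto
      then show ?thesis using s(1) by (simp add: ennreal_le_iff)
    qed
    ultimately have "real (card F) * (1 / Suc n) \<le> s" by simp
    then have "real (card F) \<le> s * Suc n" by (simp add: field_simps)
    moreover have "s * Suc n \<le> real (nat \<lceil>s * Suc n\<rceil>)" by (rule real_nat_ceiling_ge)
    ultimately show False unfolding F(2) by linarith
  qed
  then have "countable (\<Union>n. {i\<in>I. a i > 1 / Suc n})"
    by (intro countable_UN countable_finite countableI_type)
  moreover have "{i\<in>I. a i \<noteq> 0} \<subseteq> (\<Union>n. {i\<in>I. a i > 1 / Suc n})"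
  proof
    fix i assume i: "i \<in> {i\<in>I. a i \<noteq> 0}"
    then have "a i > 0" using nonneg[of i] by auto
    then obtain n where "1 / Suc n < a i" using nat_approx_posE by blast
    then show "i \<in> (\<Union>n. {i\<in>I. a i > 1 / Suc n})" using i by auto
  qed
  ultimately show ?thesis using countable_subset by blast
qed

context measure_preserving_system
begin

definition eigenfunctions :: "('a \<Rightarrow> complex) set" where
  "eigenfunctions = {g. \<exists>\<xi>. eigenfunction T M \<xi> g}"

lemma eigenfunctions_span_subspace: "L2_subspace M (lin_span eigenfunctions)"
  by (rule lin_span_subspace) (auto simp: eigenfunctions_def eigenfunction_def)

lemma Kron_eq: "Kron T M = L2_closure M (lin_span eigenfunctions)"
  by (simp add: Kron_def eigenfunctions_def)

lemma eigenspace_subset_Kron: "eigenspace T M \<xi> \<subseteq> Kron T M"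
proof
  fix g assume g: "g \<in> eigenspace T M \<xi>"
  show "g \<in> Kron T M"
  proof (cases "AE x in M. g x = 0")
    case True
    then have "L2_norm M (\<lambda>x. g x - 0) = 0"
      using L2_norm_eq_0_iff[OF eigenspaceD(1)[OF g]] by simp
    then show ?thesis
      using L2_subspaceD(2)[OF eigenfunctions_span_subspace] eigenspaceD(1)[OF g]
      by (auto simp: Kron_eq L2_closure_def intro!: bexI[of _ "\<lambda>x. 0"])
  next
    case False
    then have "g \<in> eigenfunctions" using g by (auto simp: eigenfunctions_def eigenfunction_iff)
    then show ?thesis
      unfolding Kron_eq
      by (intro L2_closure_superset[OF eigenfunctions_span_subspace] lin_span_superset)
  qed
qed

lemma L2_inner_sum_eigen_proj:
  assumes f: "f \<in> L2_space M" and F: "finite F" "F \<subseteq> sphere 0 1" "\<eta> \<in> F"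
    and g: "g \<in> eigenspace T M \<eta>"
  shows "L2_inner M (\<lambda>x. \<Sum>\<xi>\<in>F. eigen_proj T M \<xi> f x) g = L2_inner M f g"
proof -
  have u: "cmod \<xi> = 1" if "\<xi> \<in> F" for \<xi> using that F(2) by auto
  have "L2_inner M (\<lambda>x. \<Sum>\<xi>\<in>F. eigen_proj T M \<xi> f x) g
      = (\<Sum>\<xi>\<in>F. L2_inner M (eigen_proj T M \<xi> f) g)"
    by (intro L2_inner_sum_left eigen_proj_L2 f u eigenspaceD[OF g])
  also have "\<dots> = (\<Sum>\<xi>\<in>F. if \<xi> = \<eta> then L2_inner M f g else 0)"
    using u F(3) g
    by (intro sum.cong) (auto simp: L2_inner_eigen_proj[OF f]
        intro: eigenspaces_orthogonal[OF eigen_proj_properties(1)[OF f] g])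
  also have "\<dots> = L2_inner M f g" using F by simp
  finally show ?thesis .
qed

lemma L2_norm_square_sum_eigen_proj:
  assumes f: "f \<in> L2_space M" and F: "finite F" "F \<subseteq> sphere 0 1"
  shows "(L2_norm M (\<lambda>x. \<Sum>\<xi>\<in>F. eigen_proj T M \<xi> f x))\<^sup>2
    = (\<Sum>\<xi>\<in>F. (L2_norm M (eigen_proj T M \<xi> f))\<^sup>2)"
proof -
  have u: "cmod \<xi> = 1" if "\<xi> \<in> F" for \<xi> using that F(2) by auto
  let ?s = "\<lambda>x. \<Sum>\<xi>\<in>F. eigen_proj T M \<xi> f x"
  have s2: "?s \<in> L2_space M" by (intro L2_space_sum eigen_proj_L2 f u)
  have "complex_of_real ((L2_norm M ?s)\<^sup>2) = L2_inner M ?s ?s" by (rule L2_inner_self[symmetric])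
  also have "\<dots> = (\<Sum>\<xi>\<in>F. L2_inner M ?s (eigen_proj T M \<xi> f))"
    by (intro L2_inner_sum_right eigen_proj_L2 f u s2)
  also have "\<dots> = (\<Sum>\<xi>\<in>F. L2_inner M (eigen_proj T M \<xi> f) (eigen_proj T M \<xi> f))"
    using u F
    by (intro sum.cong refl)
      (simp add: L2_inner_sum_eigen_proj[OF f] L2_inner_eigen_proj[OF f] eigen_proj_properties(1)[OF f])
  also have "\<dots> = complex_of_real (\<Sum>\<xi>\<in>F. (L2_norm M (eigen_proj T M \<xi> f))\<^sup>2)"
    unfolding L2_inner_self by (rule of_real_sum[symmetric])
  finally show ?thesis by (simp only: of_real_eq_iff)
qed

text \<open>Parseval's identity: eigenspaces for different eigenvalues are orthogonal, and the sum of the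
  projections onto finitely many of them is the best approximation of \<open>P\<^sub>K f\<close> in their sum.\<close>

theorem Kron_Parseval:
  assumes f: "f \<in> L2_space M"
  shows "ennreal ((L2_norm M (orth_proj M (Kron T M) f))\<^sup>2)
    = nonneg_sum (\<lambda>\<xi>. (L2_norm M (eigen_proj T M \<xi> f))\<^sup>2) (sphere 0 1)"
proof -
  let ?a = "\<lambda>\<xi>. (L2_norm M (eigen_proj T M \<xi> f))\<^sup>2"
  define k where "k = orth_proj M (Kron T M) f"
  have ex: "\<exists>p\<in>Kron T M. \<forall>g\<in>Kron T M. L2_inner M (\<lambda>x. f x - p x) g = 0"
    unfolding Kron_eq by (rule orthogonal_decomposition[OF eigenfunctions_span_subspace f])
  have k: "k \<in> Kron T M" and ko: "\<And>g. g \<in> Kron T M \<Longrightarrow> L2_inner M (\<lambda>x. f x - k x) g = 0"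
    unfolding k_def using orth_proj_properties[OF ex] by auto
  have k2: "k \<in> L2_space M" using k by (simp add: Kron_def L2_closure_def)
  have s2: "(\<lambda>x. \<Sum>\<xi>\<in>F. eigen_proj T M \<xi> f x) \<in> L2_space M" if "F \<subseteq> sphere 0 1" for F
    using that by (intro L2_space_sum eigen_proj_L2 f) auto
  have orth: "L2_inner M (\<lambda>x. k x - (\<Sum>\<xi>\<in>F. eigen_proj T M \<xi> f x)) g = 0"
    if F: "finite F" "F \<subseteq> sphere 0 1" "\<eta> \<in> F" and g: "g \<in> eigenspace T M \<eta>" for F \<eta> g
  proof -
    note g2 = eigenspaceD(1)[OF g]
    have "L2_inner M k g = L2_inner M f g"
      using ko[OF subsetD[OF eigenspace_subset_Kron g]] L2_inner_diff_left[OF f k2 g2] by simp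
    then show ?thesis
      using L2_inner_diff_left[OF k2 s2[OF F(2)] g2] L2_inner_sum_eigen_proj[OF f F g] by simp
  qed
  have norm_k: "(L2_norm M k)\<^sup>2 = (\<Sum>\<xi>\<in>F. ?a \<xi>) + (L2_norm M (\<lambda>x. k x - (\<Sum>\<xi>\<in>F. eigen_proj T M \<xi> f x)))\<^sup>2"
    if F: "finite F" "F \<subseteq> sphere 0 1" for F
  proof -
    let ?s = "\<lambda>x. \<Sum>\<xi>\<in>F. eigen_proj T M \<xi> f x"
    let ?d = "\<lambda>x. k x - ?s x"
    have d2: "?d \<in> L2_space M" by (intro L2_space_diff k2 s2 F)
    have "L2_inner M ?d ?s = (\<Sum>\<xi>\<in>F. L2_inner M ?d (eigen_proj T M \<xi> f))"
      using F by (intro L2_inner_sum_right eigen_proj_L2 f d2) auto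
    also have "\<dots> = 0"
    proof (intro sum.neutral ballI)
      fix \<xi> assume "\<xi> \<in> F"
      then show "L2_inner M ?d (eigen_proj T M \<xi> f) = 0"
        using F by (intro orth[of F \<xi>] eigen_proj_properties(1) f) auto
    qed
    finally have "(L2_norm M (\<lambda>x. ?d x + ?s x))\<^sup>2 = (L2_norm M ?d)\<^sup>2 + (L2_norm M ?s)\<^sup>2"
      by (intro L2_pythagoras d2 s2 F)
    then show ?thesis by (simp add: L2_norm_square_sum_eigen_proj[OF f F])
  qed
  show ?thesis
    unfolding k_def[symmetric]
  proof (rule antisym)
    show "nonneg_sum ?a (sphere 0 1) \<le> ennreal ((L2_norm M k)\<^sup>2)"
    proof (intro nonneg_sum_least ennreal_leI)
      fix F :: "complex set" assume "finite F" "F \<subseteq> sphere 0 1"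
      from norm_k[OF this] show "(\<Sum>\<xi>\<in>F. ?a \<xi>) \<le> (L2_norm M k)\<^sup>2" by simp
    qed
    show "ennreal ((L2_norm M k)\<^sup>2) \<le> nonneg_sum ?a (sphere 0 1)"
    proof (rule ennreal_le_epsilon)
      fix e :: real assume e: "e > 0"
      then have "sqrt e > 0" by simp
      then obtain h where h: "h \<in> lin_span eigenfunctions" "L2_norm M (\<lambda>x. k x - h x) < sqrt e"
        using k unfolding Kron_eq L2_closure_def by blast
      then obtain S c where S: "finite S" "S \<subseteq> eigenfunctions" "h = (\<lambda>x. \<Sum>g\<in>S. c g * g x)"
        by (auto simp: lin_span_def)
      then have "\<forall>g\<in>S. \<exists>\<xi>. g \<in> eigenspace T M \<xi> \<and> cmod \<xi> = 1"
        using eigenvalue_unimodular by (fastforce simp: eigenfunctions_def eigenfunction_iff)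
      then obtain ev where ev: "\<And>g. g \<in> S \<Longrightarrow> g \<in> eigenspace T M (ev g) \<and> cmod (ev g) = 1"
        by metis
      define F where "F = ev ` S"
      have F: "finite F" "F \<subseteq> sphere 0 1" using S ev by (auto simp: F_def)
      let ?s = "\<lambda>x. \<Sum>\<xi>\<in>F. eigen_proj T M \<xi> f x"
      let ?d = "\<lambda>x. k x - ?s x"
      have d2: "?d \<in> L2_space M" by (intro L2_space_diff k2 s2 F)
      have h2: "h \<in> L2_space M"
        using L2_subspaceD(1)[OF eigenfunctions_span_subspace h(1)] .
      have "L2_inner M ?d h = (\<Sum>g\<in>S. L2_inner M ?d (\<lambda>x. c g * g x))"
        unfolding S(3) using ev
        by (intro L2_inner_sum_right L2_space_cmult d2) (auto dest: eigenspaceD)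
      also have "\<dots> = 0"
      proof (intro sum.neutral ballI)
        fix g assume g: "g \<in> S"
        have "L2_inner M ?d g = 0"
          using orth[OF F, of "ev g" g] ev[OF g] g by (auto simp: F_def)
        then show "L2_inner M ?d (\<lambda>x. c g * g x) = 0" by (simp add: L2_inner_cmult_right)
      qed
      finally have dh: "L2_inner M ?d h = 0" .
      have "L2_inner M ?d ?s = (\<Sum>\<xi>\<in>F. L2_inner M ?d (eigen_proj T M \<xi> f))"
        using F by (intro L2_inner_sum_right eigen_proj_L2 f d2) auto
      also have "\<dots> = 0"
      proof (intro sum.neutral ballI)
        fix \<xi> assume "\<xi> \<in> F"
        then show "L2_inner M ?d (eigen_proj T M \<xi> f) = 0"
          using F by (intro orth[of F \<xi>] eigen_proj_properties(1) f) auto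
      qed
      finally have "L2_inner M ?d (\<lambda>x. ?s x - h x) = 0"
        using L2_inner_diff_right[OF s2[OF F(2)] h2 d2] dh by simp
      then have "(L2_norm M (\<lambda>x. ?d x + (?s x - h x)))\<^sup>2
          = (L2_norm M ?d)\<^sup>2 + (L2_norm M (\<lambda>x. ?s x - h x))\<^sup>2"
        by (intro L2_pythagoras d2 L2_space_diff s2 F h2)
      then have "(L2_norm M ?d)\<^sup>2 \<le> (L2_norm M (\<lambda>x. k x - h x))\<^sup>2" by simp
      also have "\<dots> \<le> (sqrt e)\<^sup>2" using h(2) by (intro power_mono) auto
      finally have "(L2_norm M ?d)\<^sup>2 \<le> e" using e by simp
      then have "(L2_norm M k)\<^sup>2 \<le> (\<Sum>\<xi>\<in>F. ?a \<xi>) + e" using norm_k[OF F] by simp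
      then have "ennreal ((L2_norm M k)\<^sup>2) \<le> ennreal ((\<Sum>\<xi>\<in>F. ?a \<xi>) + e)" by (rule ennreal_leI)
      also have "\<dots> = ennreal (\<Sum>\<xi>\<in>F. ?a \<xi>) + ennreal e"
        using e by (intro ennreal_plus sum_nonneg) auto
      also have "\<dots> \<le> nonneg_sum ?a (sphere 0 1) + ennreal e"
        by (intro add_right_mono nonneg_sum_upper F)
      finally show "ennreal ((L2_norm M k)\<^sup>2) \<le> nonneg_sum ?a (sphere 0 1) + ennreal e" .
    qed
  qed
qed

end

section \<open>The maximal inequality and pointwise convergence\<close>

context measure_preserving_system
begin

text \<open>The maximal ergodic theorem by Garsia's argument. Let \<open>m x\<close> be the maximum
  of the Birkhoff sums of length at most \<open>N\<close>, the empty one included. Where \<open>m\<close> is positive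
  it is attained by a nonempty sum, and removing its first term gives \<open>m \<le> \<phi> + m \<circ> T\<close>;
  now integrate over \<open>{m > 0}\<close> and use the invariance of the integral of \<open>m\<close>.\<close>

lemma maximal_ergodic:
  fixes \<phi> :: "'a \<Rightarrow> real" and N :: nat
  assumes \<phi>: "integrable M \<phi>"
  defines "E \<equiv> {x\<in>space M. \<exists>n\<le>N. (\<Sum>j<n. \<phi> ((T ^^ j) x)) > 0}"
  shows "0 \<le> (\<integral>x. indicator E x * \<phi> x \<partial>M)"
proof -
  let ?S = "\<lambda>n x. \<Sum>j<n. \<phi> ((T ^^ j) x)"
  define m where "m x = Max ((\<lambda>n. ?S n x) ` {..N})" for x
  have S_le: "?S n x \<le> m x" if "n \<le> N" for n x unfolding m_def using that by (intro Max_ge) auto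
  have attained: "\<exists>n\<le>N. m x = ?S n x" for x
  proof -
    have "m x \<in> (\<lambda>n. ?S n x) ` {..N}" unfolding m_def by (rule Max_in) auto
    then show ?thesis by auto
  qed
  have m0: "0 \<le> m x" for x using S_le[of 0 x] by simp
  have [measurable]: "\<phi> \<in> borel_measurable M" using \<phi> by simp
  have S_int: "integrable M (?S n)" for n by (intro Bochner_Integration.integrable_sum integrable_funpow \<phi>)
  have m_meas [measurable]: "m \<in> borel_measurable M" unfolding m_def by measurable
  have m_int: "integrable M m"
  proof (rule Bochner_Integration.integrable_bound)
    show "integrable M (\<lambda>x. \<Sum>n\<le>N. \<bar>?S n x\<bar>)"
      by (intro Bochner_Integration.integrable_sum integrable_abs S_int)
    have "m x \<le> (\<Sum>n\<le>N. \<bar>?S n x\<bar>)" for x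
    proof -
      obtain n where "n \<le> N" "m x = ?S n x" using attained by blast
      moreover have "\<bar>?S n x\<bar> \<le> (\<Sum>n\<le>N. \<bar>?S n x\<bar>)"
        using \<open>n \<le> N\<close> by (intro member_le_sum) auto
      ultimately show ?thesis by linarith
    qed
    moreover have "0 \<le> (\<Sum>n\<le>N. \<bar>?S n x\<bar>)" for x by (intro sum_nonneg) auto
    ultimately show "AE x in M. norm (m x) \<le> norm (\<Sum>n\<le>N. \<bar>?S n x\<bar>)" using m0 by auto
  qed measurable
  have E_eq: "E = {x\<in>space M. m x > 0}"
  proof -
    have "(\<exists>n\<le>N. ?S n x > 0) \<longleftrightarrow> m x > 0" for x
      using attained[of x] S_le[of _ x] by (auto intro: less_le_trans)
    then show ?thesis by (simp add: E_def)
  qed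
  then have [measurable]: "E \<in> sets M" by simp
  have mT_int: "integrable M (\<lambda>x. m (T x))" using integrable_funpow[OF m_int, of 1] by simp
  have key: "m x - m (T x) \<le> indicator E x * \<phi> x" if x: "x \<in> space M" for x
  proof (cases "m x > 0")
    case True
    obtain n where n: "n \<le> N" "m x = ?S n x" using attained by blast
    with True obtain k where k: "n = Suc k" by (cases n) auto
    have "m x = \<phi> x + ?S k (T x)"
      using n(2) unfolding k sum.lessThan_Suc_shift by (simp add: funpow_swap1)
    then have "m x \<le> \<phi> x + m (T x)" using S_le[of k "T x"] n(1) k by simp
    then show ?thesis using True x by (simp add: E_eq)
  next
    case False
    then have "m x = 0" using m0[of x] by simp
    then show ?thesis using m0[of "T x"] by (simp add: E_eq)
  qed
  have "0 = (\<integral>x. m x \<partial>M) - (\<integral>x. m (T x) \<partial>M)" using integral_T[OF m_meas] by simp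
  also have "\<dots> = (\<integral>x. m x - m (T x) \<partial>M)"
    by (rule Bochner_Integration.integral_diff[symmetric]) (intro m_int mT_int)+
  also have "\<dots> \<le> (\<integral>x. indicator E x * \<phi> x \<partial>M)"
  proof (rule integral_mono)
    show "integrable M (\<lambda>x. indicator E x * \<phi> x)"
      using integrable_mult_indicator[OF \<open>E \<in> sets M\<close> \<phi>] by simp
  qed (use key m_int mT_int in auto)
  finally show ?thesis .
qed

text \<open>The weak-type estimate follows by applying the maximal ergodic theorem to \<open>\<bar>r\<bar> - \<alpha>\<close>, first for averages
  of bounded length.\<close>

lemma maximal_inequality:
  assumes r: "r \<in> L2_space M" and l: "\<alpha> > 0"
  shows "measure M {x\<in>space M. \<exists>n>0. (\<Sum>j<n. cmod (r ((T ^^ j) x))) / of_nat n > \<alpha>}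
    \<le> L2_norm M r / \<alpha>"
proof -
  define E where "E N = {x\<in>space M. \<exists>n\<le>N. (\<Sum>j<n. cmod (r ((T ^^ j) x)) - \<alpha>) > 0}" for N :: nat
  have [measurable]: "r \<in> borel_measurable M" using L2_spaceD(1)[OF r] .
  have E_meas [measurable]: "E N \<in> sets M" for N unfolding E_def by measurable
  have r_int: "integrable M (\<lambda>x. cmod (r x))" using L2_space_integrable[OF r] by (rule integrable_norm)
  have E_le: "measure M (E N) \<le> L2_norm M r / \<alpha>" for N
  proof -
    have int: "integrable M (\<lambda>x. cmod (r x) - \<alpha>)" by (intro Bochner_Integration.integrable_diff r_int) simp
    have "0 \<le> (\<integral>x. indicator (E N) x * (cmod (r x) - \<alpha>) \<partial>M)"
      using maximal_ergodic[OF int, of N] by (simp add: E_def)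
    also have "\<dots> = (\<integral>x. indicator (E N) x * cmod (r x) - \<alpha> * indicator (E N) x \<partial>M)"
      by (simp add: algebra_simps)
    also have "\<dots> = (\<integral>x. indicator (E N) x * cmod (r x) \<partial>M) - (\<integral>x. \<alpha> * indicator (E N) x \<partial>M)"
    proof (rule Bochner_Integration.integral_diff)
      show "integrable M (\<lambda>x. indicator (E N) x * cmod (r x))"
        using integrable_mult_indicator[OF E_meas r_int] by simp
      show "integrable M (\<lambda>x. \<alpha> * indicator (E N) x)"
        by (intro integrable_mult_right integrable_real_indicator) (auto simp: emeasure_eq_measure)
    qed
    also have "(\<integral>x. \<alpha> * indicator (E N) x \<partial>M) = \<alpha> * measure M (E N)" by simp
    also have "(\<integral>x. indicator (E N) x * cmod (r x) \<partial>M) \<le> (\<integral>x. cmod (r x) \<partial>M)"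
      using integrable_mult_indicator[OF E_meas r_int]
      by (intro integral_mono r_int) (auto simp: indicator_def)
    also have "\<dots> \<le> L2_norm M r" by (rule L1_norm_le_L2_norm[OF r])
    finally have "\<alpha> * measure M (E N) \<le> L2_norm M r" by simp
    then show ?thesis using l by (simp add: pos_le_divide_eq mult.commute)
  qed
  have "{x\<in>space M. \<exists>n>0. (\<Sum>j<n. cmod (r ((T ^^ j) x))) / of_nat n > \<alpha>} = (\<Union>N. E N)"
  proof -
    have "(\<exists>n>0. (\<Sum>j<n. cmod (r ((T ^^ j) x))) / of_nat n > \<alpha>)
        \<longleftrightarrow> (\<exists>N. \<exists>n\<le>N. (\<Sum>j<n. cmod (r ((T ^^ j) x)) - \<alpha>) > 0)" for x
    proof -
      have "(n > 0 \<and> (\<Sum>j<n. cmod (r ((T ^^ j) x))) / of_nat n > \<alpha>)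
          \<longleftrightarrow> (\<Sum>j<n. cmod (r ((T ^^ j) x)) - \<alpha>) > 0" for n
        by (cases "n = 0") (auto simp: sum_subtractf pos_less_divide_eq mult.commute)
      then show ?thesis by blast
    qed
    then show ?thesis by (auto simp: E_def)
  qed
  moreover have "measure M (\<Union>N. E N) \<le> L2_norm M r / \<alpha>"
  proof (rule LIMSEQ_le_const2)
    have "E N \<subseteq> E K" if "N \<le> K" for N K unfolding E_def using that order_trans by blast
    then have "incseq E" by (simp add: incseq_def)
    then show "(\<lambda>N. measure M (E N)) \<longlonglongrightarrow> measure M (\<Union>N. E N)"
      by (intro finite_Lim_measure_incseq) auto
  qed (use E_le in auto)
  ultimately show ?thesis by simp
qed

text \<open>The squares \<open>\<bar>h (T\<^sup>n x)\<bar>\<^sup>2 / n\<^sup>2\<close> have a finite sum of integrals, hence tend to 0 almost everywhere.\<close>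

lemma L2_orbit_sublinear:
  assumes h: "h \<in> L2_space M"
  shows "AE x in M. (\<lambda>n. h ((T ^^ n) x) / of_nat n) \<longlonglongrightarrow> 0"
proof -
  have [measurable]: "h \<in> borel_measurable M" using L2_spaceD(1)[OF h] .
  let ?g = "\<lambda>n x. (cmod (h ((T ^^ n) x) / of_nat n))\<^sup>2"
  have g: "?g n x = inverse ((real n)\<^sup>2) * (cmod (h ((T ^^ n) x)))\<^sup>2" for n x
    by (simp add: norm_divide power_divide) (simp add: divide_inverse)
  have "(\<integral>\<^sup>+x. (\<Sum>n. ennreal (?g n x)) \<partial>M) = (\<Sum>n. \<integral>\<^sup>+x. ennreal (?g n x) \<partial>M)"
    by (rule nn_integral_suminf) measurable
  also have "\<dots> = (\<Sum>n. ennreal (inverse ((real n)\<^sup>2) * (L2_norm M h)\<^sup>2))"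
  proof (rule arg_cong[of _ _ suminf], rule ext)
    fix n
    have "(\<integral>\<^sup>+x. ennreal (?g n x) \<partial>M) = ennreal (\<integral>x. ?g n x \<partial>M)"
      unfolding g using L2_spaceD(2)[OF L2_space_funpow[OF h]]
      by (intro nn_integral_eq_integral) auto
    also have "(\<integral>x. ?g n x \<partial>M) = inverse ((real n)\<^sup>2) * (L2_norm M h)\<^sup>2"
      unfolding g using integral_funpow[of "\<lambda>x. (cmod (h x))\<^sup>2" n] by (simp add: L2_norm_square)
    finally show "(\<integral>\<^sup>+x. ennreal (?g n x) \<partial>M) = ennreal (inverse ((real n)\<^sup>2) * (L2_norm M h)\<^sup>2)" .
  qed
  also have "\<dots> = ennreal (\<Sum>n. inverse ((real n)\<^sup>2) * (L2_norm M h)\<^sup>2)"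
    by (intro suminf_ennreal2 summable_mult2) (auto intro!: inverse_power_summable)
  finally have "(\<integral>\<^sup>+x. (\<Sum>n. ennreal (?g n x)) \<partial>M) \<noteq> \<infinity>" by simp
  then have "AE x in M. (\<Sum>n. ennreal (?g n x)) \<noteq> \<infinity>"
    by (intro nn_integral_PInf_AE) measurable
  then show ?thesis
  proof eventually_elim
    fix x assume "(\<Sum>n. ennreal (?g n x)) \<noteq> \<infinity>"
    then have "summable (\<lambda>n. ?g n x)" by (intro summable_suminf_not_top) auto
    then have "(\<lambda>n. ?g n x) \<longlonglongrightarrow> 0" by (rule summable_LIMSEQ_zero)
    then have "(\<lambda>n. sqrt (?g n x)) \<longlonglongrightarrow> sqrt 0" by (rule tendsto_real_sqrt)
    then show "(\<lambda>n. h ((T ^^ n) x) / of_nat n) \<longlonglongrightarrow> 0"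
      by (intro tendsto_norm_zero_cancel[of "\<lambda>n. h ((T ^^ n) x) / of_nat n"]) simp
  qed
qed

lemma twisted_avg_coboundary_tendsto_0:
  assumes h: "h \<in> L2_space M" and \<xi>: "cmod \<xi> = 1"
  shows "AE x in M. (\<lambda>n. twisted_avg T \<xi> n (\<lambda>x. h x - cnj \<xi> * h (T x)) x) \<longlonglongrightarrow> 0"
  using L2_orbit_sublinear[OF h]
proof eventually_elim
  fix x assume lim: "(\<lambda>n. h ((T ^^ n) x) / of_nat n) \<longlonglongrightarrow> 0"
  have "cmod (cnj \<xi> ^ n * (h ((T ^^ n) x) / of_nat n)) = cmod (h ((T ^^ n) x) / of_nat n)" for n
    unfolding norm_mult norm_power by (simp add: \<xi>)
  then have "(\<lambda>n. cmod (cnj \<xi> ^ n * (h ((T ^^ n) x) / of_nat n))) \<longlonglongrightarrow> 0"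
    using tendsto_norm_zero[OF lim] by (simp only:)
  then have "(\<lambda>n. cnj \<xi> ^ n * (h ((T ^^ n) x) / of_nat n)) \<longlonglongrightarrow> 0"
    by (rule tendsto_norm_zero_cancel)
  then have "(\<lambda>n. h x / of_nat n - cnj \<xi> ^ n * (h ((T ^^ n) x) / of_nat n)) \<longlonglongrightarrow> 0 - 0"
    by (intro tendsto_diff lim_const_over_n)
  then show "(\<lambda>n. twisted_avg T \<xi> n (\<lambda>x. h x - cnj \<xi> * h (T x)) x) \<longlonglongrightarrow> 0"
    by (simp add: twisted_avg_coboundary diff_divide_distrib)
qed

text \<open>The pointwise ergodic theorem with a twist. The convergence is clear on the eigenspace and on
  coboundaries; the maximal inequality transfers it to the closure of the coboundaries.\<close>

theorem twisted_avg_tendsto_eigen_proj: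
  assumes f: "f \<in> L2_space M" and \<xi>: "cmod \<xi> = 1"
  shows "AE x in M. (\<lambda>n. twisted_avg T \<xi> n f x) \<longlonglongrightarrow> eigen_proj T M \<xi> f x"
proof -
  let ?P = "eigen_proj T M \<xi> f"
  define q where "q = (\<lambda>x. f x - ?P x)"
  note P2 = eigen_proj_L2[OF f \<xi>]
  have q2: "q \<in> L2_space M" unfolding q_def by (intro L2_space_diff f P2)
  have "\<exists>h\<in>L2_space M. L2_norm M (\<lambda>x. q x - (h x - cnj \<xi> * h (T x))) < 1 / Suc k" for k
  proof -
    have "0 < 1 / real (Suc k)" by simp
    then obtain v where "v \<in> coboundaries \<xi>" "L2_norm M (\<lambda>x. q x - v x) < 1 / Suc k"
      using eigen_proj_properties(3)[OF f \<xi>] unfolding q_def L2_closure_def by blast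
    then show ?thesis by (auto simp: coboundaries_def)
  qed
  then obtain h where h: "\<And>k. h k \<in> L2_space M"
    and hq: "\<And>k. L2_norm M (\<lambda>x. q x - (h k x - cnj \<xi> * h k (T x))) < 1 / Suc k"
    by metis
  define v where "v k = (\<lambda>x. h k x - cnj \<xi> * h k (T x))" for k
  define r where "r k = (\<lambda>x. q x - v k x)" for k
  have v2: "v k \<in> L2_space M" for k
    unfolding v_def by (intro L2_space_diff L2_space_cmult L2_space_T h)
  have r2: "r k \<in> L2_space M" for k unfolding r_def by (intro L2_space_diff q2 v2)
  have [measurable]: "r k \<in> borel_measurable M" for k using L2_spaceD(1)[OF r2] .
  \<comment> \<open>The error \<open>r k\<close> of the \<open>k\<close>-th coboundary may disturb some average by more than \<open>\<alpha>\<close> only on \<open>E \<alpha> k\<close>,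
    whose measure is at most \<open>1 / (\<alpha> (k + 1))\<close>.\<close>
  define E where "E \<alpha> k = {x\<in>space M. \<exists>n>0. (\<Sum>j<n. cmod (r k ((T ^^ j) x))) / of_nat n > \<alpha>}"
    for \<alpha> :: real and k
  have E_meas [measurable]: "E \<alpha> k \<in> sets M" for \<alpha> k unfolding E_def by measurable
  have small: "AE x in M. \<exists>k. x \<notin> E \<alpha> k" if l: "\<alpha> > 0" for \<alpha>
  proof -
    have "measure M (\<Inter>k. E \<alpha> k) \<le> 0"
    proof (rule LIMSEQ_le_const)
      show "(\<lambda>k. (1 / \<alpha>) * (1 / real (Suc k))) \<longlonglongrightarrow> 0"
        using tendsto_mult_right_zero[OF lim_1_over_n[THEN LIMSEQ_Suc]] by blast
      have "measure M (\<Inter>k. E \<alpha> k) \<le> (1 / \<alpha>) * (1 / real (Suc k))" for k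
      proof -
        have "measure M (\<Inter>k. E \<alpha> k) \<le> measure M (E \<alpha> k)" by (intro finite_measure_mono) auto
        also have "\<dots> \<le> L2_norm M (r k) / \<alpha>" unfolding E_def by (rule maximal_inequality[OF r2 l])
        also have "\<dots> \<le> (1 / real (Suc k)) / \<alpha>"
          using hq[of k] l by (intro divide_right_mono) (auto simp: r_def v_def)
        finally show ?thesis by (simp add: mult.commute)
      qed
      then show "\<exists>N. \<forall>n\<ge>N. measure M (\<Inter>k. E \<alpha> k) \<le> (1 / \<alpha>) * (1 / real (Suc n))" by blast
    qed
    then have "measure M (\<Inter>k. E \<alpha> k) = 0" using measure_nonneg[of M "\<Inter>k. E \<alpha> k"] by linarith
    then have "(\<Inter>k. E \<alpha> k) \<in> null_sets M" by (intro null_setsI) (auto simp: emeasure_eq_measure)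
    then have "AE x in M. x \<notin> (\<Inter>k. E \<alpha> k)" by (rule AE_not_in)
    then show ?thesis by eventually_elim auto
  qed
  have "AE x in M. \<forall>i. \<exists>k. x \<notin> E (1 / Suc i) k"
    unfolding AE_all_countable by (intro allI small) simp
  moreover have "AE x in M. \<forall>k. (\<lambda>n. twisted_avg T \<xi> n (v k) x) \<longlonglongrightarrow> 0"
    unfolding AE_all_countable v_def by (intro allI twisted_avg_coboundary_tendsto_0 h \<xi>)
  moreover note twisted_avg_eigenfunction[OF eigen_proj_properties(1)[OF f \<xi>] \<xi>]
  moreover note AE_space
  ultimately show ?thesis
  proof eventually_elim
    fix x
    assume E: "\<forall>i. \<exists>k. x \<notin> E (1 / Suc i) k"
      and v: "\<forall>k. (\<lambda>n. twisted_avg T \<xi> n (v k) x) \<longlonglongrightarrow> 0"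
      and P: "\<forall>n>0. twisted_avg T \<xi> n ?P x = ?P x" and x: "x \<in> space M"
    show "(\<lambda>n. twisted_avg T \<xi> n f x) \<longlonglongrightarrow> ?P x"
    proof (rule LIMSEQ_I)
      fix e :: real assume "e > 0"
      then have "e / 2 > 0" by simp
      then obtain i where i: "1 / Suc i < e / 2" using nat_approx_posE by blast
      obtain k where k: "x \<notin> E (1 / Suc i) k" using E by blast
      from LIMSEQ_D[OF v[rule_format, of k] \<open>e / 2 > 0\<close>]
      obtain n0 where n0: "\<And>n. n \<ge> n0 \<Longrightarrow> cmod (twisted_avg T \<xi> n (v k) x) < e / 2" by auto
      have "cmod (twisted_avg T \<xi> n f x - ?P x) < e" if n: "n \<ge> Suc n0" for n
      proof -
        have "twisted_avg T \<xi> n (r k) x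
            = twisted_avg T \<xi> n f x - twisted_avg T \<xi> n ?P x - twisted_avg T \<xi> n (v k) x"
          by (simp add: r_def q_def twisted_avg_diff)
        then have "twisted_avg T \<xi> n f x - ?P x
            = twisted_avg T \<xi> n (r k) x + twisted_avg T \<xi> n (v k) x"
          using P n by simp
        then have "cmod (twisted_avg T \<xi> n f x - ?P x)
            \<le> cmod (twisted_avg T \<xi> n (r k) x) + cmod (twisted_avg T \<xi> n (v k) x)"
          by (simp add: norm_triangle_ineq)
        moreover have "cmod (twisted_avg T \<xi> n (r k) x) \<le> 1 / Suc i"
        proof -
          have "\<not> (\<Sum>j<n. cmod (r k ((T ^^ j) x))) / of_nat n > 1 / Suc i"
          proof
            assume "(\<Sum>j<n. cmod (r k ((T ^^ j) x))) / of_nat n > 1 / Suc i"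
            then have "x \<in> E (1 / Suc i) k"
              unfolding E_def using x n by (intro CollectI conjI exI[of _ n]) simp_all
            with k show False by simp
          qed
          then show ?thesis using cmod_twisted_avg_le[OF \<xi>, of T n "r k" x] by linarith
        qed
        ultimately show ?thesis using i n0[of n] n by simp
      qed
      then show "\<exists>n0. \<forall>n\<ge>n0. cmod (twisted_avg T \<xi> n f x - ?P x) < e" by blast
    qed
  qed
qed

end

section \<open>Ergodicity\<close>

locale ergodic_system = measure_preserving_system M T for M :: "'a measure" and T :: "'a \<Rightarrow> 'a" +
  assumes invariant_trivial:
    "\<And>A. A \<in> sets M \<Longrightarrow> T -` A \<inter> space M = A \<Longrightarrow> emeasure M A = 0 \<or> emeasure M A = 1"
begin

text \<open>The notion of ergodicity only refers to sets with \<open>T\<^sup>-\<^sup>1 A = A\<close>. A set that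
  is invariant up to a null set is replaced by the set of points whose orbit visits it infinitely
  often, which is invariant and differs from it by a null set.\<close>

lemma ergodic_almost_invariant:
  assumes P [measurable]: "Measurable.pred M P" and inv: "AE x in M. P (T x) = P x"
  shows "(AE x in M. P x) \<or> (AE x in M. \<not> P x)"
proof -
  define A where "A = {x\<in>space M. \<exists>\<^sub>\<infinity>n. P ((T ^^ n) x)}"
  have [measurable]: "A \<in> sets M" unfolding A_def INFM_nat by measurable
  have T_space: "T x \<in> space M" if "x \<in> space M" for x
    using measurable_space[OF measurable_T that] .
  have shift: "(\<exists>\<^sub>\<infinity>n. P ((T ^^ n) (T x))) \<longleftrightarrow> (\<exists>\<^sub>\<infinity>n. P ((T ^^ n) x))" for x
    unfolding INFM_nat
  proof safe
    fix m assume "\<forall>m. \<exists>n>m. P ((T ^^ n) (T x))"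
    then obtain n where "n > m" "P ((T ^^ n) (T x))" by blast
    then show "\<exists>n>m. P ((T ^^ n) x)" by (intro exI[of _ "Suc n"]) (simp add: funpow_swap1)
  next
    fix m assume "\<forall>m. \<exists>n>m. P ((T ^^ n) x)"
    then obtain n where "n > Suc m" "P ((T ^^ n) x)" by blast
    then show "\<exists>n>m. P ((T ^^ n) (T x))"
      by (cases n) (auto simp: funpow_swap1 intro!: exI[of _ "n - 1"])
  qed
  have "T -` A \<inter> space M = A" using T_space by (auto simp: A_def shift)
  then have "emeasure M A = 0 \<or> emeasure M A = 1" by (intro invariant_trivial) auto
  moreover have A_iff: "AE x in M. x \<in> A \<longleftrightarrow> P x"
  proof -
    have "AE x in M. \<forall>n. P (T ((T ^^ n) x)) = P ((T ^^ n) x)"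
      unfolding AE_all_countable using AE_funpow[OF inv] by blast
    then show ?thesis using AE_space
    proof eventually_elim
      fix x assume *: "\<forall>n. P (T ((T ^^ n) x)) = P ((T ^^ n) x)" and x: "x \<in> space M"
      have "P ((T ^^ n) x) = P x" for n by (induction n) (use * in auto)
      then show "x \<in> A \<longleftrightarrow> P x" using x by (auto simp: A_def INFM_nat)
    qed
  qed
  moreover have "AE x in M. x \<in> A" if "emeasure M A = 1"
    using that by (intro AE_in_set_eq_1[THEN iffD2]) (auto simp: emeasure_eq_measure)
  moreover have "AE x in M. x \<notin> A" if "emeasure M A = 0"
    using that by (intro AE_not_in null_setsI) auto
  ultimately consider "AE x in M. x \<in> A" | "AE x in M. x \<notin> A" by blast
  then show ?thesis
  proof cases
    case 1
    then have "AE x in M. P x" using A_iff by eventually_elim simp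
    then show ?thesis ..
  next
    case 2
    then have "AE x in M. \<not> P x" using A_iff by eventually_elim simp
    then show ?thesis ..
  qed
qed

text \<open>An invariant function exceeds its mean almost everywhere or almost nowhere, and the former is
  impossible. The same holds for its negative.\<close>

lemma ergodic_invariant_const:
  fixes \<phi> :: "'a \<Rightarrow> real"
  assumes \<phi>: "integrable M \<phi>" and inv: "AE x in M. \<phi> (T x) = \<phi> x"
  shows "AE x in M. \<phi> x = (\<integral>x. \<phi> x \<partial>M)"
proof -
  have le: "AE x in M. \<psi> x \<le> (\<integral>x. \<psi> x \<partial>M)"
    if \<psi>: "integrable M \<psi>" and inv: "AE x in M. \<psi> (T x) = \<psi> x" for \<psi> :: "'a \<Rightarrow> real"
  proof -
    let ?c = "\<integral>x. \<psi> x \<partial>M"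
    have [measurable]: "\<psi> \<in> borel_measurable M" using \<psi> by simp
    have "(AE x in M. \<psi> x > ?c) \<or> (AE x in M. \<not> \<psi> x > ?c)"
      by (rule ergodic_almost_invariant) (use inv in \<open>auto elim: eventually_mono\<close>)
    moreover have False if gt: "AE x in M. \<psi> x > ?c"
    proof -
      have int: "integrable M (\<lambda>x. \<psi> x - ?c)" using \<psi> by simp
      have "(\<integral>x. \<psi> x - ?c \<partial>M) = 0" using \<psi> by (simp add: prob_space)
      moreover have "AE x in M. 0 \<le> \<psi> x - ?c" using gt by eventually_elim simp
      ultimately have "AE x in M. \<psi> x - ?c = 0"
        using integral_nonneg_eq_0_iff_AE[OF int] by blast
      with gt have "AE x in M. False" by eventually_elim simp
      then show False by (simp add: AE_False)
    qed
    ultimately have "AE x in M. \<not> \<psi> x > ?c" by blast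
    then show ?thesis by eventually_elim simp
  qed
  have "AE x in M. \<phi> x \<le> (\<integral>x. \<phi> x \<partial>M)" by (rule le[OF \<phi> inv])
  moreover have "AE x in M. - \<phi> x \<le> (\<integral>x. - \<phi> x \<partial>M)"
    using \<phi> inv by (intro le) auto
  ultimately show ?thesis by eventually_elim simp
qed

lemma ergodic_cmod_eigen_proj:
  assumes f: "f \<in> L2_space M" and \<xi>: "cmod \<xi> = 1"
  shows "AE x in M. cmod (eigen_proj T M \<xi> f x) = L2_norm M (eigen_proj T M \<xi> f)"
proof -
  let ?s = "eigen_proj T M \<xi> f"
  note s = eigen_proj_properties(1)[OF f \<xi>]
  have "AE x in M. (cmod (?s x))\<^sup>2 = (\<integral>x. (cmod (?s x))\<^sup>2 \<partial>M)"
  proof (rule ergodic_invariant_const)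
    show "AE x in M. (cmod (?s (T x)))\<^sup>2 = (cmod (?s x))\<^sup>2"
      using eigenspaceD(2)[OF s] by eventually_elim (simp add: norm_mult \<xi>)
  qed (use L2_spaceD(2)[OF eigenspaceD(1)[OF s]] in auto)
  then show ?thesis by eventually_elim (metis L2_norm_def norm_ge_zero real_sqrt_unique)
qed

lemma ergodic_eigen_proj_1:
  assumes f: "f \<in> L2_space M"
  shows "AE x in M. eigen_proj T M 1 f x = (\<integral>x. f x \<partial>M)"
proof -
  let ?s = "eigen_proj T M 1 f"
  note s = eigen_proj_properties(1)[OF f, of 1, simplified]
  have s_int: "integrable M ?s" using L2_space_integrable[OF eigenspaceD(1)[OF s]] .
  have inv: "AE x in M. ?s (T x) = ?s x" using eigenspaceD(2)[OF s] by simp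
  have "AE x in M. Re (?s x) = (\<integral>x. Re (?s x) \<partial>M)"
    by (rule ergodic_invariant_const) (use s_int inv in \<open>auto elim: eventually_mono\<close>)
  moreover have "AE x in M. Im (?s x) = (\<integral>x. Im (?s x) \<partial>M)"
    by (rule ergodic_invariant_const) (use s_int inv in \<open>auto elim: eventually_mono\<close>)
  moreover have "(\<integral>x. ?s x \<partial>M) = (\<integral>x. f x \<partial>M)"
  proof -
    have one: "(\<lambda>x. 1) \<in> eigenspace T M 1" by (simp add: eigenspace_def L2_space_const)
    show ?thesis using L2_inner_eigen_proj[OF f _ one] by (simp add: L2_inner_def)
  qed
  ultimately show ?thesis
    using s_int by (auto simp: complex_eq_iff integral_Re integral_Im elim!: eventually_elim2)
qed

end

section \<open>Continuous functions on a compact metric space\<close>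

text \<open>Given \<open>\<delta>\<close> and \<open>\<epsilon>\<close>, a continuous function that oscillates by less than \<open>\<epsilon>\<close> on
  \<open>\<delta>\<close>-balls is determined up to \<open>O(\<epsilon>)\<close> by approximate values at the points of a finite
  \<open>\<delta>\<close>-net. One representative for each of these countably many possible samples is enough.\<close>

lemma separable_bcontfun:
  assumes compact: "compact (UNIV :: 'a::metric_space set)"
  obtains D :: "('a::metric_space \<Rightarrow>\<^sub>C complex) set" where "countable D" "closure D = UNIV"
proof -
  obtain Q :: "complex set" where Q: "countable Q" "\<And>X. open X \<Longrightarrow> X \<noteq> {} \<Longrightarrow> \<exists>d\<in>Q. d \<in> X"
    using countable_dense_setE by blast
  have "\<forall>e>0. \<exists>K. finite K \<and> (UNIV :: 'a set) \<subseteq> (\<Union>x\<in>K. ball x e)"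
    using compact compact_eq_totally_bounded by blast
  then have "\<exists>K. finite K \<and> (UNIV :: 'a set) \<subseteq> (\<Union>x\<in>K. ball x (1 / real (Suc n)))" for n
    by simp
  then obtain N :: "nat \<Rightarrow> 'a set" where N: "\<And>n. finite (N n)"
    and cover: "\<And>n. UNIV \<subseteq> (\<Union>y\<in>N n. ball y (1 / real (Suc n)))"
    by metis
  define S where "S n m \<phi> f \<longleftrightarrow> (\<forall>x. \<forall>y\<in>N n. dist y x < 1 / real (Suc n) \<longrightarrow> dist (apply_bcontfun f x) (\<phi> y) < 1 / real (Suc m))"
    for n m :: nat and \<phi> :: "'a \<Rightarrow> complex" and f :: "'a \<Rightarrow>\<^sub>C complex"
  define I where "I = (SIGMA n:(UNIV::nat set). (UNIV::nat set) \<times> (N n \<rightarrow>\<^sub>E Q))"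
  define D where "D = (\<lambda>(n, m, \<phi>). SOME f. S n m \<phi> f) ` I"
  have "countable D"
    unfolding D_def I_def using N Q(1)
    by (intro countable_image countable_SIGMA countable_PiE countableI_type) auto
  moreover have "closure D = UNIV"
  proof -
    have "\<exists>f\<in>D. dist f g < e" if e: "e > 0" for g e
    proof -
      obtain m where m: "1 / real (Suc m) < e / 3" using nat_approx_posE[of "e / 3"] e by auto
      \<comment> \<open>Both the oscillation of \<open>g\<close> and the rounding of its values to \<open>Q\<close> use up one \<open>\<epsilon>\<close>.\<close>
      define \<epsilon> where "\<epsilon> = 1 / (2 * real (Suc m))"
      have \<epsilon>: "\<epsilon> > 0" "\<epsilon> + \<epsilon> = 1 / real (Suc m)" by (auto simp: \<epsilon>_def field_simps)
      have "uniformly_continuous_on UNIV (apply_bcontfun g)"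
        by (intro compact_uniformly_continuous compact) simp
      then obtain \<delta> where \<delta>: "\<delta> > 0" "\<And>x y. dist y x < \<delta> \<Longrightarrow> dist (g y) (g x) < \<epsilon>"
        using \<epsilon>(1) by (rule uniformly_continuous_onE) auto
      obtain n where n: "1 / real (Suc n) < \<delta>" using nat_approx_posE[OF \<delta>(1)] by blast
      have "\<exists>q\<in>Q. dist (g y) q < \<epsilon>" for y
        using Q(2)[of "ball (g y) \<epsilon>"] \<epsilon>(1) by auto
      then obtain q where q: "\<And>y. q y \<in> Q" "\<And>y. dist (g y) (q y) < \<epsilon>" by metis
      define \<phi> where "\<phi> = restrict q (N n)"
      have "S n m \<phi> g"
        unfolding S_def
      proof (intro allI ballI impI)
        fix x y assume y: "y \<in> N n" "dist y x < 1 / real (Suc n)"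
        have "dist (g x) (\<phi> y) \<le> dist (g y) (g x) + dist (g y) (q y)"
          using y(1) dist_triangle3[of "g x" "q y" "g y"] by (simp add: \<phi>_def)
        also have "\<dots> < \<epsilon> + \<epsilon>" using \<delta>(2)[of y x] y n q(2)[of y] by simp
        finally show "dist (g x) (\<phi> y) < 1 / real (Suc m)" by (simp only: \<epsilon>)
      qed
      then have f: "S n m \<phi> (SOME f. S n m \<phi> f)" by (rule someI)
      let ?f = "SOME f. S n m \<phi> f"
      have "(n, m, \<phi>) \<in> I" using q(1) by (auto simp: I_def \<phi>_def)
      then have "?f \<in> D" unfolding D_def by (rule rev_image_eqI) simp
      moreover have "dist ?f g \<le> 2 * (1 / real (Suc m))"
      proof (rule dist_bound)
        fix x
        have "x \<in> (\<Union>y\<in>N n. ball y (1 / real (Suc n)))" using cover by blast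
        then obtain y where y: "y \<in> N n" "dist y x < 1 / real (Suc n)" by auto
        have "dist (?f x) (g x) \<le> dist (?f x) (\<phi> y) + dist (g x) (\<phi> y)" by (rule dist_triangle2)
        also have "\<dots> \<le> 2 * (1 / real (Suc m))"
        proof -
          have "dist (?f x) (\<phi> y) < 1 / real (Suc m)" using f y unfolding S_def by blast
          moreover have "dist (g x) (\<phi> y) < 1 / real (Suc m)" using \<open>S n m \<phi> g\<close> y unfolding S_def by blast
          ultimately show ?thesis by linarith
        qed
        finally show "dist (?f x) (g x) \<le> 2 * (1 / real (Suc m))" .
      qed
      ultimately show ?thesis using m e by (intro bexI[of _ ?f]) auto
    qed
    then show ?thesis by (auto simp: closure_approachable)
  qed
  ultimately show ?thesis by (rule that)
qed

lemma sum_shift_diff_le: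
  fixes a :: "nat \<Rightarrow> complex"
  assumes "\<And>m. cmod (a m) \<le> B"
  shows "cmod ((\<Sum>j<n. a (i + j)) - (\<Sum>j<n. a j)) \<le> 2 * real i * B"
proof (induction i)
  case (Suc i)
  have "(\<Sum>j<n. a (Suc i + j)) - (\<Sum>j<n. a (i + j)) = (\<Sum>j<n. a (i + Suc j) - a (i + j))"
    by (simp add: sum_subtractf)
  also have "\<dots> = a (i + n) - a (i + 0)" by (rule sum_lessThan_telescope[of "\<lambda>j. a (i + j)"])
  finally have "(\<Sum>j<n. a (Suc i + j)) - (\<Sum>j<n. a j)
      = (a (i + n) - a i) + ((\<Sum>j<n. a (i + j)) - (\<Sum>j<n. a j))" by (simp add: algebra_simps)
  also have "cmod \<dots> \<le> (cmod (a (i + n)) + cmod (a i)) + cmod ((\<Sum>j<n. a (i + j)) - (\<Sum>j<n. a j))"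
    by (intro order_trans[OF norm_triangle_ineq] add_right_mono norm_triangle_ineq4)
  also have "\<dots> \<le> (B + B) + 2 * real i * B" by (intro add_mono assms Suc)
  finally show ?case by (simp add: algebra_simps)
qed simp

text \<open>Averaging over windows of fixed length \<open>k\<close> does not change the long-term behaviour of averages.\<close>

lemma twisted_avg_twisted_avg_close:
  assumes \<xi>: "cmod \<xi> = 1" and B: "\<And>x. cmod (f x) \<le> B" and k: "k > 0" and n: "n > 0"
  shows "cmod (twisted_avg T \<xi> n (twisted_avg T \<xi> k f) x - twisted_avg T \<xi> n f x) \<le> 2 * real k * B / real n"
proof -
  define a where "a m = cnj \<xi> ^ m * f ((T ^^ m) x)" for m
  have a: "cmod (a m) \<le> B" for m using B by (simp add: a_def norm_mult norm_power \<xi>)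
  have "cnj \<xi> ^ j * twisted_avg T \<xi> k f ((T ^^ j) x) = (\<Sum>i<k. a (i + j)) / of_nat k" for j
    by (simp add: twisted_avg_def a_def sum_distrib_left power_add funpow_add mult_ac)
  then have "twisted_avg T \<xi> n (twisted_avg T \<xi> k f) x
      = (\<Sum>j<n. \<Sum>i<k. a (i + j)) / (of_nat k * of_nat n)"
    by (simp add: twisted_avg_def[of T \<xi> n] sum_divide_distrib)
  also have "(\<Sum>j<n. \<Sum>i<k. a (i + j)) = (\<Sum>i<k. \<Sum>j<n. a (i + j))" by (rule sum.swap)
  finally have 1: "twisted_avg T \<xi> n (twisted_avg T \<xi> k f) x
      = (\<Sum>i<k. \<Sum>j<n. a (i + j)) / (of_nat k * of_nat n)" .
  have 2: "twisted_avg T \<xi> n f x = (\<Sum>i<k. \<Sum>j<n. a j) / (of_nat k * of_nat n)"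
    using k by (simp add: twisted_avg_def a_def)
  have "cmod (\<Sum>i<k. (\<Sum>j<n. a (i + j)) - (\<Sum>j<n. a j)) \<le> (\<Sum>i<k. 2 * real k * B)"
  proof (rule sum_norm_le)
    fix i assume "i \<in> {..<k}"
    have "0 \<le> B" using a[of 0] norm_ge_zero order_trans by blast
    then have "2 * real i * B \<le> 2 * real k * B" using \<open>i \<in> {..<k}\<close> by (intro mult_right_mono) auto
    with sum_shift_diff_le[of a B i n, OF a]
    show "cmod ((\<Sum>j<n. a (i + j)) - (\<Sum>j<n. a j)) \<le> 2 * real k * B" by linarith
  qed
  then have "cmod ((\<Sum>i<k. \<Sum>j<n. a (i + j)) - (\<Sum>i<k. \<Sum>j<n. a j)) \<le> real k * (2 * real k * B)"
    by (simp add: sum_subtractf)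
  then have "cmod (((\<Sum>i<k. \<Sum>j<n. a (i + j)) - (\<Sum>i<k. \<Sum>j<n. a j)) / (of_nat k * of_nat n))
      \<le> real k * (2 * real k * B) / (real k * real n)"
    by (simp only: norm_divide norm_mult norm_of_nat) (intro divide_right_mono; simp)
  then show ?thesis using k unfolding 1 2 by (simp add: diff_divide_distrib)
qed

locale topological_system = measure_preserving_system M T
  for M :: "'a::metric_space measure" and T :: "'a \<Rightarrow> 'a" +
  assumes compact_UNIV: "compact (UNIV :: 'a set)" and continuous_T: "continuous_on UNIV T"
    and sets_M: "sets M = sets borel"
begin

lemma space_M: "space M = UNIV"
  using sets_eq_imp_space_eq[OF sets_M] by simp

lemma continuous_measurable:
  fixes f :: "'a \<Rightarrow> 'b::topological_space"
  assumes "continuous_on UNIV f"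
  shows "f \<in> borel_measurable M"
  using borel_measurable_continuous_onI[OF assms] measurable_cong_sets[OF sets_M refl] by blast

lemma bcontfun_measurable [measurable]: "apply_bcontfun (f :: 'a \<Rightarrow>\<^sub>C complex) \<in> borel_measurable M"
  by (rule continuous_measurable) simp

lemma cmod_bcontfun_le: "cmod (apply_bcontfun (f :: 'a \<Rightarrow>\<^sub>C complex) x) \<le> norm f"
  by (rule norm_bounded)

lemma bcontfun_L2: "apply_bcontfun f \<in> L2_space M"
  by (rule L2_norm_bounded[of _ "norm f"]) (auto intro: cmod_bcontfun_le)

lemma L2_norm_bcontfun_diff_le:
  "L2_norm M (\<lambda>x. apply_bcontfun f x - apply_bcontfun g x) \<le> dist f g"
  by (rule L2_norm_bounded) (auto simp: dist_norm[symmetric] dist_bounded)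

lemma continuous_bcontfun:
  assumes "continuous_on UNIV (f :: 'a \<Rightarrow> complex)"
  shows "f \<in> bcontfun"
proof -
  have "bounded (range f)"
    using compact_continuous_image[OF assms compact_UNIV] by (rule compact_imp_bounded)
  with assms show ?thesis by (simp add: bcontfun_def)
qed

lemma continuous_funpow: "continuous_on UNIV (T ^^ j)"
proof (induction j)
  case (Suc j)
  then show ?case
    using continuous_on_compose[of UNIV "T ^^ j" T] continuous_T
    by (auto intro: continuous_on_subset)
qed (simp add: continuous_on_id)

lemma twisted_avg_continuous:
  assumes "continuous_on UNIV f"
  shows "continuous_on UNIV (twisted_avg T \<xi> k f)"
proof -
  have "continuous_on UNIV (\<lambda>x. f ((T ^^ j) x))" for j
    using continuous_on_compose2[OF assms continuous_funpow] by auto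
  then show ?thesis
    unfolding twisted_avg_def[abs_def] by (cases "k = 0") (auto intro!: continuous_intros)
qed

text \<open>The bound of Fourier-Bohr averages at a generic point: replace \<open>f\<close> by a twisted average of
  fixed length, apply the Cauchy-Schwarz inequality to the average over the orbit, and use
  genericity for the square of the modulus. The mean ergodic theorem takes care of the resulting
  \<open>L\<^sup>2\<close>-norm.\<close>

lemma generic_fb_avg_eventually_le:
  fixes f :: "'a \<Rightarrow>\<^sub>C complex"
  assumes x: "generic_point T M x" and \<xi>: "cmod \<xi> = 1" and e: "e > 0"
  shows "\<forall>\<^sub>F n in sequentially. cmod (fb_avg T f \<xi> n x) \<le> L2_norm M (eigen_proj T M \<xi> f) + e"
proof -
  obtain k where k: "k > 0" "L2_norm M (twisted_avg T \<xi> k f) \<le> L2_norm M (eigen_proj T M \<xi> f) + e / 2"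
    using twisted_avg_norm_le_eigen_proj[OF bcontfun_L2 \<xi>, of "e / 2" f] e by auto
  define F where "F = twisted_avg T \<xi> k f"
  have F_cont: "continuous_on UNIV F" unfolding F_def by (rule twisted_avg_continuous) simp
  define G where "G = Bcontfun (\<lambda>y. complex_of_real ((cmod (F y))\<^sup>2))"
  have G: "apply_bcontfun G = (\<lambda>y. complex_of_real ((cmod (F y))\<^sup>2))"
    unfolding G_def
    by (rule Bcontfun_inverse, rule continuous_bcontfun) (intro continuous_intros F_cont)
  have "(\<lambda>n. (\<Sum>j<n. complex_of_real ((cmod (F ((T ^^ j) x)))\<^sup>2)) / of_nat n)
      \<longlonglongrightarrow> (\<integral>y. complex_of_real ((cmod (F y))\<^sup>2) \<partial>M)"
    using x[unfolded generic_point_def, rule_format, of G] unfolding G .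
  then have "(\<lambda>n. complex_of_real ((\<Sum>j<n. (cmod (F ((T ^^ j) x)))\<^sup>2) / of_nat n))
      \<longlonglongrightarrow> complex_of_real ((L2_norm M F)\<^sup>2)"
    unfolding integral_complex_of_real L2_norm_square by simp
  then have "(\<lambda>n. (\<Sum>j<n. (cmod (F ((T ^^ j) x)))\<^sup>2) / of_nat n) \<longlonglongrightarrow> (L2_norm M F)\<^sup>2"
    by (simp only: tendsto_of_real_iff)
  then have "(\<lambda>n. sqrt ((\<Sum>j<n. (cmod (F ((T ^^ j) x)))\<^sup>2) / of_nat n)) \<longlonglongrightarrow> sqrt ((L2_norm M F)\<^sup>2)"
    by (rule tendsto_real_sqrt)
  then have "(\<lambda>n. sqrt ((\<Sum>j<n. (cmod (F ((T ^^ j) x)))\<^sup>2) / of_nat n)) \<longlonglongrightarrow> L2_norm M F"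
    by simp
  then have "\<forall>\<^sub>F n in sequentially.
      sqrt ((\<Sum>j<n. (cmod (F ((T ^^ j) x)))\<^sup>2) / of_nat n) < L2_norm M F + e / 4"
    using e by (intro order_tendstoD) auto
  moreover have "\<forall>\<^sub>F n in sequentially. 2 * real k * norm f / real n < e / 4"
    using e by (intro order_tendstoD[OF lim_const_over_n]) auto
  moreover have "\<forall>\<^sub>F n in sequentially. (n::nat) > 0" by (rule eventually_gt_at_top)
  ultimately show ?thesis
  proof eventually_elim
    fix n :: nat
    assume 1: "sqrt ((\<Sum>j<n. (cmod (F ((T ^^ j) x)))\<^sup>2) / of_nat n) < L2_norm M F + e / 4"
      and 2: "2 * real k * norm f / real n < e / 4" and n: "n > 0"
    have "cmod (twisted_avg T \<xi> n F x) \<le> (\<Sum>j<n. cmod (F ((T ^^ j) x))) / of_nat n"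
      by (rule cmod_twisted_avg_le[OF \<xi>])
    also have "\<dots> \<le> sqrt ((\<Sum>j<n. (cmod (F ((T ^^ j) x)))\<^sup>2) / of_nat n)"
      by (rule real_le_rsqrt[OF square_of_average_le])
    finally have "cmod (twisted_avg T \<xi> n F x) < L2_norm M F + e / 4" using 1 by simp
    moreover have "cmod (twisted_avg T \<xi> n F x - twisted_avg T \<xi> n f x) \<le> 2 * real k * norm f / real n"
      unfolding F_def by (rule twisted_avg_twisted_avg_close[OF \<xi> cmod_bcontfun_le k(1) n])
    moreover have "cmod (twisted_avg T \<xi> n f x)
        \<le> cmod (twisted_avg T \<xi> n F x) + cmod (twisted_avg T \<xi> n F x - twisted_avg T \<xi> n f x)"
      using norm_triangle_ineq4[of "twisted_avg T \<xi> n F x"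
          "twisted_avg T \<xi> n F x - twisted_avg T \<xi> n f x"] by simp
    ultimately show "cmod (fb_avg T f \<xi> n x) \<le> L2_norm M (eigen_proj T M \<xi> f) + e"
      using k(2) 2 unfolding fb_avg_eq_twisted_avg[OF \<xi>] F_def by linarith
  qed
qed

lemma generic_fb_limit_le:
  fixes f :: "'a \<Rightarrow>\<^sub>C complex"
  assumes x: "generic_point T M x" and \<xi>: "cmod \<xi> = 1" and l: "(\<lambda>n. fb_avg T f \<xi> n x) \<longlonglongrightarrow> l"
  shows "cmod l \<le> L2_norm M (eigen_proj T M \<xi> f)"
proof (rule field_le_epsilon)
  fix e :: real assume "e > 0"
  from generic_fb_avg_eventually_le[OF x \<xi> this]
  show "cmod l \<le> L2_norm M (eigen_proj T M \<xi> f) + e"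
    by (intro tendsto_upperbound[OF tendsto_norm[OF l]]) auto
qed

lemma generic_fb_avg_tendsto_0:
  fixes f :: "'a \<Rightarrow>\<^sub>C complex"
  assumes x: "generic_point T M x" and \<xi>: "cmod \<xi> = 1" and 0: "L2_norm M (eigen_proj T M \<xi> f) = 0"
  shows "(\<lambda>n. fb_avg T f \<xi> n x) \<longlonglongrightarrow> 0"
proof (rule tendstoI)
  fix e :: real assume "e > 0"
  then have "e / 2 > 0" by simp
  from generic_fb_avg_eventually_le[OF x \<xi> this, of f] 0
  have "\<forall>\<^sub>F n in sequentially. cmod (fb_avg T f \<xi> n x) \<le> e / 2" by simp
  then show "\<forall>\<^sub>F n in sequentially. dist (fb_avg T f \<xi> n x) 0 < e"
    using \<open>e > 0\<close> by (auto elim!: eventually_mono)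
qed

lemma cmod_fb_avg_diff_le:
  assumes \<xi>: "cmod \<xi> = 1"
  shows "cmod (fb_avg T f \<xi> n x - fb_avg T g \<xi> n x) \<le> dist f g"
  unfolding fb_avg_eq_twisted_avg[OF \<xi>] twisted_avg_diff[symmetric]
  by (rule cmod_twisted_avg_bounded[OF \<xi>]) (simp add: dist_norm[symmetric] dist_bounded)

text \<open>The averages are equicontinuous in \<open>f\<close>.\<close>

lemma fb_avg_convergent_dense:
  assumes D: "closure D = UNIV" and \<xi>: "cmod \<xi> = 1"
    and conv: "\<And>g. g \<in> D \<Longrightarrow> convergent (\<lambda>n. fb_avg T g \<xi> n x)"
  shows "convergent (\<lambda>n. fb_avg T f \<xi> n x)"
proof -
  have "Cauchy (\<lambda>n. fb_avg T f \<xi> n x)"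
  proof (rule metric_CauchyI)
    fix e :: real assume e: "e > 0"
    then obtain g where g: "g \<in> D" "dist g f < e / 3"
      using D closure_approachable[of f D] by (metis UNIV_I divide_pos_pos zero_less_numeral)
    have "Cauchy (\<lambda>n. fb_avg T g \<xi> n x)" using conv[OF g(1)] by (rule convergent_Cauchy)
    then obtain N where N: "\<And>m n. m \<ge> N \<Longrightarrow> n \<ge> N \<Longrightarrow> dist (fb_avg T g \<xi> m x) (fb_avg T g \<xi> n x) < e / 3"
      using e unfolding Cauchy_def by (metis divide_pos_pos zero_less_numeral)
    have "dist (fb_avg T f \<xi> m x) (fb_avg T f \<xi> n x) < e" if "m \<ge> N" "n \<ge> N" for m n
    proof -
      have "dist (fb_avg T f \<xi> m x) (fb_avg T f \<xi> n x)
          \<le> dist (fb_avg T f \<xi> m x) (fb_avg T g \<xi> m x)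
            + (dist (fb_avg T g \<xi> m x) (fb_avg T g \<xi> n x) + dist (fb_avg T g \<xi> n x) (fb_avg T f \<xi> n x))"
        using dist_triangle[of "fb_avg T f \<xi> m x" "fb_avg T f \<xi> n x" "fb_avg T g \<xi> m x"]
          dist_triangle[of "fb_avg T g \<xi> m x" "fb_avg T f \<xi> n x" "fb_avg T g \<xi> n x"]
        by linarith
      then show ?thesis
        using N[OF that] cmod_fb_avg_diff_le[OF \<xi>, of f m x g] cmod_fb_avg_diff_le[OF \<xi>, of g n x f] g(2)
        by (simp add: dist_norm[of "fb_avg _ _ _ _ _"] dist_commute[of f g])
    qed
    then show "\<exists>N. \<forall>m\<ge>N. \<forall>n\<ge>N. dist (fb_avg T f \<xi> m x) (fb_avg T f \<xi> n x) < e" by blast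
  qed
  then show ?thesis by (rule Cauchy_convergent)
qed

text \<open>The indicator of a closed set is a bounded pointwise limit of continuous functions, and the
  closed sets are an intersection-stable generator of the Borel sets.\<close>

lemma bcontfun_separate_L2:
  assumes h: "h \<in> L2_space M" and orth: "\<And>f :: 'a \<Rightarrow>\<^sub>C complex. L2_inner M f h = 0"
  shows "AE x in M. h x = 0"
proof -
  let ?h = "\<lambda>x. cnj (h x)"
  have h_int: "integrable M ?h" using L2_space_integrable[OF h] by simp
  have [measurable]: "h \<in> borel_measurable M" using L2_spaceD(1)[OF h] .
  have ortho: "(\<integral>x. f x * ?h x \<partial>M) = 0" if "continuous_on UNIV f" for f
    using orth[of "Bcontfun f"] Bcontfun_inverse[OF continuous_bcontfun[OF that]]
    by (simp add: L2_inner_def)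
  have closed: "set_lebesgue_integral M C ?h = 0" if C: "closed C" for C
  proof (cases "C = {}")
    case True
    then show ?thesis by (simp add: set_lebesgue_integral_def)
  next
    case False
    define u where "u n x = max 0 (1 - real n * infdist x C)" for n x
    have u_cont: "continuous_on UNIV (u n)" for n
      unfolding u_def by (intro continuous_intros)
    have [measurable]: "u n \<in> borel_measurable M" for n by (rule continuous_measurable[OF u_cont])
    have [measurable]: "C \<in> sets M" using C by (simp add: sets_M)
    have u_lim: "(\<lambda>n. u n x) \<longlonglongrightarrow> indicator C x" for x
    proof (cases "x \<in> C")
      case True
      then show ?thesis by (simp add: u_def)
    next
      case out: False
      then have pos: "infdist x C > 0"
        using in_closed_iff_infdist_zero[OF C False] infdist_nonneg[of x C] by fastforce
      have "\<forall>\<^sub>F n in sequentially. u n x = 0"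
      proof -
        obtain N where N: "1 / infdist x C < real N" using reals_Archimedean2 by blast
        have "u n x = 0" if "n \<ge> N" for n
        proof -
          have "1 / infdist x C < real n" using N that by linarith
          then have "1 < real n * infdist x C" using pos by (simp add: pos_divide_less_eq)
          then show ?thesis by (simp add: u_def)
        qed
        then show ?thesis by (auto simp: eventually_sequentially)
      qed
      then show ?thesis using out by (simp add: tendsto_eventually)
    qed
    have "(\<lambda>n. \<integral>x. complex_of_real (u n x) * ?h x \<partial>M) \<longlonglongrightarrow> (\<integral>x. complex_of_real (indicator C x) * ?h x \<partial>M)"
    proof (rule integral_dominated_convergence[where w="\<lambda>x. cmod (?h x)"])
      show "integrable M (\<lambda>x. cmod (?h x))" using h_int by (rule integrable_norm)
      show "AE x in M. (\<lambda>n. complex_of_real (u n x) * ?h x) \<longlonglongrightarrow> complex_of_real (indicator C x) * ?h x"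
        by (intro AE_I2 tendsto_intros u_lim)
      have "u n x \<le> 1" "0 \<le> u n x" for n x by (auto simp: u_def infdist_nonneg)
      then show "AE x in M. cmod (complex_of_real (u n x) * ?h x) \<le> cmod (?h x)" for n
        by (intro AE_I2) (simp add: norm_mult mult_left_le_one_le)
    qed measurable
    moreover have "(\<integral>x. complex_of_real (u n x) * ?h x \<partial>M) = 0" for n
      by (rule ortho) (intro continuous_intros u_cont)
    ultimately have "(\<integral>x. complex_of_real (indicator C x) * ?h x \<partial>M) = 0"
      by (simp add: LIMSEQ_const_iff)
    then show ?thesis by (simp add: set_lebesgue_integral_def scaleR_conv_of_real)
  qed
  have total: "set_lebesgue_integral M UNIV ?h = 0" by (rule closed) simp
  have all: "set_lebesgue_integral M A ?h = 0" if "A \<in> sets M" for A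
  proof -
    have "Int_stable (Collect closed :: 'a set set)" by (auto simp: Int_stable_def)
    moreover have "Collect closed \<subseteq> Pow (UNIV :: 'a set)" by simp
    moreover have "A \<in> sigma_sets UNIV (Collect closed)"
      using that unfolding sets_M borel_eq_closed by simp
    ultimately show ?thesis
    proof (induction rule: sigma_sets_induct_disjoint)
      case (compl A)
      have A: "A \<in> sets M" using compl(1) unfolding sets_M borel_eq_closed by simp
      have si: "set_integrable M B ?h" if "B \<in> sets M" for B
        using integrable_mult_indicator[OF that h_int] by (simp add: set_integrable_def)
      have "set_lebesgue_integral M (A \<union> (UNIV - A)) ?h
          = set_lebesgue_integral M A ?h + set_lebesgue_integral M (UNIV - A) ?h"
        using A sets.compl_sets[OF A] by (intro set_integral_Un si) (auto simp: space_M)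
      then show ?case using total compl(2) by simp
    next
      case (union A)
      have A: "A i \<in> sets M" for i using union(2) unfolding sets_M borel_eq_closed by auto
      have "set_integrable M (\<Union>i. A i) ?h"
        using integrable_mult_indicator[OF sets.countable_UN[of A UNIV] h_int] A
        by (auto simp: set_integrable_def)
      then have "set_lebesgue_integral M (\<Union>i. A i) ?h = (\<Sum>i. set_lebesgue_integral M (A i) ?h)"
        using A union(1) by (intro lebesgue_integral_countable_add) (auto simp: disjoint_family_on_def)
      then show ?case using union(3) by simp
    qed (simp_all add: closed)
  qed
  have "AE x in M. ?h x = 0" by (rule density_zero[OF h_int all])
  then show ?thesis by simp
qed

lemma dense_bcontfun_separate_L2:
  assumes D: "closure D = UNIV" and h: "h \<in> L2_space M"
    and orth: "\<And>f. f \<in> D \<Longrightarrow> L2_inner M (apply_bcontfun f) h = 0"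
  shows "AE x in M. h x = 0"
proof (rule bcontfun_separate_L2[OF h])
  fix f :: "'a \<Rightarrow>\<^sub>C complex"
  have "cmod (L2_inner M f h) \<le> 0 + e" if "e > 0" for e
  proof -
    define d where "d = e / (L2_norm M h + 1)"
    have pos: "0 < L2_norm M h + 1" by (simp add: add_nonneg_pos)
    then have "d > 0" using that by (simp add: d_def)
    then obtain g where g: "g \<in> D" "dist g f < d"
      using D closure_approachable[of f D] by (metis UNIV_I)
    have "L2_inner M f h = L2_inner M (\<lambda>x. f x - g x) h"
      using L2_inner_diff_left[OF bcontfun_L2 bcontfun_L2 h] orth[OF g(1)] by simp
    then have "cmod (L2_inner M f h) \<le> L2_norm M (\<lambda>x. f x - g x) * L2_norm M h"
      using L2_Cauchy_Schwarz[OF L2_space_diff[OF bcontfun_L2 bcontfun_L2] h] by simp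
    also have "\<dots> \<le> d * (L2_norm M h + 1)"
      using L2_norm_bcontfun_diff_le[of f g] g(2) \<open>d > 0\<close>
      by (intro mult_mono) (auto simp: dist_commute)
    also have "\<dots> = e" using pos by (simp add: d_def)
    finally show ?thesis by simp
  qed
  then have "cmod (L2_inner M f h) \<le> 0" by (rule field_le_epsilon)
  then show "L2_inner M f h = 0" by simp
qed

end

section \<open>Fourier-Bohr coefficients and the spectrum\<close>

lemma tendsto_fb_lim:
  assumes "convergent (\<lambda>n. fb_avg T f \<xi> n x)"
  shows "(\<lambda>n. fb_avg T f \<xi> n x) \<longlonglongrightarrow> fb_lim T f \<xi> x"
  using assms by (simp add: fb_lim_def convergent_LIMSEQ_iff)

lemma Freq_iff:
  assumes conv: "\<And>f. convergent (\<lambda>n. fb_avg T f \<xi> n x)" and \<xi>: "\<xi> \<in> sphere 0 1"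
  shows "\<xi> \<in> Freq T x \<longleftrightarrow> (\<exists>f. fb_lim T f \<xi> x \<noteq> 0)"
proof -
  have "limsup (\<lambda>n. ereal (cmod (fb_avg T f \<xi> n x))) = ereal (cmod (fb_lim T f \<xi> x))" for f
    by (intro lim_imp_Limsup tendsto_intros tendsto_fb_lim conv) simp
  then show ?thesis using \<xi> by (simp add: Freq_def)
qed

context topological_system
begin

lemma eigen_proj_eq_0_if_not_Spec:
  assumes "cmod \<xi> = 1" "\<xi> \<notin> Spec T M" "f \<in> L2_space M"
  shows "L2_norm M (eigen_proj T M \<xi> f) = 0"
proof -
  note P = eigen_proj_properties(1)[OF assms(3,1)]
  have "AE x in M. eigen_proj T M \<xi> f x = 0"
    using assms(2) P by (auto simp: Spec_def eigenfunction_iff)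
  then show ?thesis using L2_norm_eq_0_iff[OF eigenspaceD(1)[OF P]] by simp
qed

text \<open>Since the squared coefficients are dominated by the terms of Parseval's identity, the equality
  of the sums forces the equality of all terms.\<close>

lemma spectral_identity_imp_coefficients:
  assumes \<Xi>: "\<Xi> \<subseteq> sphere 0 1" and x: "generic_point T M x"
    and conv: "\<And>\<xi>. \<xi> \<in> \<Xi> \<Longrightarrow> convergent (\<lambda>n. fb_avg T f \<xi> n x)"
    and id: "spectral_identity T M \<Xi> x f" and \<xi>: "\<xi> \<in> sphere 0 1"
  shows "\<xi> \<in> \<Xi> \<Longrightarrow> cmod (fb_lim T f \<xi> x) = L2_norm M (eigen_proj T M \<xi> f)"
    and "\<xi> \<notin> \<Xi> \<Longrightarrow> L2_norm M (eigen_proj T M \<xi> f) = 0"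
proof -
  let ?b = "\<lambda>\<xi>. (L2_norm M (eigen_proj T M \<xi> f))\<^sup>2"
  define a where "a \<xi> = (if \<xi> \<in> \<Xi> then (cmod (fb_lim T f \<xi> x))\<^sup>2 else 0)" for \<xi>
  note parseval = Kron_Parseval[OF bcontfun_L2, of f]
  have "nonneg_sum a (sphere 0 1) = nonneg_sum a \<Xi>"
    using \<Xi> by (intro nonneg_sum_support[symmetric]) (auto simp: a_def)
  also have "\<dots> = nonneg_sum (\<lambda>\<xi>. (cmod (fb_lim T f \<xi> x))\<^sup>2) \<Xi>"
    by (rule nonneg_sum_cong) (simp add: a_def)
  also have "\<dots> = nonneg_sum ?b (sphere 0 1)"
    using id parseval by (simp add: spectral_identity_def)
  finally have eq: "nonneg_sum a (sphere 0 1) = nonneg_sum ?b (sphere 0 1)" .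
  have le: "a \<eta> \<le> ?b \<eta>" if \<eta>: "\<eta> \<in> sphere 0 1" for \<eta>
  proof (cases "\<eta> \<in> \<Xi>")
    case True
    have "cmod (fb_lim T f \<eta> x) \<le> L2_norm M (eigen_proj T M \<eta> f)"
      using \<eta> by (intro generic_fb_limit_le[OF x] tendsto_fb_lim conv True) simp
    then show ?thesis using True by (simp add: a_def power_mono)
  qed (simp add: a_def)
  have "a \<xi> = ?b \<xi>"
    by (rule nonneg_sum_eq_imp_eq[OF le _ eq _ \<xi>]) (auto simp: a_def parseval[symmetric])
  then show "\<xi> \<in> \<Xi> \<Longrightarrow> cmod (fb_lim T f \<xi> x) = L2_norm M (eigen_proj T M \<xi> f)"
    and "\<xi> \<notin> \<Xi> \<Longrightarrow> L2_norm M (eigen_proj T M \<xi> f) = 0"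
    by (auto simp: a_def)
qed

lemma const_eigenspace: "(\<lambda>x. c) \<in> eigenspace T M 1"
  by (simp add: eigenspace_def L2_space_const)

lemma one_in_Spec: "1 \<in> Spec T M"
  using const_eigenspace[of 1] by (auto simp: Spec_def eigenfunction_iff AE_False)

text \<open>By Pythagoras, \<open>\<bar>\<integral>f\<bar> = \<parallel>P\<^sub>1 f\<parallel>\<close> says that \<open>P\<^sub>1 f\<close> is the constant \<open>\<integral>f\<close>. Hence an invariant function with mean
  zero, such as the centred indicator of an invariant set, is orthogonal to \<open>D\<close> and vanishes.\<close>

lemma ergodic_if_norm_eigen_proj_eq_mean:
  assumes D: "closure D = (UNIV :: ('a \<Rightarrow>\<^sub>C complex) set)"
    and mean: "\<And>f. f \<in> D \<Longrightarrow> cmod (\<integral>y. f y \<partial>M) = L2_norm M (eigen_proj T M 1 f)"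
  shows "ergodic T M"
  unfolding ergodic_def
proof (intro ballI impI)
  fix A assume A [measurable]: "A \<in> sets M" and inv: "T -` A \<inter> space M = A"
  \<comment> \<open>Once \<open>h\<close> vanishes almost everywhere, \<open>measure M A\<close> is a value of the indicator.\<close>
  define h where "h x = complex_of_real (indicator A x - measure M A)" for x
  have ind_inv: "indicator A (T x) = (indicator A x :: real)" for x
    using inv by (auto simp: space_M indicator_def)
  have h_meas [measurable]: "h \<in> borel_measurable M" unfolding h_def[abs_def] by measurable
  have "cmod (h x) \<le> 1" for x
    unfolding h_def norm_of_real using measure_nonneg[of M A] prob_le_1[of A]
    by (cases "x \<in> A") auto
  then have h2: "h \<in> L2_space M" by (intro L2_norm_bounded[of _ 1]) auto
  then have h: "h \<in> eigenspace T M 1" by (simp add: eigenspace_def h_def ind_inv)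
  have h_mean: "(\<integral>x. cnj (h x) \<partial>M) = 0"
    unfolding h_def by (simp add: prob_space emeasure_eq_measure)
  have "AE x in M. h x = 0"
  proof (rule dense_bcontfun_separate_L2[OF D h2])
    fix f assume f: "f \<in> D"
    let ?P = "eigen_proj T M 1 f" and ?c = "\<integral>y. f y \<partial>M"
    have f2: "apply_bcontfun f \<in> L2_space M" by (rule bcontfun_L2)
    have P2: "?P \<in> L2_space M" by (rule eigen_proj_L2[OF f2]) simp
    have c2: "(\<lambda>x. ?c) \<in> L2_space M" by (rule L2_space_const)
    have "L2_inner M ?P (\<lambda>x. ?c) = L2_inner M f (\<lambda>x. ?c)"
      by (rule L2_inner_eigen_proj[OF f2 _ const_eigenspace]) simp
    also have "\<dots> = ?c * cnj ?c" by (simp add: L2_inner_def)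
    also have "\<dots> = complex_of_real ((cmod ?c)\<^sup>2)" by (rule complex_norm_square[symmetric])
    finally have "Re (L2_inner M ?P (\<lambda>x. ?c)) = (cmod ?c)\<^sup>2" by (simp only: Re_complex_of_real)
    moreover have "L2_norm M (\<lambda>x. ?c) = cmod ?c" by (simp add: L2_norm_def prob_space)
    ultimately have "(L2_norm M (\<lambda>x. ?P x - ?c))\<^sup>2 = 0"
      using L2_norm_square_diff[OF P2 c2] mean[OF f] by simp
    then have "AE x in M. ?P x - ?c = 0"
      using L2_norm_eq_0_iff[OF L2_space_diff[OF P2 c2]] by simp
    then have P_const: "AE x in M. ?P x = ?c" by eventually_elim simp
    have "L2_inner M f h = L2_inner M ?P h"
      by (rule L2_inner_eigen_proj[OF f2 _ h, symmetric]) simp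
    also have "\<dots> = L2_inner M (\<lambda>x. ?c) h"
      using L2_spaceD(1)[OF P2] P_const by (intro L2_inner_cong_AE) auto
    also have "\<dots> = 0" using h_mean by (simp add: L2_inner_def)
    finally show "L2_inner M f h = 0" .
  qed
  then have ae: "AE x in M. indicator A x = measure M A"
    by eventually_elim (simp add: h_def)
  have "measure M A = 0 \<or> measure M A = 1"
  proof (rule ccontr)
    assume "\<not> ?thesis"
    then have ne: "indicator A x \<noteq> measure M A" for x by (auto simp: indicator_def)
    from ae have "AE x in M. False" by eventually_elim (simp add: ne)
    then show False by (simp add: AE_False)
  qed
  then show "emeasure M A = 0 \<or> emeasure M A = 1" by (auto simp: emeasure_eq_measure)
qed

text \<open>An eigenfunction for an eigenvalue outside \<open>\<Xi>\<close> would be orthogonal to \<open>D\<close>. In particular the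
  eigenvalue 1 lies in \<open>\<Xi>\<close>, and its coefficient at a generic point is the mean.\<close>

lemma spectral_identity_imp_ergodic:
  assumes \<Xi>: "\<Xi> \<subseteq> sphere 0 1" and x: "generic_point T M x"
    and D: "closure D = (UNIV :: ('a \<Rightarrow>\<^sub>C complex) set)"
    and conv: "\<And>f \<xi>. f \<in> D \<Longrightarrow> \<xi> \<in> \<Xi> \<Longrightarrow> convergent (\<lambda>n. fb_avg T f \<xi> n x)"
    and id: "\<And>f. f \<in> D \<Longrightarrow> spectral_identity T M \<Xi> x f"
  shows "ergodic T M \<and> Spec T M \<subseteq> \<Xi>"
proof
  show Spec: "Spec T M \<subseteq> \<Xi>"
  proof
    fix \<xi> assume "\<xi> \<in> Spec T M"
    then obtain g where g: "g \<in> eigenspace T M \<xi>" "\<not> (AE x in M. g x = 0)"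
      by (auto simp: Spec_def eigenfunction_iff)
    have \<xi>: "cmod \<xi> = 1" using eigenvalue_unimodular[OF g] .
    show "\<xi> \<in> \<Xi>"
    proof (rule ccontr)
      assume out: "\<xi> \<notin> \<Xi>"
      have "AE x in M. g x = 0"
      proof (rule dense_bcontfun_separate_L2[OF D eigenspaceD(1)[OF g(1)]])
        fix f assume f: "f \<in> D"
        have "L2_norm M (eigen_proj T M \<xi> f) = 0"
          using \<xi> out by (intro spectral_identity_imp_coefficients(2)[OF \<Xi> x conv[OF f] id[OF f]]) auto
        then have "cmod (L2_inner M (eigen_proj T M \<xi> f) g) \<le> 0"
          using L2_Cauchy_Schwarz[OF eigen_proj_L2[OF bcontfun_L2 \<xi>] eigenspaceD(1)[OF g(1)], of f]
          by simp
        then show "L2_inner M f g = 0" using L2_inner_eigen_proj[OF bcontfun_L2 \<xi> g(1), of f] by simp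
      qed
      with g(2) show False by simp
    qed
  qed
  show "ergodic T M"
  proof (rule ergodic_if_norm_eigen_proj_eq_mean[OF D])
    fix f assume f: "f \<in> D"
    have "(\<lambda>n. fb_avg T f 1 n x) \<longlonglongrightarrow> (\<integral>y. f y \<partial>M)"
      using x by (simp add: generic_point_def fb_avg_def)
    then have "fb_lim T f 1 x = (\<integral>y. f y \<partial>M)" unfolding fb_lim_def by (rule limI)
    then show "cmod (\<integral>y. f y \<partial>M) = L2_norm M (eigen_proj T M 1 f)"
      using spectral_identity_imp_coefficients(1)[OF \<Xi> x conv[OF f] id[OF f], of 1]
        Spec one_in_Spec by auto
  qed
qed

text \<open>The points at which the bound for generic points is attained by all coefficients.\<close>

definition sharp_limits :: "'a \<Rightarrow> bool" where
  "sharp_limits x \<longleftrightarrow> (\<forall>f. \<forall>\<xi>\<in>sphere 0 1. convergent (\<lambda>n. fb_avg T f \<xi> n x) \<and>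
     cmod (fb_lim T f \<xi> x) = L2_norm M (eigen_proj T M \<xi> (apply_bcontfun f)))"

lemma spectral_identity_if_sharp:
  assumes sharp: "sharp_limits x" and I: "I \<subseteq> sphere 0 1"
    and out: "\<And>\<xi>. \<xi> \<in> sphere 0 1 - I \<Longrightarrow> fb_lim T f \<xi> x = 0"
  shows "spectral_identity T M I x f"
proof -
  have "nonneg_sum (\<lambda>\<xi>. (cmod (fb_lim T f \<xi> x))\<^sup>2) I
      = nonneg_sum (\<lambda>\<xi>. (cmod (fb_lim T f \<xi> x))\<^sup>2) (sphere 0 1)"
    by (rule nonneg_sum_support[OF I]) (simp add: out)
  also have "\<dots> = nonneg_sum (\<lambda>\<xi>. (L2_norm M (eigen_proj T M \<xi> f))\<^sup>2) (sphere 0 1)"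
    by (rule nonneg_sum_cong) (use sharp in \<open>simp add: sharp_limits_def\<close>)
  finally show ?thesis by (simp add: spectral_identity_def Kron_Parseval[OF bcontfun_L2])
qed

lemma sharp_limits_properties:
  assumes gen: "generic_point T M x" and sharp: "sharp_limits x"
    and \<Xi>: "\<Xi> \<subseteq> sphere 0 1" "Spec T M \<subseteq> \<Xi>"
  shows "ww_generic T M x" "spectral_identity T M \<Xi> x f" "Freq T x \<subseteq> \<Xi>"
proof -
  have conv: "convergent (\<lambda>n. fb_avg T f \<xi> n x)" if "\<xi> \<in> sphere 0 1" for f \<xi>
    using sharp that by (simp add: sharp_limits_def)
  have zero: "fb_lim T f \<xi> x = 0" if "\<xi> \<in> sphere 0 1 - \<Xi>" for f \<xi>
  proof -
    have "L2_norm M (eigen_proj T M \<xi> f) = 0"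
      using that \<Xi>(2) by (intro eigen_proj_eq_0_if_not_Spec bcontfun_L2) auto
    moreover have "cmod (fb_lim T f \<xi> x) = L2_norm M (eigen_proj T M \<xi> f)"
      using sharp that unfolding sharp_limits_def by blast
    ultimately show ?thesis by simp
  qed
  have Freq_sphere: "Freq T x \<subseteq> sphere 0 1" by (auto simp: Freq_def)
  show "spectral_identity T M \<Xi> x f" by (intro spectral_identity_if_sharp sharp \<Xi>(1) zero)
  show "Freq T x \<subseteq> \<Xi>"
    using Freq_iff[OF conv] zero Freq_sphere by blast
  have "spectral_identity T M (Freq T x) x f" for f
    using Freq_iff[OF conv] by (intro spectral_identity_if_sharp sharp Freq_sphere) auto
  then show "ww_generic T M x"
    using gen conv by (simp add: ww_generic_def fb_generic_def)
qed

end

locale ergodic_topological_system = topological_system M T + ergodic_system M T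
  for M :: "'a::metric_space measure" and T :: "'a \<Rightarrow> 'a"
begin

text \<open>The pointwise theorem is applied to countably many pairs \<open>(f, \<xi>)\<close> only: \<open>f\<close> ranges over a countable dense
  set \<open>D\<close> and \<open>\<xi>\<close> over the set \<open>Z f\<close> of those values with \<open>P\<^sub>\<xi> f \<noteq> 0\<close>, together with 1 for the sake of
  genericity. At a generic point the coefficients of \<open>f\<close> outside \<open>Z f\<close> vanish, and uniform approximation
  passes from \<open>D\<close> to all continuous functions.\<close>

lemma AE_sharp_limits: "AE x in M. generic_point T M x \<and> sharp_limits x"
proof -
  obtain D :: "('a \<Rightarrow>\<^sub>C complex) set" where D: "countable D" "closure D = UNIV"
    using separable_bcontfun[OF compact_UNIV] .
  define Z where "Z f = insert 1 {\<xi>\<in>sphere 0 1. (L2_norm M (eigen_proj T M \<xi> (apply_bcontfun f)))\<^sup>2 \<noteq> 0}"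
    for f :: "'a \<Rightarrow>\<^sub>C complex"
  have Z: "countable (Z f)" for f
    unfolding Z_def
    by (intro countable_insert countable_support_nonneg_sum)
      (auto simp: Kron_Parseval[OF bcontfun_L2, symmetric])
  have "AE x in M. (\<lambda>n. fb_avg T f \<xi> n x) \<longlonglongrightarrow> eigen_proj T M \<xi> f x
      \<and> cmod (eigen_proj T M \<xi> f x) = L2_norm M (eigen_proj T M \<xi> f)"
    if \<xi>: "\<xi> \<in> Z f" for f :: "'a \<Rightarrow>\<^sub>C complex" and \<xi>
  proof -
    have u: "cmod \<xi> = 1" using \<xi> by (auto simp: Z_def)
    show ?thesis
      unfolding fb_avg_eq_twisted_avg[OF u]
      by (intro AE_conjI twisted_avg_tendsto_eigen_proj ergodic_cmod_eigen_proj bcontfun_L2 u)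
  qed
  then have "AE x in M. \<forall>f\<in>D. \<forall>\<xi>\<in>Z f. (\<lambda>n. fb_avg T f \<xi> n x) \<longlonglongrightarrow> eigen_proj T M \<xi> f x
      \<and> cmod (eigen_proj T M \<xi> f x) = L2_norm M (eigen_proj T M \<xi> f)"
    by (simp add: AE_ball_countable D Z)
  moreover have "AE x in M. \<forall>f\<in>D. eigen_proj T M 1 f x = (\<integral>y. f y \<partial>M)"
    unfolding AE_ball_countable[OF D(1)] using ergodic_eigen_proj_1[OF bcontfun_L2] by blast
  ultimately show ?thesis
  proof eventually_elim
    fix x
    assume lim: "\<forall>f\<in>D. \<forall>\<xi>\<in>Z f. (\<lambda>n. fb_avg T f \<xi> n x) \<longlonglongrightarrow> eigen_proj T M \<xi> f x
        \<and> cmod (eigen_proj T M \<xi> f x) = L2_norm M (eigen_proj T M \<xi> f)"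
      and mean: "\<forall>f\<in>D. eigen_proj T M 1 f x = (\<integral>y. f y \<partial>M)"
    have approx: "\<exists>g\<in>D. dist f g < e" if "e > 0" for f e
      using D(2) closure_approachable[of f D] that by (metis UNIV_I dist_commute)
    have lim_diff: "cmod (fb_lim T f \<xi> x - fb_lim T g \<xi> x) \<le> dist f g"
      if "cmod \<xi> = 1" "convergent (\<lambda>n. fb_avg T f \<xi> n x)" "convergent (\<lambda>n. fb_avg T g \<xi> n x)" for f g \<xi>
    proof (rule tendsto_upperbound)
      show "(\<lambda>n. cmod (fb_avg T f \<xi> n x - fb_avg T g \<xi> n x)) \<longlonglongrightarrow> cmod (fb_lim T f \<xi> x - fb_lim T g \<xi> x)"
        by (intro tendsto_norm tendsto_diff tendsto_fb_lim that)
      show "\<forall>\<^sub>F n in sequentially. cmod (fb_avg T f \<xi> n x - fb_avg T g \<xi> n x) \<le> dist f g"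
        by (intro always_eventually allI cmod_fb_avg_diff_le that)
    qed simp
    have gen: "generic_point T M x"
      unfolding generic_point_def
    proof
      fix f :: "'a \<Rightarrow>\<^sub>C complex"
      have D_lim: "(\<lambda>n. fb_avg T g 1 n x) \<longlonglongrightarrow> (\<integral>y. g y \<partial>M)" if "g \<in> D" for g
        using lim mean that by (auto simp: Z_def)
      have conv: "convergent (\<lambda>n. fb_avg T g 1 n x)" for g
        by (rule fb_avg_convergent_dense[OF D(2) _ convergentI[OF D_lim]]) simp_all
      have "cmod (fb_lim T f 1 x - (\<integral>y. f y \<partial>M)) \<le> 0 + e" if "e > 0" for e
      proof -
        obtain g where g: "g \<in> D" "dist f g < e / 2" using approx[of "e / 2"] \<open>e > 0\<close> by auto
        have "fb_lim T g 1 x = (\<integral>y. g y \<partial>M)" unfolding fb_lim_def by (rule limI[OF D_lim[OF g(1)]])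
        moreover have "cmod ((\<integral>y. g y \<partial>M) - (\<integral>y. f y \<partial>M)) \<le> dist f g"
        proof -
          have int: "integrable M (apply_bcontfun h)" for h :: "'a \<Rightarrow>\<^sub>C complex"
            by (rule L2_space_integrable[OF bcontfun_L2])
          have "cmod ((\<integral>y. g y \<partial>M) - (\<integral>y. f y \<partial>M)) = cmod (\<integral>y. g y - f y \<partial>M)"
            by (simp add: int)
          also have "\<dots> \<le> (\<integral>y. cmod (g y - f y) \<partial>M)" by (rule integral_norm_bound)
          also have "\<dots> \<le> L2_norm M (\<lambda>y. g y - f y)"
            by (intro L1_norm_le_L2_norm L2_space_diff bcontfun_L2)
          also have "\<dots> \<le> dist f g" using L2_norm_bcontfun_diff_le[of g f] by (simp add: dist_commute)
          finally show ?thesis .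
        qed
        moreover have "cmod (fb_lim T f 1 x - (\<integral>y. f y \<partial>M))
            \<le> cmod (fb_lim T f 1 x - fb_lim T g 1 x) + cmod (fb_lim T g 1 x - (\<integral>y. f y \<partial>M))"
          using norm_triangle_ineq[of "fb_lim T f 1 x - fb_lim T g 1 x" "fb_lim T g 1 x - (\<integral>y. f y \<partial>M)"]
          by simp
        ultimately show ?thesis using lim_diff[of 1 f g] conv g(2) by simp
      qed
      then have "cmod (fb_lim T f 1 x - (\<integral>y. f y \<partial>M)) \<le> 0" by (rule field_le_epsilon)
      then have "fb_lim T f 1 x = (\<integral>y. f y \<partial>M)" by simp
      with tendsto_fb_lim[OF conv, of f]
      show "(\<lambda>n. (\<Sum>j<n. f ((T ^^ j) x)) / of_nat n) \<longlonglongrightarrow> (\<integral>y. f y \<partial>M)"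
        by (simp add: fb_avg_def)
    qed
    moreover have "sharp_limits x"
      unfolding sharp_limits_def
    proof (intro allI ballI)
      fix f :: "'a \<Rightarrow>\<^sub>C complex" and \<xi> :: complex assume "\<xi> \<in> sphere 0 1"
      then have \<xi>: "cmod \<xi> = 1" by simp
      have sharp: "convergent (\<lambda>n. fb_avg T g \<xi> n x) \<and> cmod (fb_lim T g \<xi> x) = L2_norm M (eigen_proj T M \<xi> g)"
        if g: "g \<in> D" for g
      proof (cases "\<xi> \<in> Z g")
        case True
        then have "(\<lambda>n. fb_avg T g \<xi> n x) \<longlonglongrightarrow> eigen_proj T M \<xi> g x"
          "cmod (eigen_proj T M \<xi> g x) = L2_norm M (eigen_proj T M \<xi> g)"
          using lim g by auto
        then show ?thesis by (auto simp: fb_lim_def convergent_def dest: limI)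
      next
        case False
        then have 0: "L2_norm M (eigen_proj T M \<xi> g) = 0" using \<xi> by (simp add: Z_def)
        then have "(\<lambda>n. fb_avg T g \<xi> n x) \<longlonglongrightarrow> 0" by (rule generic_fb_avg_tendsto_0[OF gen \<xi>])
        then show ?thesis using 0 by (auto simp: fb_lim_def convergent_def dest: limI)
      qed
      have conv: "convergent (\<lambda>n. fb_avg T g \<xi> n x)" for g
        by (rule fb_avg_convergent_dense[OF D(2) \<xi> sharp[THEN conjunct1]])
      have "\<bar>cmod (fb_lim T f \<xi> x) - L2_norm M (eigen_proj T M \<xi> f)\<bar> \<le> 0 + e" if "e > 0" for e
      proof -
        obtain g where g: "g \<in> D" "dist f g < e / 2" using approx[of "e / 2"] \<open>e > 0\<close> by auto
        have "\<bar>cmod (fb_lim T f \<xi> x) - cmod (fb_lim T g \<xi> x)\<bar> \<le> dist f g"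
          by (rule order_trans[OF norm_triangle_ineq3 lim_diff[OF \<xi> conv conv]])
        moreover have "\<bar>L2_norm M (eigen_proj T M \<xi> f) - L2_norm M (eigen_proj T M \<xi> g)\<bar> \<le> dist f g"
          by (rule order_trans[OF L2_norm_eigen_proj_diff_le[OF bcontfun_L2 bcontfun_L2 \<xi>]
                L2_norm_bcontfun_diff_le])
        ultimately show ?thesis using sharp[OF g(1)] g(2) by simp
      qed
      then have "\<bar>cmod (fb_lim T f \<xi> x) - L2_norm M (eigen_proj T M \<xi> f)\<bar> \<le> 0"
        by (rule field_le_epsilon)
      then show "convergent (\<lambda>n. fb_avg T f \<xi> n x) \<and>
          cmod (fb_lim T f \<xi> x) = L2_norm M (eigen_proj T M \<xi> f)"
        using conv by simp
    qed
    ultimately show "generic_point T M x \<and> sharp_limits x" ..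
  qed
qed

end

lemma topological_systemI:
  fixes T :: "'a::metric_space \<Rightarrow> 'a"
  assumes "compact (UNIV :: 'a set)" "continuous_on UNIV T" and M: "M \<in> invariant_measures T"
  shows "topological_system M T"
proof -
  have M': "prob_space M" "sets M = sets borel" "distr M borel T = M"
    using M by (auto simp: invariant_measures_def)
  interpret prob_space M by fact
  have "T \<in> measurable M M"
    using borel_measurable_continuous_onI[OF assms(2)] measurable_cong_sets[OF M'(2) M'(2)] by blast
  moreover have "distr M M T = M"
  proof -
    have "distr M M T = distr M borel T" by (rule distr_cong) (simp_all add: M'(2))
    then show ?thesis by (simp only: M'(3))
  qed
  ultimately show ?thesis using assms M'(2) by unfold_locales auto
qed

theorem corollary4p6:
  fixes T :: "'a::metric_space \<Rightarrow> 'a"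
    and M :: "'a measure"
    and \<Xi> :: "complex set"
  assumes "compact (UNIV :: 'a set)"
    and "\<exists>S. homeomorphism UNIV UNIV T S"
    and "M \<in> invariant_measures T"
    and "\<Xi> \<subseteq> sphere 0 1"
  shows
    "let
       c1 = (ergodic T M \<and> Spec T M \<subseteq> \<Xi>);
       c2 = (\<exists>X'\<in>sets borel. emeasure M X' = 1 \<and>
               (\<forall>x\<in>X'. ww_generic T M x \<and> (\<forall>f. spectral_identity T M \<Xi> x f)));
       c3 = (\<exists>x D. generic_point T M x \<and>
               countable D \<and> closure D = (UNIV :: ('a \<Rightarrow>\<^sub>C complex) set) \<and>
               (\<forall>f\<in>D. \<forall>\<xi>\<in>\<Xi>. convergent (\<lambda>n. fb_avg T f \<xi> n x)) \<and>
               (\<forall>f\<in>D. spectral_identity T M \<Xi> x f));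
       c4 = (\<exists>x. ww_generic T M x \<and> Freq T x \<subseteq> \<Xi>)
     in (c1 \<longleftrightarrow> c2) \<and> (c1 \<longleftrightarrow> c3) \<and> (c1 \<longleftrightarrow> c4)"
proof -
  have "continuous_on UNIV T" using assms(2) by (auto simp: homeomorphism_def)
  then interpret topological_system M T using assms(1,3) by (intro topological_systemI)
  define c1 where "c1 \<longleftrightarrow> ergodic T M \<and> Spec T M \<subseteq> \<Xi>"
  define c2 where "c2 \<longleftrightarrow> (\<exists>X'\<in>sets borel. emeasure M X' = 1 \<and>
    (\<forall>x\<in>X'. ww_generic T M x \<and> (\<forall>f. spectral_identity T M \<Xi> x f)))"
  define c3 where "c3 \<longleftrightarrow> (\<exists>x D. generic_point T M x \<and>
    countable D \<and> closure D = (UNIV :: ('a \<Rightarrow>\<^sub>C complex) set) \<and>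
    (\<forall>f\<in>D. \<forall>\<xi>\<in>\<Xi>. convergent (\<lambda>n. fb_avg T f \<xi> n x)) \<and>
    (\<forall>f\<in>D. spectral_identity T M \<Xi> x f))"
  define c4 where "c4 \<longleftrightarrow> (\<exists>x. ww_generic T M x \<and> Freq T x \<subseteq> \<Xi>)"
  have 1: "c2 \<and> c4" if c1
  proof -
    have "ergodic T M" and Spec: "Spec T M \<subseteq> \<Xi>" using that by (auto simp: c1_def)
    then interpret ergodic_topological_system M T
      by unfold_locales (auto simp: ergodic_def)
    from AE_sharp_limits obtain N where N: "N \<in> null_sets M"
      "{x\<in>space M. \<not> (generic_point T M x \<and> sharp_limits x)} \<subseteq> N"
      by (auto simp: eventually_ae_filter)
    have good: "generic_point T M x \<and> sharp_limits x" if "x \<in> UNIV - N" for x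
      using that N(2) by (auto simp: space_M)
    have sets: "UNIV - N \<in> sets M" using N(1) sets.compl_sets[of N M] by (auto simp: space_M)
    have "emeasure M (space M - N) = 1"
      using emeasure_Diff_null_set[OF N(1) sets.top] by (simp add: emeasure_space_1)
    then have full: "emeasure M (UNIV - N) = 1" by (simp add: space_M)
    have c2
      unfolding c2_def using full sets good sharp_limits_properties(1,2)[OF _ _ assms(4) Spec]
      by (intro bexI[of _ "UNIV - N"]) (auto simp: sets_M)
    moreover have c4
    proof -
      have "UNIV - N \<noteq> {}"
      proof
        assume "UNIV - N = {}"
        with full have "emeasure M {} = 1" by (simp only:)
        then show False by simp
      qed
      then obtain x where "x \<in> UNIV - N" by blast
      from good[OF this] show ?thesis
        unfolding c4_def using sharp_limits_properties(1,3)[OF _ _ assms(4) Spec] by blast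
    qed
    ultimately show ?thesis ..
  qed
  have c1I: c1 if "ww_generic T M x" "\<And>f. spectral_identity T M \<Xi> x f" for x
    unfolding c1_def
  proof (rule spectral_identity_imp_ergodic[OF assms(4), where D=UNIV])
    show "generic_point T M x" using that(1) by (simp add: ww_generic_def fb_generic_def)
    show "convergent (\<lambda>n. fb_avg T f \<xi> n x)" if "\<xi> \<in> \<Xi>" for f \<xi>
      using \<open>ww_generic T M x\<close> assms(4) that by (auto simp: ww_generic_def fb_generic_def)
  qed (use that(2) in auto)
  have 2: c1 if c2
  proof -
    obtain X' where X': "emeasure M X' = 1"
      "\<forall>x\<in>X'. ww_generic T M x \<and> (\<forall>f. spectral_identity T M \<Xi> x f)"
      using \<open>c2\<close> by (auto simp: c2_def)
    then have "X' \<noteq> {}" by auto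
    then show ?thesis using X'(2) c1I by blast
  qed
  have 4: c1 if c4
  proof -
    obtain x where x: "ww_generic T M x" "Freq T x \<subseteq> \<Xi>" using \<open>c4\<close> by (auto simp: c4_def)
    have conv: "convergent (\<lambda>n. fb_avg T f \<xi> n x)" if "\<xi> \<in> sphere 0 1" for f \<xi>
      using x(1) that by (simp add: ww_generic_def fb_generic_def)
    have "spectral_identity T M \<Xi> x f" for f
    proof -
      have "nonneg_sum (\<lambda>\<xi>. (cmod (fb_lim T f \<xi> x))\<^sup>2) (Freq T x)
          = nonneg_sum (\<lambda>\<xi>. (cmod (fb_lim T f \<xi> x))\<^sup>2) \<Xi>"
        using Freq_iff[OF conv] assms(4) by (intro nonneg_sum_support x(2)) auto
      then show ?thesis using x(1) by (simp add: ww_generic_def spectral_identity_def)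
    qed
    with x(1) show ?thesis by (rule c1I)
  qed
  have 3: "c1 \<longleftrightarrow> c3"
  proof
    assume c3
    then obtain x D where x: "generic_point T M x" "closure D = (UNIV :: ('a \<Rightarrow>\<^sub>C complex) set)"
      "\<forall>f\<in>D. \<forall>\<xi>\<in>\<Xi>. convergent (\<lambda>n. fb_avg T f \<xi> n x)"
      "\<forall>f\<in>D. spectral_identity T M \<Xi> x f"
      unfolding c3_def by blast
    show c1 unfolding c1_def using x(3,4) by (intro spectral_identity_imp_ergodic[OF assms(4) x(1,2)]) auto
  next
    assume c1
    with 1 have c2 by blast
    then obtain X' where X': "emeasure M X' = 1"
      "\<forall>x\<in>X'. ww_generic T M x \<and> (\<forall>f. spectral_identity T M \<Xi> x f)"
      by (auto simp: c2_def)
    then have "X' \<noteq> {}" by auto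
    then obtain x where x: "ww_generic T M x" "\<And>f. spectral_identity T M \<Xi> x f" using X'(2) by blast
    obtain D :: "('a \<Rightarrow>\<^sub>C complex) set" where D: "countable D" "closure D = UNIV"
      using separable_bcontfun[OF assms(1)] .
    have "convergent (\<lambda>n. fb_avg T f \<xi> n x)" if "\<xi> \<in> \<Xi>" for f \<xi>
      using x(1) assms(4) that by (auto simp: ww_generic_def fb_generic_def)
    then show c3
      unfolding c3_def using x D
      by (intro exI[of _ x] exI[of _ D]) (auto simp: ww_generic_def fb_generic_def)
  qed
  show ?thesis
    unfolding Let_def c1_def[symmetric] c2_def[symmetric] c3_def[symmetric] c4_def[symmetric]
    using 1 2 3 4 by blast
qed

end
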